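(* There is a universal constant $c>0$ such that the following holds. Let $N\ge 2$, $n\in[N]$, $R, I_1,\dots,I_N\ge 1$ be integers, let $\mathcal{X}\in\mathbb{R}^{I_1\times\cdots\times I_N}$ be a tensor with classical mode-$n$ unfolding $X_{(n)}\in\mathbb{R}^{I_n\times\prod_{j\ne n}I_j}$, let $A^{(j)}\in\mathbb{R}^{I_j\times R}$ for $j\in[N]\setminus\{n\}$, and let $$A^{\ne n} = A^{(N)}\odot\cdots\odot A^{(n+1)}\odot A^{(n-1)}\odot\cdots\odot A^{(1)}\in\mathbb{R}^{(\prod_{j\ne n}I_j)\times R},$$ assumed nonzero. Let $v=(N,\dots,n+1,n-1,\dots,1)$ and let $\varepsilon,\delta\in(0,1)$. Let $\Psi\in\mathbb{R}^{J_1\times\prod_{j\ne n}I_j}$ be a $(J_1,(I_{v(j)})_{j=1}^{N-1})$-recursive sketch, let $\Psi A^{\ne n}=U_1\Sigma_1V_1^\top$ be a compact SVD, and let $\tilde\ell_i(A^{\ne n})=\|e_i^\top A^{\ne n}V_1\Sigma_1^{-1}\|_2^2$ for $i\in[\prod_{j\ne n}I_j]$. Let $S\in\mathbb{R}^{J_2\times\prod_{j\ne n}I_j}$ be a sampling matrix with parameters $(J_2,q)$ (drawn, given $\Psi$, with fresh independent randomness), where $q$ is the probability distribution with $q(i)\propto\tilde\ell_i(A^{\ne n})$. If $$J_1\ge c\,N R^2/\delta,\qquad J_2\ge c\,R\max\big(\log(R/\delta),\,1/(\varepsilon\delta)\big),$$ then $\tilde A\in\operatorname{arg\,min}_{A\in\mathbb{R}^{I_n\times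 R}}\|S A^{\ne n}A^\top - S X_{(n)}^\top\|_F$ satisfies, with probability at least $1-\delta$, $$\|A^{\ne n}\tilde A^\top - X_{(n)}^\top\|_F\le(1+\varepsilon)\min_{A\in\mathbb{R}^{I_n\times R}}\|A^{\ne n}A^\top - X_{(n)}^\top\|_F.$$
   Context: Notation: $[k]=\{1,\dots,k\}$; $e_i$ is the $i$th canonical basis vector; $\otimes$ is the Kronecker product; $\odot$ is the Khatri–Rao (columnwise Kronecker) product, $(A\odot B)(:,r)=A(:,r)\otimes B(:,r)$. For $i_1\in[I_1],\dots,i_M\in[I_M]$, $\overline{i_1\cdots i_M}=1+\sum_{k=1}^M(i_k-1)\prod_{j=1}^{k-1}I_j$ (similarly for any list of indices with given ranges). The classical mode-$n$ unfolding is $X_{(n)}(i_n,\overline{i_1\cdots i_{n-1}i_{n+1}\cdots i_N})=\mathcal{X}(i_1,\dots,i_N)$. A compact SVD $A=U\Sigma V^\top$ has $\Sigma\in\mathbb{R}^{\operatorname{rank}(A)\times\operatorname{rank}(A)}$ and $U,V$ with $\operatorname{rank}(A)$ orthonormal columns. Sampling matrix: given a probability distribution $q$ on $[I]$, let $f:[J]\to[I]$ be random with $f(1),\dots,f(J)$ independent and distributed according to $q$; the sampling matrix with parameters $(J,q)$ is $S\in\mathbb{R}^{J\times I}$, $S(j,i)=\mathbf{1}\{f(j)=i\}/\sqrt{J\,q(f(j))}$. If $\tilde\ell_i(A^{\ne n})=0$ for all $i$ (i.e. $\Psi A^{\ne n}=0$), $q$ is taken to be an arbitrary fixed distribution, e.g.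 uniform. $k$-wise independence: a random function $h:[I]\to B$ ($B$ finite) is $k$-wise independent if for any $k$ distinct $i_1,\dots,i_k\in[I]$ (for all elements of $[I]$ if $I<k$) the values $h(i_1),\dots,h(i_k)$ are independent and uniform on $B$. CountSketch: with $h:[I]\to[J]$ 3-wise independent and $s:[I]\to\{-1,+1\}$ 4-wise independent ($h,s$ independent of each other), it is the matrix $C\in\mathbb{R}^{J\times I}$ with $C(j,i)=s(i)\mathbf{1}\{h(i)=j\}$. Degree-two TensorSketch: with $h_1,h_2:[I]\to[J]$ 3-wise independent and $s_1,s_2:[I]\to\{-1,+1\}$ 4-wise independent (all four mutually independent) and $h(i_1,i_2)=((h_1(i_1)+h_2(i_2))\bmod J)+1$, it is the matrix $T\in\mathbb{R}^{J\times I^2}$ with $T(j,\overline{i_1i_2})=s_1(i_1)s_2(i_2)\mathbf{1}\{h(i_1,i_2)=j\}$. Recursive sketch: let $J,I_1,\dots,I_M$ be positive integers. If $M=2^q$, the $(J,(I_k)_{k=1}^M)$-recursive sketch is the random matrix $\Psi_{J,(I_k)_{k=1}^M}=T^{(q)}T^{(q-1)}\cdots T^{(1)}C\in\mathbb{R}^{J\times\prod_kI_k}$, where $C=C_1\otimes\cdots\otimes C_M$ with $C_k\in\mathbb{R}^{J\times I_k}$ CountSketches, and $T^{(m)}=T^{(m)}_1\otimes\cdots\otimes T^{(m)}_{2^{q-m}}$ with $T^{(m)}_k\in\mathbb{R}^{J\times J^2}$ degree-two TensorSketches, all the $C_k$ and $T^{(m)}_k$ being mutually independent. If $M$ is not a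 power of 2, put $q=\lceil\log_2M\rceil$, $I_{\max}=\max_{k\in[M]}I_k$, $\tilde I_k=I_k$ for $k\le M$, $\tilde I_k=I_{\max}$ for $M<k\le2^q$, and define $\Psi_{J,(I_k)_{k=1}^M}x=\Psi_{J,(\tilde I_k)_{k=1}^{2^q}}(x\otimes e_1^{\otimes(2^q-M)})$ with $e_1\in\mathbb{R}^{I_{\max}}$. *)

theory Defs
  imports
    "HOL-Probability.Probability"
    "Jordan_Normal_Form.Gauss_Jordan_Elimination"
    "Jordan_Normal_Form.DL_Rank"
begin

text \<open>
  Modes, tensor entries, matrix rows and columns, and hash values are all counted from 0.
\<close>

section \<open>Matrices and tensors\<close>

definition frob_norm :: "real mat \<Rightarrow> real" where
  "frob_norm A = sqrt (\<Sum>i<dim_row A. \<Sum>j<dim_col A. (A $$ (i, j))\<^sup>2)"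

definition kron :: "real mat \<Rightarrow> real mat \<Rightarrow> real mat" where
  "kron A B = mat (dim_row A * dim_row B) (dim_col A * dim_col B)
     (\<lambda>(i, j). A $$ (i div dim_row B, j div dim_col B) * B $$ (i mod dim_row B, j mod dim_col B))"

primrec kron_list :: "real mat list \<Rightarrow> real mat" where
  "kron_list [] = 1\<^sub>m 1"
| "kron_list (A # As) = kron A (kron_list As)"

definition kron_vec :: "real Matrix.vec \<Rightarrow> real Matrix.vec \<Rightarrow> real Matrix.vec" where
  "kron_vec x y = Matrix.vec (dim_vec x * dim_vec y)
     (\<lambda>i. vec_index x (i div dim_vec y) * vec_index y (i mod dim_vec y))"

definition khatri_rao :: "real mat \<Rightarrow> real mat \<Rightarrow> real mat" where
  "khatri_rao A B = mat_of_cols (dim_row A * dim_row B)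
     (map (\<lambda>r. kron_vec (col A r) (col B r)) [0..<dim_col A])"

text \<open>The neutral element for matrices with \<open>R\<close> columns is the all-ones row.\<close>
primrec khatri_rao_list :: "nat \<Rightarrow> real mat list \<Rightarrow> real mat" where
  "khatri_rao_list R [] = mat 1 R (\<lambda>_. 1)"
| "khatri_rao_list R (A # As) = khatri_rao A (khatri_rao_list R As)"

definition omit :: "nat \<Rightarrow> 'a list \<Rightarrow> 'a list" where
  "omit n xs = take n xs @ drop (Suc n) xs"

text \<open>The linear index of a multi-index, first index running fastest, and its inverse.\<close>

definition lin_index :: "nat list \<Rightarrow> nat list \<Rightarrow> nat" where
  "lin_index Is is = (\<Sum>k<length Is. is ! k * (\<Prod>j<k. Is ! j))"

definition multi_index :: "nat list \<Rightarrow> nat \<Rightarrow> nat list" where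
  "multi_index Is p = map (\<lambda>k. (p div (\<Prod>j<k. Is ! j)) mod (Is ! k)) [0..<length Is]"

text \<open>
  A tensor of size \<open>Is\<close> is a function on the index lists \<open>is\<close> with \<open>length is = length Is\<close>
  and \<open>is ! k < Is ! k\<close>; its other values are irrelevant.
  The lemma \<open>mode_unfolding_index\<close> below is the usual defining equation of the unfolding.
\<close>
definition mode_unfolding :: "nat list \<Rightarrow> nat \<Rightarrow> (nat list \<Rightarrow> real) \<Rightarrow> real mat" where
  "mode_unfolding Is n X = mat (Is ! n) (prod_list (omit n Is))
     (\<lambda>(i, p). let is = multi_index (omit n Is) p in X (take n is @ i # drop n is))"

lemma lin_index_Nil [simp]: "lin_index [] is = 0"
  by (simp add: lin_index_def)

lemma lin_index_Cons [simp]: "lin_index (I # Is) (i # is) = i + I * lin_index Is is"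
proof -
  have "(\<Prod>j<Suc k. (I # Is) ! j) = I * (\<Prod>j<k. Is ! j)" for k
    by (subst prod.lessThan_Suc_shift) simp
  then show ?thesis
    by (simp add: lin_index_def sum.lessThan_Suc_shift sum_distrib_left mult.assoc mult.left_commute
        del: sum.lessThan_Suc prod.lessThan_Suc)
qed

lemma multi_index_Nil [simp]: "multi_index [] p = []"
  by (simp add: multi_index_def)

lemma multi_index_Cons [simp]: "multi_index (I # Is) p = (p mod I) # multi_index Is (p div I)"
proof -
  have "(\<Prod>j<Suc k. (I # Is) ! j) = I * (\<Prod>j<k. Is ! j)" for k
    by (subst prod.lessThan_Suc_shift) simp
  then show ?thesis
    by (simp add: multi_index_def upt_conv_Cons map_Suc_upt[symmetric] div_mult2_eq comp_def
        del: upt_Suc prod.lessThan_Suc)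
qed

lemma lin_index_less:
  "list_all2 (<) is Is \<Longrightarrow> lin_index Is is < prod_list Is"
proof (induction rule: list_all2_induct)
  case (Cons i "is" I Is)
  have "i + I * lin_index Is is < I + I * lin_index Is is" using Cons by simp
  also have "\<dots> = I * Suc (lin_index Is is)" by simp
  also have "\<dots> \<le> I * prod_list Is" using Cons by (intro mult_le_mono) auto
  finally show ?case by simp
qed simp

lemma multi_index_lin_index:
  "list_all2 (<) is Is \<Longrightarrow> multi_index Is (lin_index Is is) = is"
  by (induction rule: list_all2_induct) auto

lemma mode_unfolding_index:
  assumes "list_all2 (<) is Is" "n < length Is"
  shows "mode_unfolding Is n X $$ (is ! n, lin_index (omit n Is) (omit n is)) = X is"
proof -
  have len: "length is = length Is" using assms(1) by (rule list_all2_lengthD)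
  have om: "list_all2 (<) (omit n is) (omit n Is)"
    unfolding omit_def using assms
    by (intro list_all2_appendI list_all2_takeI list_all2_dropI)
  have "take n (omit n is) @ is ! n # drop n (omit n is) = is"
    using assms(2) len by (simp add: omit_def id_take_nth_drop[symmetric])
  then show ?thesis
    using assms lin_index_less[OF om] list_all2_nthD[OF assms(1), of n] len
    by (simp add: mode_unfolding_def multi_index_lin_index[OF om])
qed

definition is_compact_svd :: "real mat \<Rightarrow> real mat \<Rightarrow> real mat \<Rightarrow> real mat \<Rightarrow> bool" where
  "is_compact_svd A U Sg V \<longleftrightarrow>
     (let r = vec_space.rank (dim_row A) A in
        U \<in> carrier_mat (dim_row A) r \<and> Sg \<in> carrier_mat r r \<and> V \<in> carrier_mat (dim_col A) r \<and>
        transpose_mat U * U = 1\<^sub>m r \<and> transpose_mat V * V = 1\<^sub>m r \<and>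
        diagonal_mat Sg \<and> (\<forall>i<r. Sg $$ (i, i) > 0) \<and>
        A = U * Sg * transpose_mat V)"


section \<open>Random sketches\<close>

text \<open>
  All the random objects here take finitely many values, so they are represented by their laws,
  as probability mass functions; independence of several of them means that their joint law is
  the product \<open>pair_pmf\<close> or \<open>Pi_pmf\<close>.
\<close>

definition k_wise_independent :: "nat \<Rightarrow> nat \<Rightarrow> 'b set \<Rightarrow> (nat \<Rightarrow> 'b) pmf \<Rightarrow> bool" where
  "k_wise_independent k I B H \<longleftrightarrow>
     set_pmf H \<subseteq> {..<I} \<rightarrow>\<^sub>E B \<and>
     (\<forall>K \<subseteq> {..<I}. card K = min k I \<longrightarrow>
        prob_space.indep_vars (measure_pmf H) (\<lambda>_. count_space UNIV) (\<lambda>i h. h i) K \<and>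
        (\<forall>i\<in>K. map_pmf (\<lambda>h. h i) H = pmf_of_set B))"

definition count_sketch_mat :: "nat \<Rightarrow> nat \<Rightarrow> (nat \<Rightarrow> nat) \<Rightarrow> (nat \<Rightarrow> real) \<Rightarrow> real mat" where
  "count_sketch_mat J I h s = mat J I (\<lambda>(j, i). s i * (if h i = j then 1 else 0))"

definition is_count_sketch :: "nat \<Rightarrow> nat \<Rightarrow> real mat pmf \<Rightarrow> bool" where
  "is_count_sketch J I P \<longleftrightarrow>
     (\<exists>H S. k_wise_independent 3 I {..<J} H \<and> k_wise_independent 4 I {-1, 1} S \<and>
        P = map_pmf (\<lambda>(h, s). count_sketch_mat J I h s) (pair_pmf H S))"

text \<open>
  The column \<open>p\<close> has linear index \<open>p = i1 + I * i2\<close>. Hash values counted from 1 would give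
  the combined hash \<open>(h1 i1 + h2 i2) mod J + 1\<close>, hence the two \<open>Suc\<close>s.
\<close>
definition tensor_sketch_mat ::
  "nat \<Rightarrow> nat \<Rightarrow> (nat \<Rightarrow> nat) \<Rightarrow> (nat \<Rightarrow> nat) \<Rightarrow> (nat \<Rightarrow> real) \<Rightarrow> (nat \<Rightarrow> real) \<Rightarrow> real mat" where
  "tensor_sketch_mat J I h1 h2 s1 s2 = mat J (I\<^sup>2)
     (\<lambda>(j, p). let i1 = p mod I; i2 = p div I in
        s1 i1 * s2 i2 * (if (Suc (h1 i1) + Suc (h2 i2)) mod J = j then 1 else 0))"

definition is_tensor_sketch :: "nat \<Rightarrow> nat \<Rightarrow> real mat pmf \<Rightarrow> bool" where
  "is_tensor_sketch J I P \<longleftrightarrow>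
     (\<exists>H1 H2 S1 S2.
        k_wise_independent 3 I {..<J} H1 \<and> k_wise_independent 3 I {..<J} H2 \<and>
        k_wise_independent 4 I {-1, 1} S1 \<and> k_wise_independent 4 I {-1, 1} S2 \<and>
        P = map_pmf (\<lambda>(h1, h2, s1, s2). tensor_sketch_mat J I h1 h2 s1 s2)
              (pair_pmf H1 (pair_pmf H2 (pair_pmf S1 S2))))"

text \<open>
  \<open>sketch_product q C T m\<close> is \<open>T^(m) \<cdots> T^(1) (C 0 \<otimes> \<cdots> \<otimes> C (2^q - 1))\<close>, where \<open>T^(m)\<close> is the
  Kronecker product of the \<open>2^(q - m)\<close> matrices \<open>T (m, k)\<close>.
\<close>
primrec sketch_product ::
  "nat \<Rightarrow> (nat \<Rightarrow> real mat) \<Rightarrow> (nat \<times> nat \<Rightarrow> real mat) \<Rightarrow> nat \<Rightarrow> real mat" where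
  "sketch_product q C T 0 = kron_list (map C [0..<2 ^ q])"
| "sketch_product q C T (Suc m) =
     kron_list (map (\<lambda>k. T (Suc m, k)) [0..<2 ^ (q - Suc m)]) * sketch_product q C T m"

definition is_recursive_sketch_pow2 :: "nat \<Rightarrow> nat list \<Rightarrow> real mat pmf \<Rightarrow> bool" where
  "is_recursive_sketch_pow2 J Is P \<longleftrightarrow>
     (\<exists>q PC PT.
        length Is = 2 ^ q \<and>
        (\<forall>k<2 ^ q. is_count_sketch J (Is ! k) (PC k)) \<and>
        (\<forall>m\<in>{1..q}. \<forall>k<2 ^ (q - m). is_tensor_sketch J J (PT (m, k))) \<and>
        P = map_pmf (\<lambda>(C, T). sketch_product q C T q)
              (pair_pmf (Pi_pmf {..<2 ^ q} (0\<^sub>m 0 0) PC)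
                        (Pi_pmf (SIGMA m:{1..q}. {..<2 ^ (q - m)}) (0\<^sub>m 0 0) PT)))"

text \<open>\<open>pad_sketch d k e Psi\<close> is the matrix of \<open>x \<mapsto> Psi (x \<otimes> e\<^sub>1\<^bsup>\<otimes>k\<^esup>)\<close> for \<open>x \<in> \<real>\<^sup>d\<close>, \<open>e\<^sub>1 \<in> \<real>\<^sup>e\<close>.\<close>
definition pad_sketch :: "nat \<Rightarrow> nat \<Rightarrow> nat \<Rightarrow> real mat \<Rightarrow> real mat" where
  "pad_sketch d k e Psi = mat_of_cols (dim_row Psi)
     (map (\<lambda>j. Psi *\<^sub>v ((\<lambda>y. kron_vec y (unit_vec e 0)) ^^ k) (unit_vec d j)) [0..<d])"

definition is_recursive_sketch :: "nat \<Rightarrow> nat list \<Rightarrow> real mat pmf \<Rightarrow> bool" where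
  "is_recursive_sketch J Is P \<longleftrightarrow>
     (if \<exists>q. length Is = 2 ^ q then is_recursive_sketch_pow2 J Is P
      else let q = nat \<lceil>log 2 (length Is)\<rceil>;
               k = 2 ^ q - length Is;
               Imax = Max (set Is)
           in \<exists>P'. is_recursive_sketch_pow2 J (Is @ replicate k Imax) P' \<and>
                P = map_pmf (pad_sketch (prod_list Is) k Imax) P')"


section \<open>Leverage score sampling\<close>

text \<open>The squared norms of the rows of \<open>A V Sg^(-1)\<close>.\<close>
definition approx_lev_score :: "real mat \<Rightarrow> real mat \<Rightarrow> real mat \<Rightarrow> nat \<Rightarrow> real" where
  "approx_lev_score A Sg V i =
     (let r = row (A * V * the (mat_inverse Sg)) i in scalar_prod r r)"

text \<open>The law on \<open>{..<L}\<close> proportional to \<open>l\<close>; \<open>q0\<close> is used when \<open>l\<close> vanishes.\<close>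
definition proportional_pmf :: "nat \<Rightarrow> (nat \<Rightarrow> real) \<Rightarrow> nat pmf \<Rightarrow> nat pmf" where
  "proportional_pmf L l q0 =
     (if \<forall>i<L. l i = 0 then q0
      else embed_pmf (\<lambda>i. if i < L then l i / (\<Sum>k<L. l k) else 0))"

lemma pmf_proportional_pmf:
  assumes nn: "\<And>i. i < L \<Longrightarrow> l i \<ge> 0" and nz: "\<not> (\<forall>i<L. l i = 0)"
  shows "pmf (proportional_pmf L l q0) i = (if i < L then l i / (\<Sum>k<L. l k) else 0)"
proof -
  let ?f = "\<lambda>i. if i < L then l i / (\<Sum>k<L. l k) else 0"
  have pos: "(\<Sum>k<L. l k) > 0"
    using nz nn by (metis finite_lessThan lessThan_iff order_less_le sum_nonneg sum_nonneg_eq_0_iff)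
  have f0: "?f i \<ge> 0" for i using nn pos by simp
  have "(\<integral>\<^sup>+i. ennreal (?f i) \<partial>count_space UNIV) = (\<Sum>i<L. ennreal (?f i))"
    by (rule nn_integral_count_space'[where A = "{..<L}"]) auto
  also have "\<dots> = ennreal (\<Sum>i<L. ?f i)" using f0 by (intro sum_ennreal) blast
  also have "(\<Sum>i<L. ?f i) = 1" using pos by (simp flip: sum_divide_distrib)
  finally have "(\<integral>\<^sup>+i. ennreal (?f i) \<partial>count_space UNIV) = 1" by simp
  then have "pmf (embed_pmf ?f) i = ?f i" by (intro pmf_embed_pmf f0)
  then show ?thesis using nz by (auto simp add: proportional_pmf_def)
qed

definition sampling_mat :: "nat \<Rightarrow> nat \<Rightarrow> nat pmf \<Rightarrow> (nat \<Rightarrow> nat) \<Rightarrow> real mat" where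
  "sampling_mat J I q f =
     mat J I (\<lambda>(j, i). (if f j = i then 1 else 0) / sqrt (real J * pmf q (f j)))"

definition sampling_pmf :: "nat \<Rightarrow> nat \<Rightarrow> nat pmf \<Rightarrow> real mat pmf" where
  "sampling_pmf J I q = map_pmf (sampling_mat J I q) (Pi_pmf {..<J} 0 (\<lambda>_. q))"

end

theory Submission
  imports Defs
begin

text \<open>
  Let \<open>A\<close> be the Khatri--Rao product. Each CountSketch and TensorSketch \<open>T\<close> preserves \<open>E|Tx|\<^sup>2\<close> and
  satisfies \<open>E|Tx|\<^sup>4 \<le> (1 + 9/J\<^sub>1) |x|\<^sup>4\<close>. Such bounds multiply under products and Kronecker products, so the
  recursive sketch has the constant \<open>g = (1 + 9/J\<^sub>1)\<^sup>4\<^sup>N\<close>. By polarization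
  the inner products of an orthogonal basis of the column space are preserved up to variance \<open>2(g - 1)\<close>,
  and Markov's inequality makes \<open>\<Psi>\<close> a subspace embedding with distortion 1/2 if \<open>J\<^sub>1 \<ge> c N R\<^sup>2/\<delta>\<close>.

  Then \<open>B = A V\<^sub>1 \<Sigma>\<^sub>1\<^sup>-\<^sup>1\<close> has the range of \<open>A\<close> and squared singular values in [2/3, 2], and the sampling
  distribution is the exact row-norm distribution of \<open>B\<close>. Two facts about the sample suffice, as optimality
  of the sketched solution, with error \<open>Z\<close>, gives \<open>|S B Z|\<^sup>2 \<le> 2 |Z| |B\<^sup>T S\<^sup>T S W|\<close> for the optimal
  residual \<open>W\<close>. The first, \<open>|B\<^sup>T S\<^sup>T S W|\<^sup>2 \<le> 6R/(J\<^sub>2 \<delta>) |W|\<^sup>2\<close>, is a variance computation. The second,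
  \<open>|S B y|\<^sup>2 \<ge> |y|\<^sup>2/54\<close> for all \<open>y\<close>, is where the logarithm enters. Instead of the matrix exponential
  one uses the potential \<open>tr M\<^sup>-\<^sup>p\<close> with \<open>p\<close> of order \<open>log(R/\<delta>)\<close>, where \<open>M\<close> is a multiple of the identity plus
  the rank-one samples so far: under a Sherman--Morrison update it drops by at least
  \<open>p/3 v\<^sup>T M\<^sup>-\<^sup>p\<^sup>-\<^sup>1 v\<close>, by log-convexity of the moments \<open>v\<^sup>T M\<^sup>-\<^sup>k v\<close>.
\<close>

section \<open>Rank-one updates and traces of powers\<close>

text \<open>The logarithm shapes the proof: a second-moment bound on the sampled Gram matrix would
  cost J2 of order R^2/\<delta>. But only its smallest eigenvalue matters, which suggests a
  potential that blows up near singularity and that rank-one updates can only decrease. A power of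
  the inverse serves because Sherman--Morrison and Cauchy--Schwarz handle it without eigenvalues.
  The exponent \<open>p\<close> is odd so that \<open>v^T H^(p+1) v\<close> splits into squared
  inner products, to which the second-moment bound on a random row applies. The term
  1/(\<epsilon>\<delta>) comes from Markov's inequality for the residual term.

  The number 9 is 3 * 3, one fourth-moment constant for each sign sequence of a TensorSketch. The
  exponent 4N counts matrices in the sketch tree: with 2^q leaves there are fewer than 2 * 2^q of
  them, and padding less than doubles the leaves. The failure budget \<delta> is cut in three:
  embedding, spectral bound, variance bound.\<close>

text \<open>Vectors of \<open>\<real>\<^sup>r\<close> are functions on the natural numbers whose values from \<open>r\<close> on are ignored.\<close>
definition ip :: "nat \<Rightarrow> (nat \<Rightarrow> real) \<Rightarrow> (nat \<Rightarrow> real) \<Rightarrow> real" where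
  "ip r x y = (\<Sum>i<r. x i * y i)"

lemma ip_commute: "ip r x y = ip r y x"
  by (simp add: ip_def mult.commute)

lemma ip_lincomb_right: "ip r x (\<lambda>i. a * y i + b * z i) = a * ip r x y + b * ip r x z"
  by (simp add: ip_def algebra_simps sum.distrib sum_distrib_left)

lemma ip_lincomb_left: "ip r (\<lambda>i. a * y i + b * z i) x = a * ip r y x + b * ip r z x"
  by (simp add: ip_commute[of r _ x] ip_lincomb_right)

lemma ip_diff_scale_right: "ip r x (\<lambda>i. y i - b * z i) = ip r x y - b * ip r x z"
  by (simp add: ip_def algebra_simps sum_subtractf sum_distrib_left)

lemma ip_diff_scale_left: "ip r (\<lambda>i. y i - b * z i) x = ip r y x - b * ip r z x"
  by (simp add: ip_commute[of r _ x] ip_diff_scale_right)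

lemma ip_self_nonneg [simp]: "ip r x x \<ge> 0"
  by (simp add: ip_def sum_nonneg)

section \<open>Positive semidefinite operators, their moments and traces\<close>

definition bvec :: "nat \<Rightarrow> nat \<Rightarrow> real" where
  "bvec i = (\<lambda>j. if j = i then 1 else 0)"

lemma ip_bvec_left: "i < r \<Longrightarrow> ip r (bvec i) x = x i"
  by (simp add: ip_def bvec_def if_distrib[of "\<lambda>t. t * _"] sum.delta cong: if_cong)

text \<open>Operators act on functions, so that powers are iterates \<open>H ^^ k\<close>. Linearity
  is an equation between whole functions, including the ignored indices, and so can be rewritten
  inside an iterate.\<close>

definition psd_op :: "nat \<Rightarrow> ((nat \<Rightarrow> real) \<Rightarrow> nat \<Rightarrow> real) \<Rightarrow> bool" where
  "psd_op r H \<longleftrightarrow>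
     (\<forall>a x b y. H (\<lambda>i. a * x i + b * y i) = (\<lambda>i. a * H x i + b * H y i)) \<and>
     (\<forall>x y. ip r (H x) y = ip r x (H y)) \<and> (\<forall>x. ip r x (H x) \<ge> 0)"

lemma psd_op_lin: "psd_op r H \<Longrightarrow> H (\<lambda>i. a * x i + b * y i) = (\<lambda>i. a * H x i + b * H y i)"
  and psd_op_sym: "psd_op r H \<Longrightarrow> ip r (H x) y = ip r x (H y)"
  and psd_op_nonneg: "psd_op r H \<Longrightarrow> ip r x (H x) \<ge> 0"
  by (auto simp: psd_op_def)

lemma psd_op_pow_sym: "psd_op r H \<Longrightarrow> ip r ((H ^^ k) x) y = ip r x ((H ^^ k) y)"
proof (induction k arbitrary: y)
  case (Suc k)
  then have "ip r ((H ^^ Suc k) x) y = ip r x ((H ^^ k) (H y))" by (simp add: psd_op_sym)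
  then show ?case by (simp add: funpow_swap1)
qed simp

lemma psd_op_pow_shift:
  "psd_op r H \<Longrightarrow> ip r ((H ^^ j) x) ((H ^^ k) y) = ip r x ((H ^^ (j + k)) y)"
  by (simp add: psd_op_pow_sym funpow_add)

text \<open>For k = 2m the form is the squared length of \<open>H^m x\<close>; for k = 2m + 1 it is
  the form of \<open>H\<close> at \<open>H^m x\<close>.\<close>

lemma psd_op_pow:
  assumes "psd_op r H" shows "psd_op r (H ^^ k)"
proof -
  have lin: "(H ^^ k) (\<lambda>i. a * x i + b * y i) = (\<lambda>i. a * (H ^^ k) x i + b * (H ^^ k) y i)" for a x b y
    by (induction k) (auto simp: psd_op_lin[OF assms])
  have nn: "ip r x ((H ^^ k) x) \<ge> 0" for x
  proof (cases "even k")
    case True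
    then obtain m where "k = m + m" by (metis evenE mult_2)
    then show ?thesis by (simp flip: psd_op_pow_shift[OF assms])
  next
    case False
    then obtain m where "k = m + Suc m" by (metis oddE mult_2 add_Suc_right Suc_eq_plus1)
    then have "ip r x ((H ^^ k) x) = ip r ((H ^^ m) x) ((H ^^ Suc m) x)"
      by (simp only: psd_op_pow_shift[OF assms])
    then show ?thesis using psd_op_nonneg[OF assms] by simp
  qed
  show ?thesis unfolding psd_op_def using lin nn psd_op_pow_sym[OF assms] by blast
qed

text \<open>The form is nonnegative on the span of x and y. Since \<open>H\<close> may be singular,
  a vanishing form at y needs its own case.\<close>

lemma psd_op_CS:
  assumes "psd_op r H"
  shows "(ip r x (H y))\<^sup>2 \<le> ip r x (H x) * ip r y (H y)"
proof -
  have expand: "ip r (\<lambda>i. a * x i + b * y i) (H (\<lambda>i. a * x i + b * y i)) =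
      a\<^sup>2 * ip r x (H x) + 2 * a * b * ip r x (H y) + b\<^sup>2 * ip r y (H y)" for a b
    using psd_op_sym[OF assms, of y x] ip_commute[of r y "H x"] ip_commute[of r "H y" x]
    by (simp add: psd_op_lin[OF assms] ip_lincomb_left ip_lincomb_right algebra_simps power2_eq_square)
  have nn: "a\<^sup>2 * ip r x (H x) + 2 * a * b * ip r x (H y) + b\<^sup>2 * ip r y (H y) \<ge> 0" for a b
    unfolding expand[symmetric] by (rule psd_op_nonneg[OF assms])
  define p q s where "p = ip r x (H x)" and "q = ip r x (H y)" and "s = ip r y (H y)"
  have nn: "a\<^sup>2 * p + 2 * a * b * q + b\<^sup>2 * s \<ge> 0" for a b using nn p_def q_def s_def by simp
  have "q\<^sup>2 \<le> p * s"
  proof (cases "s = 0")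
    case True
    have "q = 0"
    proof (rule ccontr)
      assume "q \<noteq> 0"
      \<comment> \<open>With this b the form at x + b y would be p - (p + 1) = -1.\<close>
      then have "2 * (- (p + 1) / (2 * q)) * q = - (p + 1)" by (simp add: field_simps)
      with nn[of 1 "- (p + 1) / (2 * q)"] True show False by simp
    qed
    then show ?thesis using True by simp
  next
    case False
    then have "s > 0" using psd_op_nonneg[OF assms, of y] s_def by simp
    have "s * (p * s - q\<^sup>2) \<ge> 0"
      using nn[of s "-q"] by (simp add: power2_eq_square algebra_simps)
    then show ?thesis using \<open>s > 0\<close> by (simp add: zero_le_mult_iff)
  qed
  then show ?thesis by (simp add: p_def q_def s_def)
qed

lemma psd_op_CS_id: "(ip r x y)\<^sup>2 \<le> ip r x x * ip r y y"
  using psd_op_CS[of r "\<lambda>x. x" x y] by (simp add: psd_op_def)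

text \<open>The ratios a(k+1)/a(k) are nondecreasing; they are cross-multiplied because moments may
  vanish.\<close>

lemma log_convex_ratio:
  fixes a :: "nat \<Rightarrow> real"
  assumes nn: "\<And>k. a k \<ge> 0" and lc: "\<And>k. (a (Suc k))\<^sup>2 \<le> a k * a (Suc (Suc k))" and "i \<le> j"
  shows "a (Suc i) * a j \<le> a i * a (Suc j)"
  using \<open>i \<le> j\<close>
proof (induction j rule: dec_induct)
  case (step j)
  show ?case
  proof (cases "a j = 0")
    case True
    then have "a (Suc j) = 0" using lc[of j] by simp
    then show ?thesis using nn by simp
  next
    case False
    then have pos: "a j > 0" using nn[of j] by simp
    have "(a (Suc i) * a (Suc j)) * a j = (a (Suc i) * a j) * a (Suc j)" by simp
    also have "\<dots> \<le> (a i * a (Suc j)) * a (Suc j)" using step nn by (intro mult_right_mono) auto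
    also have "\<dots> = a i * (a (Suc j))\<^sup>2" by (simp add: power2_eq_square)
    also have "\<dots> \<le> a i * (a j * a (Suc (Suc j)))" by (intro mult_left_mono lc nn)
    finally have "(a (Suc i) * a (Suc j)) * a j \<le> (a i * a (Suc (Suc j))) * a j"
      by (simp add: algebra_simps)
    then show ?thesis using pos by simp
  qed
qed simp

text \<open>The two indices are moved apart one step at a time until the smaller is 0.\<close>

lemma log_convex_prod_le:
  fixes a :: "nat \<Rightarrow> real"
  assumes nn: "\<And>k. a k \<ge> 0" and lc: "\<And>k. (a (Suc k))\<^sup>2 \<le> a k * a (Suc (Suc k))"
  shows "a d * a e \<le> a 0 * a (d + e)"
proof -
  have "d \<le> e \<Longrightarrow> a d * a e \<le> a 0 * a (d + e)" for d e
  proof (induction d arbitrary: e)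
    case (Suc d)
    have "a (Suc d) * a e \<le> a d * a (Suc e)"
      using Suc.prems by (intro log_convex_ratio nn lc) auto
    also have "\<dots> \<le> a 0 * a (d + Suc e)" using Suc.prems by (intro Suc.IH) simp
    finally show ?case by simp
  qed simp
  then show ?thesis
    by (metis add.commute linorder_le_cases mult.commute)
qed

text \<open>Cauchy--Schwarz for \<open>H^m x\<close> and \<open>H^(m+1) x\<close>, in the standard
  inner product if k = 2m and in the form of \<open>H\<close> if k = 2m + 1.\<close>

lemma psd_op_moments_log_convex:
  assumes "psd_op r H"
  shows "(ip r x ((H ^^ Suc k) x))\<^sup>2 \<le> ip r x ((H ^^ k) x) * ip r x ((H ^^ Suc (Suc k)) x)"
proof (cases "even k")
  case True
  then obtain m where m: "k = m + m" by (metis evenE mult_2)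
  have "(ip r ((H ^^ m) x) ((H ^^ Suc m) x))\<^sup>2 \<le>
      ip r ((H ^^ m) x) ((H ^^ m) x) * ip r ((H ^^ Suc m) x) ((H ^^ Suc m) x)"
    by (rule psd_op_CS_id)
  then show ?thesis unfolding psd_op_pow_shift[OF assms] by (simp add: m)
next
  case False
  then obtain m where m: "k = m + Suc m" by (metis oddE mult_2 add_Suc_right Suc_eq_plus1)
  have "(ip r ((H ^^ m) x) (H ((H ^^ Suc m) x)))\<^sup>2 \<le>
      ip r ((H ^^ m) x) (H ((H ^^ m) x)) * ip r ((H ^^ Suc m) x) (H ((H ^^ Suc m) x))"
    by (rule psd_op_CS[OF assms])
  then have "(ip r ((H ^^ m) x) ((H ^^ Suc (Suc m)) x))\<^sup>2 \<le>
      ip r ((H ^^ m) x) ((H ^^ Suc m) x) * ip r ((H ^^ Suc m) x) ((H ^^ Suc (Suc m)) x)"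
    by simp
  then show ?thesis unfolding psd_op_pow_shift[OF assms] by (simp add: m)
qed

lemma psd_op_moments_nonneg: "psd_op r H \<Longrightarrow> ip r x ((H ^^ k) x) \<ge> 0"
  by (rule psd_op_nonneg[OF psd_op_pow])

definition tr_op :: "nat \<Rightarrow> ((nat \<Rightarrow> real) \<Rightarrow> nat \<Rightarrow> real) \<Rightarrow> real" where
  "tr_op r H = (\<Sum>i<r. ip r (bvec i) (H (bvec i)))"

text \<open>Replaces "the largest eigenvalue is at most the trace". Cauchy--Schwarz for
  \<open>G\<close> against each basis vector gives |Gy|^2 \<le> tr G * y^T G y; Cauchy--Schwarz for
  y and Gy does the rest.\<close>

lemma psd_op_le_trace:
  assumes "psd_op r G"
  shows "ip r y (G y) \<le> tr_op r G * ip r y y"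
proof -
  let ?g = "ip r y (G y)"
  have g0: "?g \<ge> 0" by (rule psd_op_nonneg[OF assms])
  have "ip r (G y) (G y) = (\<Sum>i<r. (ip r (bvec i) (G y))\<^sup>2)"
    by (simp add: ip_bvec_left) (simp add: ip_def power2_eq_square)
  also have "\<dots> \<le> (\<Sum>i<r. ip r (bvec i) (G (bvec i)) * ?g)"
    by (intro sum_mono psd_op_CS assms)
  also have "\<dots> = tr_op r G * ?g" by (simp add: tr_op_def sum_distrib_right)
  finally have "ip r y y * ip r (G y) (G y) \<le> ip r y y * (tr_op r G * ?g)"
    by (rule mult_left_mono) simp
  with psd_op_CS_id[of r y "G y"] have "?g * ?g \<le> (tr_op r G * ip r y y) * ?g"
    by (simp add: power2_eq_square mult_ac)
  moreover have "tr_op r G * ip r y y \<ge> 0"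
    by (auto simp: tr_op_def intro!: mult_nonneg_nonneg sum_nonneg psd_op_nonneg[OF assms])
  ultimately show ?thesis using g0 by (cases "?g = 0") (auto simp: mult_le_cancel_right)
qed

text \<open>A violating y has first moment above h |y|^2. Log-convexity propagates this to y^T H^p y
  > h^p |y|^2, against the trace bound.\<close>

lemma psd_op_bound_of_trace_pow:
  assumes H: "psd_op r H" and tr: "tr_op r (H ^^ p) \<le> h ^ p" and "h > 0" "p > 0"
  shows "ip r y (H y) \<le> h * ip r y y"
proof (rule ccontr)
  let ?g = "\<lambda>k. ip r y ((H ^^ k) y)"
  assume "\<not> ?thesis"
  then have gt: "?g 1 > h * ?g 0" by simp
  have g0: "?g 0 > 0"
  proof (rule ccontr)
    assume "\<not> ?g 0 > 0"
    then have "?g 0 = 0" using ip_self_nonneg[of r y] by simp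
    then have "(?g 1)\<^sup>2 \<le> 0" using psd_op_moments_log_convex[OF H, of y 0] by simp
    then show False using gt \<open>?g 0 = 0\<close> by simp
  qed
  have "0 < h * ?g 0" using g0 \<open>h > 0\<close> by (intro mult_pos_pos)
  then have g1: "?g 1 > 0" using gt by linarith
  have "?g k > h ^ k * ?g 0 \<or> k = 0" for k
  proof (induction k)
    case (Suc k)
    show ?case
    proof (cases "k = 0")
      case True then show ?thesis using gt by simp
    next
      case False
      then have k: "?g k > h ^ k * ?g 0" using Suc by simp
      have "h ^ Suc k * ?g 0 * ?g 0 = (h * ?g 0) * (h ^ k * ?g 0)" by simp
      also have "\<dots> < ?g 1 * ?g k"
        using gt k g0 g1 \<open>h > 0\<close> by (intro mult_strict_mono) auto
      also have "\<dots> \<le> ?g 0 * ?g (Suc k)"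
        using log_convex_ratio[of ?g 0 k]
          psd_op_moments_nonneg[OF H] psd_op_moments_log_convex[OF H] by simp
      finally have "(h ^ Suc k * ?g 0) * ?g 0 < ?g (Suc k) * ?g 0" by (simp only: mult.commute)
      then have "h ^ Suc k * ?g 0 < ?g (Suc k)" using g0 by (simp only: mult_less_cancel_right_pos)
      then show ?thesis by simp
    qed
  qed simp
  from this[of p] have "?g p > h ^ p * ?g 0" using \<open>p > 0\<close> by simp
  moreover have "?g p \<le> tr_op r (H ^^ p) * ?g 0"
    using psd_op_le_trace[OF psd_op_pow[OF H]] by simp
  moreover have "\<dots> \<le> h ^ p * ?g 0" using tr g0 by (intro mult_right_mono) auto
  ultimately show False by simp
qed

text \<open>For each eigenvalue x this is x^(p+1) \<ge> s x^p - s^(p+1). A bound linear in tr H^p is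
  wanted, because it passes through expectations. Without eigenvalues: the differences d(k) = tr
  H^(k+1) - s tr H^k satisfy d(k+1) \<ge> s d(k).\<close>

lemma trace_pow_Suc_ge:
  assumes "psd_op r H" "s \<ge> 0"
  shows "tr_op r (H ^^ Suc p) \<ge> s * tr_op r (H ^^ p) - real r * s ^ Suc p"
proof -
  let ?t = "\<lambda>k. tr_op r (H ^^ k)"
  have conv: "?t (Suc (Suc k)) - 2 * s * ?t (Suc k) + s\<^sup>2 * ?t k \<ge> 0" for k
  proof -
    have "0 \<le> ip r e ((H ^^ Suc (Suc k)) e) - 2 * s * ip r e ((H ^^ Suc k) e) + s\<^sup>2 * ip r e ((H ^^ k) e)" for e
    proof -
      \<comment> \<open>The vector (H - s) e; the form of H^k at it is the second difference to be
        bounded.\<close>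
      let ?z = "\<lambda>i. 1 * H e i + (- s) * e i"
      have shift: "ip r (H e) ((H ^^ k) e) = ip r e ((H ^^ Suc k) e)"
        "ip r (H e) ((H ^^ k) (H e)) = ip r e ((H ^^ Suc (Suc k)) e)"
        "ip r e ((H ^^ k) (H e)) = ip r e ((H ^^ Suc k) e)"
        by (simp_all add: psd_op_sym[OF assms(1)] flip: funpow_swap1)
      have "0 \<le> ip r ?z ((H ^^ k) ?z)" by (rule psd_op_moments_nonneg[OF assms(1)])
      also have "\<dots> = ip r e ((H ^^ Suc (Suc k)) e) - 2 * s * ip r e ((H ^^ Suc k) e) + s\<^sup>2 * ip r e ((H ^^ k) e)"
        unfolding psd_op_lin[OF psd_op_pow[OF assms(1)]] ip_lincomb_left ip_lincomb_right shift
        by (simp add: algebra_simps power2_eq_square)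
      finally show ?thesis .
    qed
    then have "0 \<le> (\<Sum>i<r. ip r (bvec i) ((H ^^ Suc (Suc k)) (bvec i))
        - 2 * s * ip r (bvec i) ((H ^^ Suc k) (bvec i)) + s\<^sup>2 * ip r (bvec i) ((H ^^ k) (bvec i)))"
      by (intro sum_nonneg) blast
    then show ?thesis unfolding tr_op_def by (simp add: sum.distrib sum_subtractf sum_distrib_left)
  qed
  have "?t (Suc k) - s * ?t k \<ge> - real r * s ^ Suc k" for k
  proof (induction k)
    case 0
    have "?t 0 = real r" by (simp add: tr_op_def ip_bvec_left) (simp add: bvec_def)
    moreover have "tr_op r H \<ge> 0" unfolding tr_op_def
      by (intro sum_nonneg psd_op_nonneg assms)
    ultimately show ?case by (simp add: id_def comp_def)
  next
    case (Suc k)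
    have "?t (Suc (Suc k)) - s * ?t (Suc k) \<ge> s * (?t (Suc k) - s * ?t k)"
      using conv[of k] by (simp add: algebra_simps power2_eq_square)
    moreover have "s * (?t (Suc k) - s * ?t k) \<ge> s * (- real r * s ^ Suc k)"
      using Suc assms(2) by (intro mult_left_mono)
    moreover have "s * (- real r * s ^ Suc k) = - real r * s ^ Suc (Suc k)" by simp
    ultimately show ?case by linarith
  qed
  from this[of p] show ?thesis by simp
qed

text \<open>The Sherman--Morrison update: if \<open>H\<close> is the inverse of \<open>M\<close>, this is the inverse of \<open>M + v v\<^sup>T\<close>.\<close>
definition sm_update ::
  "nat \<Rightarrow> ((nat \<Rightarrow> real) \<Rightarrow> nat \<Rightarrow> real) \<Rightarrow> (nat \<Rightarrow> real) \<Rightarrow> (nat \<Rightarrow> real) \<Rightarrow> nat \<Rightarrow> real" where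
  "sm_update r H v x = (\<lambda>i. H x i - ip r (H v) x / (1 + ip r v (H v)) * H v i)"

lemma ip_sm_update:
  "ip r y (sm_update r H v x) = ip r y (H x) - ip r (H v) x * ip r y (H v) / (1 + ip r v (H v))"
  unfolding sm_update_def ip_diff_scale_right by simp

lemma sm_update_le:
  assumes "psd_op r H"
  shows "ip r x (sm_update r H v x) \<le> ip r x (H x)"
proof -
  have "ip r (H v) x * ip r x (H v) / (1 + ip r v (H v)) \<ge> 0"
    using psd_op_nonneg[OF assms, of v] by (simp add: ip_commute[of r "H v"])
  then show ?thesis by (simp add: ip_sm_update)
qed

lemma psd_op_sm_update:
  assumes "psd_op r H"
  shows "psd_op r (sm_update r H v)"
  unfolding psd_op_def
proof (intro conjI allI)
  fix a x b y
  show "sm_update r H v (\<lambda>i. a * x i + b * y i) =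
      (\<lambda>i. a * sm_update r H v x i + b * sm_update r H v y i)"
    by (simp add: sm_update_def psd_op_lin[OF assms] ip_lincomb_right fun_eq_iff add_divide_distrib
        algebra_simps)
next
  fix x y
  show "ip r (sm_update r H v x) y = ip r x (sm_update r H v y)"
    unfolding ip_commute[of r _ y] ip_sm_update psd_op_sym[OF assms, of x y, unfolded ip_commute[of r _ y]]
    by (simp add: ip_commute mult.commute)
next
  fix x
  let ?a = "ip r v (H v)"
  have a: "?a \<ge> 0" by (rule psd_op_nonneg[OF assms])
  have x: "ip r x (H x) \<ge> 0" by (rule psd_op_nonneg[OF assms])
  have "(ip r x (H v))\<^sup>2 \<le> ip r x (H x) * ?a" by (rule psd_op_CS[OF assms])
  also have "\<dots> \<le> ip r x (H x) * (1 + ?a)" using x by (simp add: algebra_simps)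
  finally have "(ip r x (H v))\<^sup>2 / (1 + ?a) \<le> ip r x (H x)" using a by (simp add: divide_le_eq)
  then show "ip r x (sm_update r H v x) \<ge> 0"
    by (simp add: ip_sm_update ip_commute[of r "H v"] power2_eq_square)
qed

text \<open>Telescoping of H^p - H'^p into terms H^(p-1-k) (H - H') H'^k, where H - H' = t u u^T has
  rank one.\<close>

lemma pow_diff_sm_update:
  fixes v :: "nat \<Rightarrow> real"
  assumes "psd_op r H"
  defines "H' \<equiv> sm_update r H v" and "u \<equiv> H v" and "t \<equiv> 1 / (1 + ip r v (H v))"
  shows "ip r y ((H ^^ p) x) - ip r y ((H' ^^ p) x) =
    (\<Sum>k<p. t * ip r ((H' ^^ k) u) x * ip r y ((H ^^ (p - 1 - k)) u))"
proof (induction p arbitrary: y)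
  case (Suc p)
  have H': "psd_op r H'" unfolding H'_def by (rule psd_op_sm_update[OF assms(1)])
  have "ip r y ((H ^^ Suc p) x) - ip r y ((H' ^^ Suc p) x) =
     (ip r (H y) ((H ^^ p) x) - ip r (H y) ((H' ^^ p) x)) +
     (ip r y (H ((H' ^^ p) x)) - ip r y (H' ((H' ^^ p) x)))"
    by (simp add: psd_op_sym[OF assms(1)])
  also have "ip r y (H ((H' ^^ p) x)) - ip r y (H' ((H' ^^ p) x)) = t * ip r ((H' ^^ p) u) x * ip r y u"
    unfolding H'_def ip_sm_update unfolding H'_def[symmetric]
    by (simp add: t_def u_def psd_op_pow_sym[OF H'])
  also have "ip r (H y) ((H ^^ p) x) - ip r (H y) ((H' ^^ p) x) =
    (\<Sum>k<p. t * ip r ((H' ^^ k) u) x * ip r (H y) ((H ^^ (p - 1 - k)) u))" by (rule Suc.IH)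
  also have "\<dots> = (\<Sum>k<p. t * ip r ((H' ^^ k) u) x * ip r y ((H ^^ (Suc p - 1 - k)) u))"
  proof (intro sum.cong refl)
    fix k assume "k \<in> {..<p}"
    then have "Suc p - 1 - k = Suc (p - 1 - k)" by auto
    then show "t * ip r ((H' ^^ k) u) x * ip r (H y) ((H ^^ (p - 1 - k)) u) =
        t * ip r ((H' ^^ k) u) x * ip r y ((H ^^ (Suc p - 1 - k)) u)"
      by (simp only: psd_op_sym[OF assms(1)] funpow.simps comp_def)
  qed
  finally show ?case by simp
qed simp

text \<open>Every telescoped term has rank one, so its trace is a single inner product.\<close>

lemma trace_pow_sm_update:
  fixes v :: "nat \<Rightarrow> real"
  assumes "psd_op r H"
  defines "H' \<equiv> sm_update r H v" and "u \<equiv> H v" and "t \<equiv> 1 / (1 + ip r v (H v))"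
  shows "tr_op r (H ^^ p) - tr_op r (H' ^^ p) =
    (\<Sum>k<p. t * ip r ((H ^^ (p - 1 - k)) u) ((H' ^^ k) u))"
proof -
  have "tr_op r (H ^^ p) - tr_op r (H' ^^ p) =
     (\<Sum>i<r. \<Sum>k<p. t * ip r ((H' ^^ k) u) (bvec i) * ip r (bvec i) ((H ^^ (p - 1 - k)) u))"
    unfolding tr_op_def sum_subtractf[symmetric] H'_def u_def t_def
    by (intro sum.cong refl pow_diff_sm_update assms)
  also have "\<dots> = (\<Sum>k<p. t * (\<Sum>i<r. (H ^^ (p - 1 - k)) u i * (H' ^^ k) u i))"
    by (subst sum.swap) (simp add: ip_bvec_left ip_commute[of r _ "bvec _"] sum_distrib_left mult_ac)
  finally show ?thesis by (simp add: ip_def)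
qed

text \<open>Moving one factor \<open>H'\<close> to the other side costs at most \<open>a/(1+a)\<close>, because the moments of \<open>H\<close>
  are log-convex.\<close>
lemma sm_update_mixed_moment:
  fixes v :: "nat \<Rightarrow> real"
  assumes H: "psd_op r H"
  defines "H' \<equiv> sm_update r H v" and "u \<equiv> H v" and "a \<equiv> ip r v (H v)"
  shows "ip r ((H ^^ m) u) ((H' ^^ k) u) \<ge> (1 - real k * (a / (1 + a))) * ip r v ((H ^^ (m + k + 2)) v)"
proof -
  have H': "psd_op r H'" unfolding H'_def by (rule psd_op_sm_update[OF assms(1)])
  have a: "a \<ge> 0" unfolding a_def by (rule psd_op_nonneg[OF H])
  let ?g = "\<lambda>k. ip r v ((H ^^ k) v)"
  let ?n = "\<lambda>k m. ip r ((H ^^ m) u) ((H' ^^ k) u)"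
  have gnn: "?g k \<ge> 0" for k by (rule psd_op_moments_nonneg[OF H])
  have mu: "ip r ((H ^^ m) u) u = ?g (m + 2)" for m
  proof -
    have "ip r ((H ^^ m) u) u = ip r ((H ^^ Suc m) v) ((H ^^ 1) v)" by (simp add: u_def funpow_swap1)
    then show ?thesis unfolding psd_op_pow_shift[OF H] by simp
  qed
  \<comment> \<open>Expands the outermost H' as H minus its rank-one part and moves H to the left
    factor.\<close>
  have rec: "?n (Suc k) m = ?n k (Suc m) - 1 / (1 + a) * ?n k 0 * ?g (m + 2)" for k m
  proof -
    have "?n (Suc k) m = ip r ((H ^^ m) u) (H ((H' ^^ k) u)) -
        ip r u ((H' ^^ k) u) * ip r ((H ^^ m) u) u / (1 + a)"
      by (simp add: H'_def ip_sm_update u_def a_def)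
    then show ?thesis by (simp add: psd_op_sym[OF H] mu)
  qed
  have n0: "?n k 0 \<ge> 0" for k using psd_op_moments_nonneg[OF H'] by simp
  have upper: "?n k m \<le> ?g (m + k + 2)" for k m
  proof (induction k arbitrary: m)
    case 0 then show ?case by (simp add: mu)
  next
    case (Suc k)
    have "?n (Suc k) m \<le> ?n k (Suc m)" unfolding rec using n0[of k] gnn[of "m + 2"] a by simp
    also have "\<dots> \<le> ?g (Suc m + k + 2)" by (rule Suc)
    finally show ?case by simp
  qed
  show "?n k m \<ge> (1 - real k * (a / (1 + a))) * ?g (m + k + 2)"
  proof (induction k arbitrary: m)
    case 0 then show ?case by (simp add: mu)
  next
    case (Suc k)
    \<comment> \<open>Log-convexity is applied to the moments shifted by one, which start with g(1)
      = a. This turns the product of two moments into a times one moment.\<close>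
    have "?g (Suc (k + 1)) * ?g (Suc (m + 1)) \<le> ?g (Suc 0) * ?g (Suc (k + 1 + (m + 1)))"
      using psd_op_moments_nonneg[OF H] psd_op_moments_log_convex[OF H]
      by (intro log_convex_prod_le[of "\<lambda>k. ?g (Suc k)"])
    then have gg: "?g (k + 2) * ?g (m + 2) \<le> a * ?g (Suc m + k + 2)"
      by (simp add: a_def add.commute)
    have "?n k 0 * ?g (m + 2) \<le> ?g (k + 2) * ?g (m + 2)"
      using upper[of 0 k] gnn[of "m + 2"] by (intro mult_right_mono) auto
    also note gg
    finally have "1 / (1 + a) * (?n k 0 * ?g (m + 2)) \<le> 1 / (1 + a) * (a * ?g (Suc m + k + 2))"
      using a by (intro mult_left_mono) auto
    moreover have "?n k (Suc m) \<ge> (1 - real k * (a / (1 + a))) * ?g (Suc m + k + 2)" by (rule Suc)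
    moreover have "(1 - real (Suc k) * (a / (1 + a))) * ?g (Suc m + k + 2) =
       (1 - real k * (a / (1 + a))) * ?g (Suc m + k + 2) - 1 / (1 + a) * (a * ?g (Suc m + k + 2))"
      by (simp add: algebra_simps add_divide_distrib)
    ultimately show ?case unfolding rec by simp
  qed
qed

text \<open>With a \<le> 1/(2p) a mixed moment keeps at least half of its value, and 1/(1+a) \<ge>
  2/3. Hence each of the p terms is at least a third of \<open>v^T H^(p+1) v\<close>.\<close>

lemma trace_pow_sm_update_le:
  assumes H: "psd_op r H" and a: "ip r v (H v) \<le> 1 / (2 * real p)" and p: "p > 0"
  shows "tr_op r (sm_update r H v ^^ p) \<le> tr_op r (H ^^ p) - real p / 3 * ip r v ((H ^^ Suc p) v)"
proof -
  let ?a = "ip r v (H v)"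
  let ?m = "\<lambda>k. ip r ((H ^^ (p - 1 - k)) (H v)) ((sm_update r H v ^^ k) (H v))"
  let ?g = "ip r v ((H ^^ Suc p) v)"
  have a0: "?a \<ge> 0" by (rule psd_op_nonneg[OF H])
  have "1 / (2 * real p) \<le> 1 / 2" using p by (simp add: field_simps)
  then have a1: "?a \<le> 1 / 2" using a by linarith
  have g0: "?g \<ge> 0" by (rule psd_op_moments_nonneg[OF H])
  have t: "1 / (1 + ?a) \<ge> 2 / 3" using a0 a1 by (simp add: field_simps)
  have "(\<Sum>k<p. 1 / 3 * ?g) \<le>
    (\<Sum>k<p. 1 / (1 + ?a) * ?m k)"
  proof (intro sum_mono)
    fix k assume "k \<in> {..<p}"
    then have k: "k < p" "p - 1 - k + k + 2 = Suc p" by auto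
    have "real k * (?a / (1 + ?a)) \<le> real p * ?a"
      using a0 k by (intro mult_mono) (auto simp: field_simps)
    also have "\<dots> \<le> 1 / 2" using a p by (simp add: field_simps)
    finally have "1 / 2 * ?g \<le> (1 - real k * (?a / (1 + ?a))) * ?g"
      using g0 by (intro mult_right_mono) auto
    also have "\<dots> \<le> ?m k"
      using sm_update_mixed_moment[OF H, of k v "p - 1 - k"] unfolding k(2) .
    finally have *: "1 / 2 * ?g \<le> ?m k" .
    have "1 / 3 * ?g = 2 / 3 * (1 / 2 * ?g)" by simp
    also have "\<dots> \<le> 1 / (1 + ?a) * ?m k"
      using t * g0 a0 by (intro mult_mono) auto
    finally show "1 / 3 * ?g \<le> 1 / (1 + ?a) * ?m k" .
  qed
  then show ?thesis using trace_pow_sm_update[OF H, of p v] by simp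
qed

text \<open>The inverse of M = c I + sum over i < j of v_i v_i^T, built by updates from I/c.\<close>

primrec sm_iter :: "nat \<Rightarrow> real \<Rightarrow> (nat \<Rightarrow> nat \<Rightarrow> real) \<Rightarrow> nat \<Rightarrow> (nat \<Rightarrow> real) \<Rightarrow> nat \<Rightarrow> real" where
  "sm_iter r c v 0 = (\<lambda>x i. x i / c)"
| "sm_iter r c v (Suc j) = sm_update r (sm_iter r c v j) (v j)"

lemma psd_op_sm_iter: "c > 0 \<Longrightarrow> psd_op r (sm_iter r c v j)"
proof (induction j)
  case 0
  then show ?case unfolding psd_op_def ip_def
    by (auto simp: add_divide_distrib intro!: sum_nonneg)
qed (auto intro: psd_op_sm_update)

lemma sm_iter_le: "c > 0 \<Longrightarrow> ip r x (sm_iter r c v j x) \<le> ip r x x / c"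
proof (induction j)
  case 0
  then show ?case by (simp add: ip_def sum_divide_distrib)
next
  case (Suc j)
  then show ?case using sm_update_le[OF psd_op_sm_iter[of c r v j], of x "v j"] by simp
qed

lemma sm_iter_cong: "(\<And>i. i < j \<Longrightarrow> v i = v' i) \<Longrightarrow> sm_iter r c v j = sm_iter r c v' j"
  by (induction j) auto

text \<open>The weak form x^T M H y = x^T y of the claim that \<open>H\<close> inverts M. It is all
  that is needed to turn a bound on \<open>H\<close> into one on M.\<close>

lemma sm_iter_inverse:
  assumes "c > 0"
  shows "ip r x y = c * ip r x (sm_iter r c v j y) + (\<Sum>i<j. ip r (v i) x * ip r (v i) (sm_iter r c v j y))"
proof (induction j arbitrary: y)
  case 0
  show ?case using assms by (simp add: ip_def sum_divide_distrib[symmetric])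
next
  case (Suc j)
  let ?H = "sm_iter r c v j"
  let ?a = "ip r (v j) (?H (v j))"
  define b where "b = ip r (?H (v j)) y / (1 + ?a)"
  have H: "psd_op r ?H" by (rule psd_op_sm_iter[OF assms])
  have a: "?a \<ge> 0" by (rule psd_op_nonneg[OF H])
  have e: "ip r z (sm_iter r c v (Suc j) y) = ip r z (?H y) - b * ip r z (?H (v j))" for z
    by (simp add: ip_sm_update b_def)
  have sym: "ip r (v j) (?H y) = ip r (?H (v j)) y" by (simp add: psd_op_sym[OF H])
  have b: "b * (1 + ?a) = ip r (?H (v j)) y" using a by (simp add: b_def)
  have "c * ip r x (sm_iter r c v (Suc j) y) + (\<Sum>i<Suc j. ip r (v i) x * ip r (v i) (sm_iter r c v (Suc j) y)) =
     (c * ip r x (?H y) + (\<Sum>i<j. ip r (v i) x * ip r (v i) (?H y)))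
     - b * (c * ip r x (?H (v j)) + (\<Sum>i<j. ip r (v i) x * ip r (v i) (?H (v j))))
     + ip r (v j) x * (ip r (v j) (?H y) - b * ?a)"
    unfolding e by (simp add: algebra_simps sum_subtractf sum_distrib_left)
  also have "\<dots> = ip r x y - b * ip r x (v j) + ip r (v j) x * (ip r (?H (v j)) y - b * ?a)"
    by (simp only: Suc.IH[symmetric] sym)
  also have "ip r (?H (v j)) y - b * ?a = b" using b by (simp add: algebra_simps)
  finally show ?case by (simp add: ip_commute)
qed

text \<open>The form of M at y - H y/h is nonnegative, and expanding it gives y^T M y \<ge> |y|^2/h.
  The part c I of M is then subtracted. Only the one vector y is involved.\<close>

lemma lower_bound_of_sm_iter:
  assumes c: "c > 0" and h: "h > 0" and le: "ip r y (sm_iter r c v j y) \<le> h * ip r y y"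
  shows "(\<Sum>i<j. (ip r (v i) y)\<^sup>2) \<ge> (1 / h - c) * ip r y y"
proof -
  let ?Hy = "sm_iter r c v j y"
  let ?M = "\<lambda>x z. c * ip r x z + (\<Sum>i<j. ip r (v i) x * ip r (v i) z)"
  let ?w = "\<lambda>i. y i - 1 / h * ?Hy i"
  have "0 \<le> ?M ?w ?w"
    using c by (intro add_nonneg_nonneg mult_nonneg_nonneg[of c] sum_nonneg zero_le_square) auto
  also have "\<dots> = ?M y y - 1 / h * (?M y ?Hy + ?M ?Hy y) + (1 / h)\<^sup>2 * ?M ?Hy ?Hy"
    unfolding ip_diff_scale_left ip_diff_scale_right
    by (simp add: algebra_simps sum_subtractf sum.distrib sum_distrib_left power2_eq_square sum_divide_distrib)
  also have "?M ?Hy y = ?M y ?Hy" by (simp add: ip_commute mult.commute)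
  also have "?M y ?Hy = ip r y y" by (rule sm_iter_inverse[OF c, symmetric])
  also have "?M ?Hy ?Hy = ip r ?Hy y" by (rule sm_iter_inverse[OF c, symmetric])
  also have "(1 / h)\<^sup>2 * ip r ?Hy y \<le> (1 / h)\<^sup>2 * (h * ip r y y)"
    using le by (intro mult_left_mono) (auto simp: ip_commute)
  finally have "0 \<le> ?M y y - 1 / h * (2 * ip r y y) + (1 / h)\<^sup>2 * (h * ip r y y)" by simp
  then have "0 \<le> ?M y y - 1 / h * ip r y y" using h by (simp add: power2_eq_square field_simps)
  then show ?thesis by (simp add: algebra_simps power2_eq_square)
qed

lemma trace_pow_sm_iter_0: "tr_op r (sm_iter r c v 0 ^^ p) = real r * (1 / c) ^ p"
proof -
  have "((\<lambda>x i. x i / c) ^^ p) x = (\<lambda>i. (1 / c) ^ p * x i)" for x :: "nat \<Rightarrow> real"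
    by (induction p) auto
  then show ?thesis by (simp add: tr_op_def ip_bvec_left) (simp add: bvec_def)
qed

section \<open>Lower tail of sampled Gram matrices\<close>

text \<open>The expectation if the support is finite; as a sum it is linear without integrability conditions.\<close>
definition fexp :: "'a pmf \<Rightarrow> ('a \<Rightarrow> real) \<Rightarrow> real" where
  "fexp P f = (\<Sum>x\<in>set_pmf P. pmf P x * f x)"

section \<open>Expectations over finite supports\<close>

lemma fexp_eq_expectation: "finite (set_pmf P) \<Longrightarrow> fexp P f = measure_pmf.expectation P f"
  unfolding fexp_def by (subst integral_measure_pmf[where A = "set_pmf P"]) auto

lemma fexp_add: "fexp P (\<lambda>x. f x + g x) = fexp P f + fexp P g"
  by (simp add: fexp_def distrib_left sum.distrib)

lemma fexp_diff: "fexp P (\<lambda>x. f x - g x) = fexp P f - fexp P g"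
  by (simp add: fexp_def right_diff_distrib sum_subtractf)

lemma fexp_cmult: "fexp P (\<lambda>x. c * f x) = c * fexp P f"
  by (simp add: fexp_def sum_distrib_left mult.left_commute)

lemma fexp_sum: "fexp P (\<lambda>x. \<Sum>i\<in>I. h i x) = (\<Sum>i\<in>I. fexp P (h i))"
proof -
  have "(\<Sum>x\<in>set_pmf P. \<Sum>i\<in>I. pmf P x * h i x) = (\<Sum>i\<in>I. \<Sum>x\<in>set_pmf P. pmf P x * h i x)"
    by (rule sum.swap)
  then show "fexp P (\<lambda>x. \<Sum>i\<in>I. h i x) = (\<Sum>i\<in>I. fexp P (h i))"
    by (simp add: fexp_def sum_distrib_left)
qed

lemma fexp_mult_const: "fexp P (\<lambda>x. f x * c) = fexp P f * c"
  using fexp_cmult[of P c f] by (simp add: mult.commute)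

lemma fexp_const [simp]: "finite (set_pmf P) \<Longrightarrow> fexp P (\<lambda>_. c) = c"
  by (simp add: fexp_def sum_pmf_eq_1 flip: sum_distrib_right)

lemma fexp_cong: "(\<And>x. x \<in> set_pmf P \<Longrightarrow> f x = g x) \<Longrightarrow> fexp P f = fexp P g"
  by (simp add: fexp_def)

lemma fexp_mono: "(\<And>x. x \<in> set_pmf P \<Longrightarrow> f x \<le> g x) \<Longrightarrow> fexp P f \<le> fexp P g"
  unfolding fexp_def by (intro sum_mono mult_left_mono) auto

lemma fexp_nonneg: "(\<And>x. x \<in> set_pmf P \<Longrightarrow> f x \<ge> 0) \<Longrightarrow> fexp P f \<ge> 0"
  unfolding fexp_def by (intro sum_nonneg mult_nonneg_nonneg) auto

lemma fexp_map: "finite (set_pmf P) \<Longrightarrow> fexp (map_pmf g P) f = fexp P (\<lambda>x. f (g x))"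
  by (simp add: fexp_eq_expectation)

lemma fexp_pair: "fexp (pair_pmf P Q) f = fexp P (\<lambda>x. fexp Q (\<lambda>y. f (x, y)))"
  by (simp add: fexp_def sum.cartesian_product' pmf_pair sum_distrib_left mult.assoc)

lemma fexp_pair_mult:
  "fexp (pair_pmf P Q) (\<lambda>(x, y). f x * g y) = fexp P f * fexp Q g"
  by (simp add: fexp_pair fexp_cmult fexp_mult_const)

lemma fexp_swap: "fexp P (\<lambda>x. fexp Q (f x)) = fexp Q (\<lambda>y. fexp P (\<lambda>x. f x y))"
proof -
  have "(\<Sum>x\<in>set_pmf P. \<Sum>y\<in>set_pmf Q. pmf P x * (pmf Q y * f x y)) =
      (\<Sum>y\<in>set_pmf Q. \<Sum>x\<in>set_pmf P. pmf P x * (pmf Q y * f x y))" by (rule sum.swap)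
  then show ?thesis by (simp add: fexp_def sum_distrib_left mult.left_commute)
qed

text \<open>The hypothesis is E f \<le> t c, not a quotient, so that the threshold c may be 0. This
  occurs when the optimal residual vanishes; then f is zero on the support.\<close>

lemma fexp_Markov:
  assumes fin: "finite (set_pmf P)" and nn: "\<And>x. x \<in> set_pmf P \<Longrightarrow> f x \<ge> 0"
    and le: "fexp P f \<le> t * c" and "t \<ge> 0" "c \<ge> 0"
  shows "measure_pmf.prob P {x. f x > c} \<le> t"
proof -
  have prob: "measure_pmf.prob P A = fexp P (indicator A)" for A
    using fin by (simp add: fexp_eq_expectation)
  show ?thesis
  proof (cases "c = 0")
    case True
    then have "(\<Sum>x\<in>set_pmf P. pmf P x * f x) = 0"
      using le fexp_nonneg[of P f] nn by (simp add: fexp_def)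
    then have "pmf P x * f x = 0" if "x \<in> set_pmf P" for x
      using that fin nn by (subst (asm) sum_nonneg_eq_0_iff) auto
    then have "f x = 0" if "x \<in> set_pmf P" for x using that by (simp add: set_pmf_iff)
    then have "fexp P (indicator {x. f x > c}) = fexp P (\<lambda>x. 0)"
      using True by (intro fexp_cong) auto
    then show ?thesis using \<open>t \<ge> 0\<close> prob by (simp add: fexp_def)
  next
    case False
    then have "c > 0" using \<open>c \<ge> 0\<close> by simp
    have "c * fexp P (indicator {x. f x > c}) \<le> fexp P f"
      unfolding fexp_cmult[symmetric] using nn \<open>c > 0\<close>
      by (intro fexp_mono) (auto simp: indicator_def)
    also note le
    finally show ?thesis using \<open>c > 0\<close> prob by (simp add: mult.commute)
  qed
qed

lemma finite_set_Pi_pmf: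
  assumes "finite A" "\<And>x. x \<in> A \<Longrightarrow> finite (set_pmf (p x))"
  shows "finite (set_pmf (Pi_pmf A d p))"
  using assms by (simp add: set_Pi_pmf finite_PiE_dflt)

text \<open>The last sample is averaged innermost, so that a one-step bound valid for every history
  applies to it.\<close>

lemma fexp_Pi_pmf_lessThan_Suc:
  assumes "\<And>x. x \<le> n \<Longrightarrow> finite (set_pmf (p x))"
  shows "fexp (Pi_pmf {..<Suc n} d p) h =
     fexp (Pi_pmf {..<n} d p) (\<lambda>f. fexp (p n) (\<lambda>y. h (f(n := y))))"
proof -
  have fin: "finite (set_pmf (Pi_pmf {..<n} d p))" using assms by (intro finite_set_Pi_pmf) auto
  have "fexp (Pi_pmf {..<Suc n} d p) h = fexp (p n) (\<lambda>y. fexp (Pi_pmf {..<n} d p) (\<lambda>f. h (f(n := y))))"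
    unfolding lessThan_Suc
    by (subst Pi_pmf_insert, simp, simp, subst fexp_map)
       (use assms fin in \<open>simp_all add: fexp_pair\<close>)
  then show ?thesis by (subst fexp_swap)
qed

text \<open>The expected drop is p/3 * 2/3 * tr H^(p+1). Bounding this trace below linearly gives a
  linear recurrence with rate 2ps/9 and fixed point r s^p. Updates only decrease \<open>H\<close>,
  so the bound K/c \<le> 1/(2p) on the initial form serves at every step.\<close>

lemma fexp_sm_iter_trace_pow:
  fixes w :: "nat \<Rightarrow> nat \<Rightarrow> real"
  assumes fin: "finite (set_pmf q)"
    and K: "\<And>y. y \<in> set_pmf q \<Longrightarrow> ip r (w y) (w y) \<le> K"
    and iso: "\<And>x. fexp q (\<lambda>y. (ip r (w y) x)\<^sup>2) \<ge> 2 / 3 * ip r x x"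
    and c: "c > 0" and Kc: "K / c \<le> 1 / (2 * real p)" and "odd p" and s: "s \<ge> 0"
    and ps: "2 / 9 * real p * s \<le> 1"
  defines "\<phi> \<equiv> \<lambda>j. fexp (Pi_pmf {..<j} 0 (\<lambda>_. q)) (\<lambda>f. tr_op r (sm_iter r c (\<lambda>i. w (f i)) j ^^ p))"
  shows "\<phi> j \<le> (1 - 2 / 9 * real p * s) ^ j * (real r * (1 / c) ^ p) + real r * s ^ p"
proof (induction j)
  case 0
  have "\<phi> 0 = real r * (1 / c) ^ p"
    by (simp add: \<phi>_def fexp_def trace_pow_sm_iter_0 del: sm_iter.simps)
  then show ?case using s by simp
next
  case (Suc j)
  have p: "p > 0" using \<open>odd p\<close> by (cases p) auto
  \<comment> \<open>With p + 1 = 2m, \<open>v^T H^(p+1) v\<close> is |H^m v|^2, a sum of (v^T H^m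
    e_i)^2; the hypothesis \<open>iso\<close> bounds the mean of each summand.\<close>
  obtain m where m: "Suc p = m + m" using \<open>odd p\<close> by (metis even_Suc evenE mult_2)
  let ?e = "2 / 9 * real p"
  have step: "fexp q (\<lambda>y. tr_op r (sm_update r H (w y) ^^ p)) \<le>
      (1 - ?e * s) * tr_op r (H ^^ p) + ?e * s * (real r * s ^ p)"
    if H: "psd_op r H" and Hc: "\<And>x. ip r x (H x) \<le> ip r x x / c" for H
  proof -
    have "fexp q (\<lambda>y. tr_op r (sm_update r H (w y) ^^ p)) \<le>
        fexp q (\<lambda>y. tr_op r (H ^^ p) - real p / 3 * ip r (w y) ((H ^^ Suc p) (w y)))"
    proof (intro fexp_mono trace_pow_sm_update_le H p)
      fix y assume "y \<in> set_pmf q"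
      have "ip r (w y) (H (w y)) \<le> ip r (w y) (w y) / c" by (rule Hc)
      also have "\<dots> \<le> K / c" using K \<open>y \<in> set_pmf q\<close> c by (intro divide_right_mono) auto
      also note Kc
      finally show "ip r (w y) (H (w y)) \<le> 1 / (2 * real p)" .
    qed
    also have "\<dots> = tr_op r (H ^^ p) - real p / 3 * fexp q (\<lambda>y. ip r (w y) ((H ^^ Suc p) (w y)))"
      unfolding fexp_diff fexp_cmult fexp_const[OF fin] ..
    also have "fexp q (\<lambda>y. ip r (w y) ((H ^^ Suc p) (w y))) =
        (\<Sum>i<r. fexp q (\<lambda>y. (ip r (w y) ((H ^^ m) (bvec i)))\<^sup>2))"
    proof -
      have "ip r v ((H ^^ Suc p) v) = (\<Sum>i<r. (ip r v ((H ^^ m) (bvec i)))\<^sup>2)" for v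
      proof -
        have "ip r v ((H ^^ Suc p) v) = ip r ((H ^^ m) v) ((H ^^ m) v)"
          unfolding m by (simp only: psd_op_pow_shift[OF H])
        also have "\<dots> = (\<Sum>i<r. (ip r (bvec i) ((H ^^ m) v))\<^sup>2)"
          by (simp add: ip_bvec_left) (simp add: ip_def power2_eq_square)
        finally show ?thesis by (simp add: ip_commute[of r "bvec _"] psd_op_pow_sym[OF H])
      qed
      then show ?thesis by (simp only: fexp_sum)
    qed
    also have "tr_op r (H ^^ p) - real p / 3 * (\<Sum>i<r. fexp q (\<lambda>y. (ip r (w y) ((H ^^ m) (bvec i)))\<^sup>2))
       \<le> tr_op r (H ^^ p) - real p / 3 * (\<Sum>i<r. 2 / 3 * ip r ((H ^^ m) (bvec i)) ((H ^^ m) (bvec i)))"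
      by (intro diff_left_mono mult_left_mono sum_mono iso) auto
    also have "(\<Sum>i<r. 2 / 3 * ip r ((H ^^ m) (bvec i)) ((H ^^ m) (bvec i))) = 2 / 3 * tr_op r (H ^^ Suc p)"
      unfolding m psd_op_pow_shift[OF H] tr_op_def by (simp add: sum_distrib_left)
    also have "tr_op r (H ^^ p) - real p / 3 * (2 / 3 * tr_op r (H ^^ Suc p)) \<le>
        tr_op r (H ^^ p) - real p / 3 * (2 / 3 * (s * tr_op r (H ^^ p) - real r * s ^ Suc p))"
      by (intro diff_left_mono mult_left_mono trace_pow_Suc_ge H s) auto
    also have "\<dots> = (1 - ?e * s) * tr_op r (H ^^ p) + ?e * s * (real r * s ^ p)"
      by (simp add: algebra_simps)
    finally show ?thesis .
  qed
  have "\<phi> (Suc j) = fexp (Pi_pmf {..<j} 0 (\<lambda>_. q))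
     (\<lambda>f. fexp q (\<lambda>y. tr_op r (sm_update r (sm_iter r c (\<lambda>i. w (f i)) j) (w y) ^^ p)))"
  proof -
    have "sm_iter r c (\<lambda>i. w ((f(j := y)) i)) (Suc j) = sm_update r (sm_iter r c (\<lambda>i. w (f i)) j) (w y)" for f y
      using sm_iter_cong[of j "\<lambda>i. w ((f(j := y)) i)" "\<lambda>i. w (f i)" r c] by simp
    then show ?thesis unfolding \<phi>_def using fin
      by (subst fexp_Pi_pmf_lessThan_Suc) (simp_all del: sm_iter.simps)
  qed
  also have "\<dots> \<le> fexp (Pi_pmf {..<j} 0 (\<lambda>_. q))
     (\<lambda>f. (1 - ?e * s) * tr_op r (sm_iter r c (\<lambda>i. w (f i)) j ^^ p) + ?e * s * (real r * s ^ p))"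
    by (intro fexp_mono step psd_op_sm_iter sm_iter_le c)
  also have "\<dots> = (1 - ?e * s) * \<phi> j + ?e * s * (real r * s ^ p)"
    unfolding \<phi>_def using fin finite_set_Pi_pmf[of "{..<j}" "\<lambda>_. q" 0]
    by (simp add: fexp_add fexp_cmult)
  also have "\<dots> \<le> (1 - ?e * s) * ((1 - ?e * s) ^ j * (real r * (1 / c) ^ p) + real r * s ^ p)
      + ?e * s * (real r * s ^ p)"
    using Suc ps by (intro add_right_mono mult_left_mono) auto
  also have "\<dots> = (1 - ?e * s) ^ Suc j * (real r * (1 / c) ^ p) + real r * s ^ p"
    by (simp add: algebra_simps)
  finally show ?case .
qed

text \<open>Plays the role of a matrix Chernoff bound; the constants come from \<open>s = 9/J\<close> and \<open>c = J/54\<close>.\<close>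
lemma sampled_gram_lower_tail:
  fixes w :: "nat \<Rightarrow> nat \<Rightarrow> real"
  assumes fin: "finite (set_pmf q)"
    and K: "\<And>y. y \<in> set_pmf q \<Longrightarrow> ip r (w y) (w y) \<le> K"
    and iso: "\<And>x. fexp q (\<lambda>y. (ip r (w y) x)\<^sup>2) \<ge> 2 / 3 * ip r x x"
    and "odd p" and J: "real J \<ge> 108 * K * real p" and K1: "K \<ge> 1"
  shows "measure_pmf.prob (Pi_pmf {..<J} 0 (\<lambda>_. q))
     {f. \<not> (\<forall>x. (\<Sum>i<J. (ip r (w (f i)) x)\<^sup>2) \<ge> real J / 54 * ip r x x)} \<le> 2 * real r / 3 ^ p"
    (is "measure_pmf.prob _ ?bad \<le> _")
proof -
  let ?Q = "Pi_pmf {..<J} 0 (\<lambda>_. q)"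
  let ?H = "\<lambda>f. sm_iter r (real J / 54) (\<lambda>i. w (f i)) J"
  have p: "p > 0" using \<open>odd p\<close> by (cases p) auto
  have "1 * 1 \<le> K * real p" using K1 p by (intro mult_mono) auto
  then have J0: "real J > 0" using J by simp
  have c: "real J / 54 > 0" using J0 by simp
  have finQ: "finite (set_pmf ?Q)" using fin by (intro finite_set_Pi_pmf) auto
  have pJ: "2 * real p \<le> real J"
  proof -
    have "1 * real p \<le> K * real p" using K1 by (intro mult_right_mono) auto
    then show ?thesis using J by linarith
  qed
  have "fexp ?Q (\<lambda>f. tr_op r (?H f ^^ p)) \<le>
     (1 - 2 / 9 * real p * (9 / real J)) ^ J * (real r * (1 / (real J / 54)) ^ p) + real r * (9 / real J) ^ p"
  proof (rule fexp_sm_iter_trace_pow[where K = K])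
    show "K / (real J / 54) \<le> 1 / (2 * real p)" using J J0 p by (simp add: field_simps)
    show "2 / 9 * real p * (9 / real J) \<le> 1" using J0 pJ by (simp add: field_simps)
  qed (use fin K iso c \<open>odd p\<close> J0 in auto)
  \<comment> \<open>The initial potential r (54/J)^p shrinks by exp(-2p) \<le> 6^(-p), and so
    reaches the size r (9/J)^p of the fixed point.\<close>
  also have "(1 - 2 / 9 * real p * (9 / real J)) ^ J * (real r * (1 / (real J / 54)) ^ p) \<le> real r * (9 / real J) ^ p"
  proof -
    have "(1 - 2 * real p / real J) ^ J \<le> exp (- (2 * real p / real J)) ^ J"
      using J0 pJ exp_ge_add_one_self[of "- (2 * real p / real J)"] by (intro power_mono) (auto simp: field_simps)
    also have "\<dots> = exp (-2) ^ p" using J0 by (simp flip: exp_of_nat_mult)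
    also have "\<dots> \<le> (1 / 6) ^ p"
    proof (intro power_mono)
      have "exp (2::real) = exp 1 * exp 1" by (simp flip: exp_add)
      also have "\<dots> \<ge> (5 / 2) * (5 / 2)"
        using e_less_272 exp_lower_Taylor_quadratic[of "1::real"] by (intro mult_mono) auto
      finally show "exp (-2) \<le> (1 / 6 :: real)" by (simp add: exp_minus field_simps)
    qed auto
    finally have "(1 - 2 * real p / real J) ^ J * (real r * (54 / real J) ^ p) \<le> (1 / 6) ^ p * (real r * (54 / real J) ^ p)"
      by (intro mult_right_mono) auto
    also have "\<dots> = real r * ((1 / 6) * (54 / real J)) ^ p" by (simp only: power_mult_distrib mult.left_commute)
    also have "(1 / 6) * (54 / real J) = 9 / real J" by simp
    finally show ?thesis by simp
  qed
  finally have "fexp ?Q (\<lambda>f. tr_op r (?H f ^^ p)) \<le> 2 * real r * (9 / real J) ^ p" by simp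
  \<comment> \<open>The threshold base 27/J is three times 9/J, so Markov's inequality gains 3^p. It
    leaves the eigenvalue bound J/27 - J/54 = J/54.\<close>
  also have "\<dots> = 2 * real r / 3 ^ p * (3 * (9 / real J)) ^ p" by (simp only: power_mult_distrib) simp
  also have "3 * (9 / real J) = 27 / real J" by simp
  finally have le: "fexp ?Q (\<lambda>f. tr_op r (?H f ^^ p)) \<le> 2 * real r / 3 ^ p * (27 / real J) ^ p" .
  have psd: "psd_op r (?H f)" for f using c by (rule psd_op_sm_iter)
  have "measure_pmf.prob ?Q ?bad \<le>
      measure_pmf.prob ?Q {f. tr_op r (?H f ^^ p) > (27 / real J) ^ p}"
  proof (intro measure_pmf.finite_measure_mono subsetI CollectI)
    fix f assume "f \<in> ?bad"
    then obtain x where x: "\<not> (\<Sum>i<J. (ip r (w (f i)) x)\<^sup>2) \<ge> real J / 54 * ip r x x" by auto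
    show "tr_op r (?H f ^^ p) > (27 / real J) ^ p"
    proof (rule ccontr)
      assume "\<not> ?thesis"
      then have "ip r x (?H f x) \<le> 27 / real J * ip r x x"
        using J0 p by (intro psd_op_bound_of_trace_pow[OF psd, where p = p]) auto
      from lower_bound_of_sm_iter[OF c _ this] J0
      have "(\<Sum>i<J. (ip r (w (f i)) x)\<^sup>2) \<ge> (real J / 27 - real J / 54) * ip r x x" by simp
      with x show False by (simp add: field_simps)
    qed
  qed auto
  also have "\<dots> \<le> 2 * real r / 3 ^ p"
    using finQ le by (intro fexp_Markov) (auto simp: tr_op_def intro!: sum_nonneg psd_op_nonneg[OF psd_op_pow[OF psd]])
  finally show ?thesis .
qed

section \<open>CountSketch and TensorSketch\<close>

lemma k_wise_independent_finite:
  assumes "k_wise_independent k I B H" "finite B"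
  shows "finite (set_pmf H)"
  using assms by (intro finite_subset[OF _ finite_PiE[of "{..<I}" "\<lambda>_. B"]]) (auto simp: k_wise_independent_def)

text \<open>Independence is given for index sets of size exactly \<open>min k I\<close>; a smaller
  set is enlarged to such a set and inherits it.\<close>

lemma k_wise_independent_fexp_prod:
  fixes g :: "nat \<Rightarrow> 'b \<Rightarrow> real"
  assumes H: "k_wise_independent k I B H" and L: "L \<subseteq> {..<I}" "card L \<le> k" and B: "finite B" "B \<noteq> {}"
  shows "fexp H (\<lambda>h. \<Prod>i\<in>L. g i (h i)) = (\<Prod>i\<in>L. fexp (pmf_of_set B) (g i))"
proof -
  have finH: "finite (set_pmf H)" by (rule k_wise_independent_finite[OF H B(1)])
  have "card L \<le> min k I" using L card_mono[of "{..<I}" L] by auto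
  then obtain K where K: "L \<subseteq> K" "K \<subseteq> {..<I}" "card K = min k I"
    using exists_subset_between[of L "min k I" "{..<I}"] L(1) by auto
  have ind: "prob_space.indep_vars (measure_pmf H) (\<lambda>_. count_space UNIV) (\<lambda>i h. h i) K"
    and unif: "\<And>i. i \<in> K \<Longrightarrow> map_pmf (\<lambda>h. h i) H = pmf_of_set B"
    using H K by (auto simp: k_wise_independent_def)
  have "prob_space.indep_vars (measure_pmf H) (\<lambda>_. count_space UNIV) (\<lambda>i h. h i) L"
    by (rule prob_space.indep_vars_subset[OF prob_space_measure_pmf ind K(1)])
  then have ind': "prob_space.indep_vars (measure_pmf H) (\<lambda>_. borel) (\<lambda>i h. g i (h i)) L"
    by (rule prob_space.indep_vars_compose2[OF prob_space_measure_pmf]) auto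
  have "fexp H (\<lambda>h. \<Prod>i\<in>L. g i (h i)) = measure_pmf.expectation H (\<lambda>h. \<Prod>i\<in>L. g i (h i))"
    by (rule fexp_eq_expectation[OF finH])
  also have "\<dots> = (\<Prod>i\<in>L. measure_pmf.expectation H (\<lambda>h. g i (h i)))"
    using finite_subset[OF L(1)] ind' finH
    by (intro prob_space.indep_vars_lebesgue_integral prob_space_measure_pmf) (auto intro: integrable_measure_pmf_finite)
  also have "\<dots> = (\<Prod>i\<in>L. fexp (pmf_of_set B) (g i))"
  proof (intro prod.cong refl)
    fix i assume "i \<in> L"
    then have "pmf_of_set B = map_pmf (\<lambda>h. h i) H" using unif K by auto
    then show "measure_pmf.expectation H (\<lambda>h. g i (h i)) = fexp (pmf_of_set B) (g i)"
      using finH by (simp add: fexp_map fexp_eq_expectation)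
  qed
  finally show ?thesis .
qed

lemma k_wise_independent_range:
  "k_wise_independent k I B H \<Longrightarrow> h \<in> set_pmf H \<Longrightarrow> i < I \<Longrightarrow> h i \<in> B"
  by (auto simp: k_wise_independent_def PiE_def Pi_def)

lemma fexp_pmf_of_set: "finite B \<Longrightarrow> B \<noteq> {} \<Longrightarrow> fexp (pmf_of_set B) g = (\<Sum>x\<in>B. g x) / card B"
  by (simp add: fexp_def sum_distrib_left sum_divide_distrib[symmetric] flip: sum_distrib_left)

text \<open>The pair of hash values is expanded over point indicators, whose product has mean
  1/J^2.\<close>

lemma pairwise_independent_fexp:
  fixes \<psi> :: "nat \<Rightarrow> nat \<Rightarrow> real"
  assumes H: "k_wise_independent k I {..<J} H" and k: "k \<ge> 2" and J: "J > 0"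
    and ab: "a < I" "b < I" "a \<noteq> b"
  shows "fexp H (\<lambda>h. \<psi> (h a) (h b)) = (\<Sum>u<J. \<Sum>t<J. \<psi> u t) / (real J)\<^sup>2"
proof -
  have B: "finite {..<J}" "{..<J} \<noteq> {}" using J by auto
  have one: "fexp H (\<lambda>h. of_bool (h a = u) * of_bool (h b = t)) = 1 / (real J)\<^sup>2" if "u < J" "t < J" for u t
  proof -
    have "fexp H (\<lambda>h. \<Prod>i\<in>{a, b}. of_bool (h i = (if i = a then u else t))) =
      (\<Prod>i\<in>{a, b}. fexp (pmf_of_set {..<J}) (\<lambda>y. of_bool (y = (if i = a then u else t))))"
      using ab k by (intro k_wise_independent_fexp_prod[OF H _ _ B, of _ "\<lambda>i y. of_bool (y = (if i = a then u else t))"]) auto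
    also have "\<dots> = 1 / (real J)\<^sup>2"
      using ab B that by (simp add: fexp_pmf_of_set of_bool_def power2_eq_square sum.delta del: of_bool_eq_iff cong: if_cong)
    finally show ?thesis using ab by (simp add: eq_commute[of a b])
  qed
  have "fexp H (\<lambda>h. \<psi> (h a) (h b)) =
     fexp H (\<lambda>h. \<Sum>u<J. \<Sum>t<J. \<psi> u t * (of_bool (h a = u) * of_bool (h b = t)))"
  proof (rule fexp_cong)
    fix h assume "h \<in> set_pmf H"
    then have "h a < J" "h b < J" using k_wise_independent_range[OF H] ab by auto
    then show "\<psi> (h a) (h b) = (\<Sum>u<J. \<Sum>t<J. \<psi> u t * (of_bool (h a = u) * of_bool (h b = t)))"
      by (simp add: of_bool_def sum.delta if_distrib[of "\<lambda>t. _ * t"] cong: if_cong)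
  qed
  also have "\<dots> = (\<Sum>u<J. \<Sum>t<J. \<psi> u t * (1 / (real J)\<^sup>2))"
    by (simp add: fexp_sum fexp_cmult one del: mult_cancel_left)
  finally show ?thesis by (simp add: sum_divide_distrib)
qed

text \<open>A product of distinct signs has mean 0. If two of the four indices agree, their signs
  cancel and a second moment remains.\<close>

lemma sign_fexp:
  assumes S: "k_wise_independent 4 I {-1, 1} S"
  shows sign_fexp_2: "a < I \<Longrightarrow> b < I \<Longrightarrow> fexp S (\<lambda>s. s a * s b) = of_bool (a = b)"
    and sign_fexp_4: "a < I \<Longrightarrow> b < I \<Longrightarrow> c < I \<Longrightarrow> d < I \<Longrightarrow> fexp S (\<lambda>s. s a * s b * (s c * s d)) =
      of_bool (a = b \<and> c = d \<or> a = c \<and> b = d \<or> a = d \<and> b = c)"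
proof -
  have fin: "finite (set_pmf S)" by (rule k_wise_independent_finite[OF S]) auto
  have sq: "s i * s i = 1" if "s \<in> set_pmf S" "i < I" for s i
    using k_wise_independent_range[OF S that] by auto
  have zero: "fexp S (\<lambda>s. \<Prod>i\<in>L. s i) = 0" if "L \<subseteq> {..<I}" "card L \<le> 4" "L \<noteq> {}" for L
    using that finite_subset[OF that(1)]
    by (subst k_wise_independent_fexp_prod[OF S, where g = "\<lambda>_ x. x"]) (auto simp: fexp_pmf_of_set)
  show two: "fexp S (\<lambda>s. s a * s b) = of_bool (a = b)" if "a < I" "b < I" for a b
  proof (cases "a = b")
    case True
    then have "fexp S (\<lambda>s. s a * s b) = fexp S (\<lambda>_. 1)" using sq that by (intro fexp_cong) auto
    then show ?thesis using True fin by simp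
  next
    case False
    then show ?thesis using zero[of "{a, b}"] that by simp
  qed
  assume I: "a < I" "b < I" "c < I" "d < I"
  have red: "fexp S (\<lambda>s. s a * s b * (s c * s d)) = fexp S (\<lambda>s. s i * s j)"
    if "\<And>s. s \<in> set_pmf S \<Longrightarrow> s a * s b * (s c * s d) = s i * s j" for i j
    using that by (rule fexp_cong)
  consider "a = b" | "a = c" | "a = d" | "b = c" | "b = d" | "c = d" | "distinct [a, b, c, d]" by auto
  then show "fexp S (\<lambda>s. s a * s b * (s c * s d)) =
      of_bool (a = b \<and> c = d \<or> a = c \<and> b = d \<or> a = d \<and> b = c)"
  proof cases
    case 1
    have "fexp S (\<lambda>s. s a * s b * (s c * s d)) = fexp S (\<lambda>s. s c * s d)"
      using sq I 1 by (intro red) simp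
    then show ?thesis using two[of c d] I 1 by auto
  next
    case 2
    have "fexp S (\<lambda>s. s a * s b * (s c * s d)) = fexp S (\<lambda>s. s b * s d)"
      using sq[of _ a] I 2 by (intro red) (simp add: mult_ac mult.left_commute[of "_ a" "_ b"] flip: mult.assoc[of "_ a"])
    then show ?thesis using two[of b d] I 2 by auto
  next
    case 3
    have "fexp S (\<lambda>s. s a * s b * (s c * s d)) = fexp S (\<lambda>s. s b * s c)"
      using sq[of _ a] I 3 by (intro red) (simp add: mult_ac flip: mult.assoc[of "_ a"])
    then show ?thesis using two[of b c] I 3 by auto
  next
    case 4
    have "fexp S (\<lambda>s. s a * s b * (s c * s d)) = fexp S (\<lambda>s. s a * s d)"
      using sq[of _ b] I 4 by (intro red) (simp add: mult.assoc flip: mult.assoc[of "_ b"])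
    then show ?thesis using two[of a d] I 4 by auto
  next
    case 5
    have "fexp S (\<lambda>s. s a * s b * (s c * s d)) = fexp S (\<lambda>s. s a * s c)"
      using sq[of _ b] I 5 by (intro red) (simp add: mult_ac flip: mult.assoc[of "_ b"])
    then show ?thesis using two[of a c] I 5 by auto
  next
    case 6
    have "fexp S (\<lambda>s. s a * s b * (s c * s d)) = fexp S (\<lambda>s. s a * s b)"
      using sq I 6 by (intro red) simp
    then show ?thesis using two[of a b] I 6 by auto
  next
    case 7
    then have "(\<lambda>s::nat \<Rightarrow> real. s a * s b * (s c * s d)) = (\<lambda>s. \<Prod>i\<in>{a, b, c, d}. s i)" by (simp add: mult_ac)
    moreover have "fexp S (\<lambda>s. \<Prod>i\<in>{a, b, c, d}. s i) = 0"
      using I by (intro zero) (auto intro!: order_trans[OF card_insert_le_m1])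
    ultimately show ?thesis using 7 by simp
  qed
qed

section \<open>The fourth moment of a random signed sum\<close>

lemma pow4_sum_expand:
  fixes z :: "nat \<Rightarrow> real"
  shows "(\<Sum>a<n. z a) ^ 4 = (\<Sum>a<n. \<Sum>b<n. \<Sum>c<n. \<Sum>d<n. z a * z b * (z c * z d))"
  and "((\<Sum>a<n. \<Sum>b<n. u a b)::real)\<^sup>2 = (\<Sum>a<n. \<Sum>b<n. \<Sum>c<n. \<Sum>d<n. u a b * u c d)"
proof -
  show two: "((\<Sum>a<n. \<Sum>b<n. u a b)::real)\<^sup>2 = (\<Sum>a<n. \<Sum>b<n. \<Sum>c<n. \<Sum>d<n. u a b * u c d)" for u
    unfolding power2_eq_square by (simp only: sum_distrib_right) (simp only: sum_distrib_left)
  have "(\<Sum>a<n. z a) ^ 4 = ((\<Sum>a<n. z a)\<^sup>2)\<^sup>2" by simp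
  also have "(\<Sum>a<n. z a)\<^sup>2 = (\<Sum>a<n. \<Sum>b<n. z a * z b)"
    unfolding power2_eq_square by (rule sum_product)
  finally show "(\<Sum>a<n. z a) ^ 4 = (\<Sum>a<n. \<Sum>b<n. \<Sum>c<n. \<Sum>d<n. z a * z b * (z c * z d))"
    by (simp only: two)
qed

lemma ip_self_squared: "(ip n y y)\<^sup>2 = (\<Sum>a<n. \<Sum>b<n. (y a)\<^sup>2 * (y b)\<^sup>2)"
  unfolding ip_def power2_eq_square by (rule sum_product)

lemma sum_pair_diagonal:
  "(\<Sum>a<n. \<Sum>b<n. \<Sum>c<n. \<Sum>d<n. of_bool (a = b) * of_bool (c = d) * ((y a)\<^sup>2 * (y c)\<^sup>2)) = (ip n y y)\<^sup>2"
proof -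
  have delta: "(\<Sum>j<n. of_bool (i = j) * w) = w" if "i \<in> {..<n}" for i and w :: real
    using that by (subst sum.remove[of _ i]) auto
  have "(\<Sum>b<n. \<Sum>c<n. \<Sum>d<n. of_bool (a = b) * of_bool (c = d) * ((y a)\<^sup>2 * (y c)\<^sup>2)) =
      (\<Sum>b<n. of_bool (a = b) * (\<Sum>c<n. \<Sum>d<n. of_bool (c = d) * ((y a)\<^sup>2 * (y c)\<^sup>2)))" for a
    by (simp only: sum_distrib_left mult.assoc)
  moreover have "(\<Sum>c<n. \<Sum>d<n. of_bool (c = d) * ((y a)\<^sup>2 * (y c)\<^sup>2)) = (\<Sum>c<n. (y a)\<^sup>2 * (y c)\<^sup>2)" for a
    by (rule sum.cong[OF refl], rule delta)
  ultimately show ?thesis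
    unfolding ip_self_squared by (simp only:) (rule sum.cong[OF refl], rule delta)
qed

text \<open>Only the three pairings of the four indices contribute, each with total |y|^4. It is an
  inequality since a = b = c = d belongs to all three.\<close>

lemma sign_fourth_moment:
  assumes S: "k_wise_independent 4 I {-1, 1} S"
  shows "fexp S (\<lambda>s. (\<Sum>a<I. s a * y a) ^ 4) \<le> 3 * (ip I y y)\<^sup>2"
proof -
  have nn: "t * (t * (t * t)) \<ge> 0" for t :: real
    using zero_le_square[of "t * t"] by (simp add: mult.assoc)
  have "fexp S (\<lambda>s. (\<Sum>a<I. s a * y a) ^ 4) =
      (\<Sum>a<I. \<Sum>b<I. \<Sum>c<I. \<Sum>d<I. fexp S (\<lambda>s. s a * y a * (s b * y b) * (s c * y c * (s d * y d))))"
    by (simp only: pow4_sum_expand fexp_sum)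
  also have "\<dots> \<le> (\<Sum>a<I. \<Sum>b<I. \<Sum>c<I. \<Sum>d<I.
      of_bool (a = b) * of_bool (c = d) * ((y a)\<^sup>2 * (y c)\<^sup>2) +
      of_bool (a = c) * of_bool (b = d) * ((y a)\<^sup>2 * (y b)\<^sup>2) +
      of_bool (a = d) * of_bool (b = c) * ((y a)\<^sup>2 * (y b)\<^sup>2))"
  proof (intro sum_mono)
    fix a b c d assume I: "a \<in> {..<I}" "b \<in> {..<I}" "c \<in> {..<I}" "d \<in> {..<I}"
    let ?lhs = "fexp S (\<lambda>s. s a * y a * (s b * y b) * (s c * y c * (s d * y d)))"
    let ?rhs = "of_bool (a = b) * of_bool (c = d) * ((y a)\<^sup>2 * (y c)\<^sup>2) +
      of_bool (a = c) * of_bool (b = d) * ((y a)\<^sup>2 * (y b)\<^sup>2) +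
      of_bool (a = d) * of_bool (b = c) * ((y a)\<^sup>2 * (y b)\<^sup>2)"
    have "?lhs =
        fexp S (\<lambda>s. (y a * y b * (y c * y d)) * (s a * s b * (s c * s d)))"
      by (intro fexp_cong) (simp add: mult_ac)
    also have "\<dots> = (y a * y b * (y c * y d)) * of_bool (a = b \<and> c = d \<or> a = c \<and> b = d \<or> a = d \<and> b = c)"
      using I by (simp add: fexp_cmult sign_fexp_4[OF S])
    also have "\<dots> \<le> ?rhs"
      by (cases "a = b"; cases "c = d"; cases "a = c"; cases "b = d"; cases "a = d"; cases "b = c")
         (auto simp: power2_eq_square mult_ac nn)
    finally show "?lhs \<le>
      ?rhs" .
  qed
  also have "\<dots> = 3 * (ip I y y)\<^sup>2"
  proof -
    have 1: "(\<Sum>a<I. \<Sum>b<I. \<Sum>c<I. \<Sum>d<I. of_bool (a = b) * of_bool (c = d) * ((y a)\<^sup>2 * (y c)\<^sup>2)) = (ip I y y)\<^sup>2"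
      by (rule sum_pair_diagonal)
    have 2: "(\<Sum>a<I. \<Sum>b<I. \<Sum>c<I. \<Sum>d<I. of_bool (a = c) * of_bool (b = d) * ((y a)\<^sup>2 * (y b)\<^sup>2)) = (ip I y y)\<^sup>2"
    proof -
      have "(\<Sum>a<I. \<Sum>b<I. \<Sum>c<I. \<Sum>d<I. of_bool (a = c) * of_bool (b = d) * ((y a)\<^sup>2 * (y b)\<^sup>2)) =
          (\<Sum>a<I. \<Sum>c<I. \<Sum>b<I. \<Sum>d<I. of_bool (a = c) * of_bool (b = d) * ((y a)\<^sup>2 * (y b)\<^sup>2))"
        by (rule sum.cong[OF refl], rule sum.swap)
      then show ?thesis by (simp only: sum_pair_diagonal)
    qed
    have 3: "(\<Sum>a<I. \<Sum>b<I. \<Sum>c<I. \<Sum>d<I. of_bool (a = d) * of_bool (b = c) * ((y a)\<^sup>2 * (y b)\<^sup>2)) = (ip I y y)\<^sup>2"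
    proof -
      have "(\<Sum>a<I. \<Sum>b<I. \<Sum>c<I. \<Sum>d<I. of_bool (a = d) * of_bool (b = c) * ((y a)\<^sup>2 * (y b)\<^sup>2)) =
          (\<Sum>a<I. \<Sum>b<I. \<Sum>d<I. \<Sum>c<I. of_bool (a = d) * of_bool (b = c) * ((y a)\<^sup>2 * (y b)\<^sup>2))"
        by (rule sum.cong[OF refl], rule sum.cong[OF refl], rule sum.swap)
      then show ?thesis by (simp only: 2)
    qed
    show ?thesis by (simp only: sum.distrib 1 2 3)
  qed
  finally show ?thesis .
qed

section \<open>Moment bounds for random matrices, products and Kronecker products\<close>

lemma sum_lessThan_mult:
  fixes f :: "nat \<Rightarrow> real"
  shows "(\<Sum>p<a * b. f p) = (\<Sum>i<a. \<Sum>j<b. f (i * b + j))"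
proof -
  have "(\<Sum>p<a * b. f p) = (\<Sum>i<a. sum f {i * b..<i * b + b})"
    by (rule sum.nat_group[symmetric])
  also have "\<dots> = (\<Sum>i<a. \<Sum>j<b. f (i * b + j))"
    by (intro sum.cong[OF refl], subst sum.atLeastLessThan_shift_0) (simp add: lessThan_atLeast0 comp_def)
  finally show ?thesis .
qed

definition app :: "real mat \<Rightarrow> (nat \<Rightarrow> real) \<Rightarrow> nat \<Rightarrow> real" where
  "app M x = (\<lambda>i. \<Sum>j<dim_col M. M $$ (i, j) * x j)"

definition sq_app :: "real mat \<Rightarrow> (nat \<Rightarrow> real) \<Rightarrow> real" where
  "sq_app M x = ip (dim_row M) (app M x) (app M x)"

lemma sq_app_nonneg [simp]: "sq_app M x \<ge> 0"
  by (simp add: sq_app_def)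

text \<open>The second moment of |Mx|^2 is bounded rather than its variance, because then the
  constants simply multiply. The relative variance is at most g - 1.\<close>

definition moment_sketch :: "real \<Rightarrow> nat \<Rightarrow> nat \<Rightarrow> real mat pmf \<Rightarrow> bool" where
  "moment_sketch g m n P \<longleftrightarrow> finite (set_pmf P) \<and> set_pmf P \<subseteq> carrier_mat m n \<and>
     (\<forall>x. fexp P (\<lambda>M. sq_app M x) = ip n x x \<and> fexp P (\<lambda>M. (sq_app M x)\<^sup>2) \<le> g * (ip n x x)\<^sup>2)"

lemma moment_sketchD:
  assumes "moment_sketch g m n P"
  shows "finite (set_pmf P)" "M \<in> set_pmf P \<Longrightarrow> M \<in> carrier_mat m n"
    "fexp P (\<lambda>M. sq_app M x) = ip n x x" "fexp P (\<lambda>M. (sq_app M x)\<^sup>2) \<le> g * (ip n x x)\<^sup>2"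
  using assms by (auto simp: moment_sketch_def)

text \<open>Convexity of the square, with weights \<open>a i\<close>, loses no constant.\<close>
lemma fexp_sum_squared_le:
  assumes fin: "finite (set_pmf P)" and a: "\<And>i. i < k \<Longrightarrow> a i \<ge> 0"
    and F: "\<And>i. i < k \<Longrightarrow> fexp P (\<lambda>\<omega>. (F \<omega> i)\<^sup>2) \<le> g * (a i)\<^sup>2"
  shows "fexp P (\<lambda>\<omega>. (\<Sum>i<k. F \<omega> i)\<^sup>2) \<le> g * (\<Sum>i<k. a i)\<^sup>2"
proof -
  have zero: "F \<omega> i = 0" if "\<omega> \<in> set_pmf P" "i < k" "a i = 0" for \<omega> i
  proof -
    have "fexp P (\<lambda>\<omega>. (F \<omega> i)\<^sup>2) = 0"
      using F[OF that(2)] that(3) fexp_nonneg[of P "\<lambda>\<omega>. (F \<omega> i)\<^sup>2"] by simp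
    then have "pmf P \<omega> * (F \<omega> i)\<^sup>2 = 0"
      using fin that(1) unfolding fexp_def by (subst (asm) sum_nonneg_eq_0_iff) auto
    then show ?thesis using that(1) by (simp add: set_pmf_iff)
  qed
  have "fexp P (\<lambda>\<omega>. (\<Sum>i<k. F \<omega> i)\<^sup>2) \<le> fexp P (\<lambda>\<omega>. (\<Sum>i<k. a i) * (\<Sum>i<k. 1 / a i * (F \<omega> i)\<^sup>2))"
  proof (rule fexp_mono)
    fix \<omega> assume w: "\<omega> \<in> set_pmf P"
    have "(\<Sum>i<k. F \<omega> i)\<^sup>2 = (\<Sum>i<k. sqrt (a i) * (F \<omega> i / sqrt (a i)))\<^sup>2"
      using zero[OF w] by (intro arg_cong[where f = "\<lambda>t. t\<^sup>2"] sum.cong) auto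
    also have "\<dots> \<le> (\<Sum>i<k. (sqrt (a i))\<^sup>2) * (\<Sum>i<k. (F \<omega> i / sqrt (a i))\<^sup>2)"
      by (rule Cauchy_Schwarz_ineq_sum)
    also have "(\<Sum>i<k. (sqrt (a i))\<^sup>2) = (\<Sum>i<k. a i)" using a by (intro sum.cong) auto
    also have "(\<Sum>i<k. (F \<omega> i / sqrt (a i))\<^sup>2) = (\<Sum>i<k. 1 / a i * (F \<omega> i)\<^sup>2)"
      using a by (intro sum.cong) (auto simp: power_divide)
    finally show "(\<Sum>i<k. F \<omega> i)\<^sup>2 \<le> (\<Sum>i<k. a i) * (\<Sum>i<k. 1 / a i * (F \<omega> i)\<^sup>2)" .
  qed
  also have "\<dots> = (\<Sum>i<k. a i) * (\<Sum>i<k. 1 / a i * fexp P (\<lambda>\<omega>. (F \<omega> i)\<^sup>2))"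
    by (simp only: fexp_cmult fexp_sum)
  also have "\<dots> \<le> (\<Sum>i<k. a i) * (\<Sum>i<k. g * a i)"
  proof (intro mult_left_mono sum_mono sum_nonneg)
    fix i assume "i \<in> {..<k}"
    then have "1 / a i * fexp P (\<lambda>\<omega>. (F \<omega> i)\<^sup>2) \<le> 1 / a i * (g * (a i)\<^sup>2)"
      using a F by (intro mult_left_mono) auto
    also have "\<dots> = g * a i" by (simp add: power2_eq_square)
    finally show "1 / a i * fexp P (\<lambda>\<omega>. (F \<omega> i)\<^sup>2) \<le> g * a i" .
  qed (use a in auto)
  also have "\<dots> = g * (\<Sum>i<k. a i)\<^sup>2" by (simp add: power2_eq_square flip: sum_distrib_left)
  finally show ?thesis .
qed

lemma app_mult:
  assumes "A \<in> carrier_mat m k" "B \<in> carrier_mat k n" "i < m"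
  shows "app (A * B) x i = app A (app B x) i"
proof -
  have "app (A * B) x i = (\<Sum>j<n. \<Sum>l<k. A $$ (i, l) * B $$ (l, j) * x j)"
    using assms by (simp add: app_def scalar_prod_def sum_distrib_right lessThan_atLeast0)
  also have "\<dots> = (\<Sum>l<k. \<Sum>j<n. A $$ (i, l) * B $$ (l, j) * x j)" by (rule sum.swap)
  also have "\<dots> = app A (app B x) i" using assms by (simp add: app_def sum_distrib_left mult.assoc)
  finally show ?thesis .
qed

text \<open>The outer factor is averaged first, at the fixed vector N x. This reduces both moments
  to those of the inner factor.\<close>

lemma moment_sketch_mult:
  assumes A: "moment_sketch gA m k PA" and B: "moment_sketch gB k n PB" and g: "gA \<ge> 0"
  shows "moment_sketch (gA * gB) m n (map_pmf (\<lambda>(A, B). A * B) (pair_pmf PA PB))"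
proof -
  let ?K = "map_pmf (\<lambda>(A, B). A * B) (pair_pmf PA PB)"
  have fin: "finite (set_pmf (pair_pmf PA PB))"
    using A B by (auto dest: moment_sketchD(1))
  have sq: "sq_app (M * N) x = sq_app M (app N x)" if "M \<in> set_pmf PA" "N \<in> set_pmf PB" for M N x
  proof -
    have M: "M \<in> carrier_mat m k" and N: "N \<in> carrier_mat k n"
      using that A B by (auto dest: moment_sketchD(2))
    show ?thesis using M N by (simp add: sq_app_def ip_def app_mult[OF M N])
  qed
  have swap: "fexp ?K (\<lambda>M. f (sq_app M x)) =
     fexp PB (\<lambda>N. fexp PA (\<lambda>M. f (sq_app M (app N x))))" for f x
  proof -
    have "fexp ?K (\<lambda>M. f (sq_app M x)) =
       fexp PA (\<lambda>M. fexp PB (\<lambda>N. f (sq_app (M * N) x)))"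
      by (simp add: fexp_map[OF fin] fexp_pair)
    also have "\<dots> = fexp PA (\<lambda>M. fexp PB (\<lambda>N. f (sq_app M (app N x))))"
      by (intro fexp_cong) (simp add: sq)
    finally show ?thesis by (subst (asm) fexp_swap)
  qed
  have dim: "ip k (app N x) (app N x) = sq_app N x" if "N \<in> set_pmf PB" for N x
    using moment_sketchD(2)[OF B that] by (simp add: sq_app_def)
  have "fexp ?K (\<lambda>M. sq_app M x) = ip n x x" for x
  proof -
    have "fexp PB (\<lambda>N. fexp PA (\<lambda>M. sq_app M (app N x))) = fexp PB (\<lambda>N. sq_app N x)"
      by (intro fexp_cong) (simp add: moment_sketchD(3)[OF A] dim)
    then show ?thesis using swap[of "\<lambda>t. t"] by (simp add: moment_sketchD(3)[OF B])
  qed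
  moreover have "fexp ?K (\<lambda>M. (sq_app M x)\<^sup>2) \<le> gA * gB * (ip n x x)\<^sup>2" for x
  proof -
    have "fexp PB (\<lambda>N. fexp PA (\<lambda>M. (sq_app M (app N x))\<^sup>2)) \<le> fexp PB (\<lambda>N. gA * (sq_app N x)\<^sup>2)"
      using moment_sketchD(4)[OF A] by (intro fexp_mono) (metis dim)
    also have "\<dots> \<le> gA * (gB * (ip n x x)\<^sup>2)"
      unfolding fexp_cmult using g moment_sketchD(4)[OF B] by (intro mult_left_mono)
    finally show ?thesis using swap[of "\<lambda>t. t\<^sup>2"] by simp
  qed
  moreover have "M * N \<in> carrier_mat m n" if "M \<in> set_pmf PA" "N \<in> set_pmf PB" for M N
    using that A B by (intro mult_carrier_mat[of _ m k]) (auto dest: moment_sketchD(2))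
  ultimately show ?thesis
    using fin unfolding moment_sketch_def by auto
qed

lemma kron_carrier: "A \<in> carrier_mat m1 n1 \<Longrightarrow> B \<in> carrier_mat m2 n2 \<Longrightarrow> kron A B \<in> carrier_mat (m1 * m2) (n1 * n2)"
  by (auto simp: kron_def)

lemma div_mod_lt_mult: "(i::nat) < a \<Longrightarrow> j < b \<Longrightarrow> i * b + j < a * b"
  using mult_le_mono1[of "Suc i" a b] by simp

text \<open>Regard x as an n1 by n2 array: \<open>B\<close> acts on its rows, then \<open>A\<close>
  on the columns of the result.\<close>

lemma app_kron:
  assumes A: "A \<in> carrier_mat m1 n1" and B: "B \<in> carrier_mat m2 n2" and i: "a < m1" "b < m2"
  shows "app (kron A B) x (a * m2 + b) = app A (\<lambda>c. app B (\<lambda>d. x (c * n2 + d)) b) a"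
proof -
  have "app (kron A B) x (a * m2 + b) = (\<Sum>p<n1 * n2. kron A B $$ (a * m2 + b, p) * x p)"
    using kron_carrier[OF A B] by (simp add: app_def)
  also have "\<dots> = (\<Sum>c<n1. \<Sum>d<n2. kron A B $$ (a * m2 + b, c * n2 + d) * x (c * n2 + d))"
    by (rule sum_lessThan_mult)
  also have "\<dots> = (\<Sum>c<n1. \<Sum>d<n2. A $$ (a, c) * B $$ (b, d) * x (c * n2 + d))"
    using A B i div_mod_lt_mult[of a m1 b m2] div_mod_lt_mult[of _ n1 _ n2]
    by (intro sum.cong refl) (simp add: kron_def)
  also have "\<dots> = app A (\<lambda>c. app B (\<lambda>d. x (c * n2 + d)) b) a"
    using A B by (simp add: app_def sum_distrib_left mult.assoc)
  finally show ?thesis .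
qed

text \<open>One matrix acting on several vectors is the sketch tensored with an identity, and this
  keeps g.\<close>

lemma moment_sketch_sum:
  assumes A: "moment_sketch g m n P"
  shows "fexp P (\<lambda>M. (\<Sum>i<k. sq_app M (x i))\<^sup>2) \<le> g * (\<Sum>i<k. ip n (x i) (x i))\<^sup>2"
  using moment_sketchD[OF A] by (intro fexp_sum_squared_le) auto

text \<open>Works as a product of M tensored with an identity and an identity tensored with N, each
  controlled by \<open>moment_sketch_sum\<close>.\<close>

lemma moment_sketch_kron:
  assumes A: "moment_sketch gA m1 n1 PA" and B: "moment_sketch gB m2 n2 PB" and g: "gA \<ge> 0"
  shows "moment_sketch (gA * gB) (m1 * m2) (n1 * n2) (map_pmf (\<lambda>(A, B). kron A B) (pair_pmf PA PB))"
proof -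
  let ?K = "map_pmf (\<lambda>(A, B). kron A B) (pair_pmf PA PB)"
  let ?y = "\<lambda>N x b c. app N (\<lambda>d. x (c * n2 + d)) b"
  have fin: "finite (set_pmf (pair_pmf PA PB))"
    using A B by (auto dest: moment_sketchD(1))
  have sq: "sq_app (kron M N) x = (\<Sum>b<m2. sq_app M (?y N x b))"
    if "M \<in> set_pmf PA" "N \<in> set_pmf PB" for M N x
  proof -
    have M: "M \<in> carrier_mat m1 n1" and N: "N \<in> carrier_mat m2 n2"
      using that A B by (auto dest: moment_sketchD(2))
    have "sq_app (kron M N) x = (\<Sum>a<m1. \<Sum>b<m2. app (kron M N) x (a * m2 + b) * app (kron M N) x (a * m2 + b))"
      using kron_carrier[OF M N] by (simp add: sq_app_def ip_def sum_lessThan_mult)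
    also have "\<dots> = (\<Sum>a<m1. \<Sum>b<m2. app M (?y N x b) a * app M (?y N x b) a)"
      by (intro sum.cong refl) (simp add: app_kron[OF M N])
    also have "\<dots> = (\<Sum>b<m2. \<Sum>a<m1. app M (?y N x b) a * app M (?y N x b) a)" by (rule sum.swap)
    finally show ?thesis using M by (simp add: sq_app_def ip_def)
  qed
  \<comment> \<open>The squared length of the intermediate array, summed by columns for M and by
    rows for N.\<close>
  have ysum: "(\<Sum>b<m2. ip n1 (?y N x b) (?y N x b)) = (\<Sum>c<n1. sq_app N (\<lambda>d. x (c * n2 + d)))"
    if "N \<in> set_pmf PB" for N x
    using moment_sketchD(2)[OF B that] unfolding ip_def sq_app_def
    by (subst sum.swap) simp
  have xsum: "(\<Sum>c<n1. ip n2 (\<lambda>d. x (c * n2 + d)) (\<lambda>d. x (c * n2 + d))) = ip (n1 * n2) x x" for x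
    by (simp add: ip_def sum_lessThan_mult)
  have swap: "fexp ?K (\<lambda>M. f (sq_app M x)) =
     fexp PB (\<lambda>N. fexp PA (\<lambda>M. f (\<Sum>b<m2. sq_app M (?y N x b))))" for f x
  proof -
    have "fexp ?K (\<lambda>M. f (sq_app M x)) = fexp PA (\<lambda>M. fexp PB (\<lambda>N. f (sq_app (kron M N) x)))"
      by (simp add: fexp_map[OF fin] fexp_pair)
    also have "\<dots> = fexp PA (\<lambda>M. fexp PB (\<lambda>N. f (\<Sum>b<m2. sq_app M (?y N x b))))"
      by (intro fexp_cong) (simp add: sq)
    finally show ?thesis by (subst (asm) fexp_swap)
  qed
  have "fexp ?K (\<lambda>M. sq_app M x) = ip (n1 * n2) x x" for x
  proof -
    have "fexp ?K (\<lambda>M. sq_app M x) = fexp PB (\<lambda>N. \<Sum>b<m2. ip n1 (?y N x b) (?y N x b))"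
      using swap[of "\<lambda>t. t"] by (simp add: fexp_sum moment_sketchD(3)[OF A])
    also have "\<dots> = fexp PB (\<lambda>N. \<Sum>c<n1. sq_app N (\<lambda>d. x (c * n2 + d)))"
      by (intro fexp_cong ysum)
    also have "\<dots> = ip (n1 * n2) x x" by (simp add: fexp_sum moment_sketchD(3)[OF B] xsum)
    finally show ?thesis .
  qed
  moreover have "fexp ?K (\<lambda>M. (sq_app M x)\<^sup>2) \<le> gA * gB * (ip (n1 * n2) x x)\<^sup>2" for x
  proof -
    have "fexp ?K (\<lambda>M. (sq_app M x)\<^sup>2) \<le> fexp PB (\<lambda>N. gA * (\<Sum>c<n1. sq_app N (\<lambda>d. x (c * n2 + d)))\<^sup>2)"
      unfolding swap[of "\<lambda>t. t\<^sup>2"]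
    proof (rule fexp_mono)
      fix N assume N: "N \<in> set_pmf PB"
      show "fexp PA (\<lambda>M. (\<Sum>b<m2. sq_app M (?y N x b))\<^sup>2) \<le> gA * (\<Sum>c<n1. sq_app N (\<lambda>d. x (c * n2 + d)))\<^sup>2"
        unfolding ysum[OF N, symmetric] by (rule moment_sketch_sum[OF A])
    qed
    also have "\<dots> \<le> gA * (gB * (\<Sum>c<n1. ip n2 (\<lambda>d. x (c * n2 + d)) (\<lambda>d. x (c * n2 + d)))\<^sup>2)"
      unfolding fexp_cmult using g by (intro mult_left_mono moment_sketch_sum[OF B])
    finally show ?thesis by (simp add: xsum)
  qed
  ultimately show ?thesis
    using fin moment_sketchD(2)[OF A] moment_sketchD(2)[OF B]
    unfolding moment_sketch_def by (auto intro: kron_carrier)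
qed

text \<open>The argument common to both sketches: column a has the single nonzero entry
  \<open>\<sigma> s a\<close>, in row \<open>\<eta> h a\<close>. Nonnegative fourth moments of the
  signs allow x to be replaced by |x| and every collision probability by 1/J.\<close>

lemma moment_sketch_of_hash_sign:
  fixes \<sigma> :: "'s \<Rightarrow> nat \<Rightarrow> real" and \<eta> :: "'h \<Rightarrow> nat \<Rightarrow> nat"
  assumes fin: "finite (set_pmf S)" "finite (set_pmf H)"
    and sq: "\<And>s a. s \<in> set_pmf S \<Longrightarrow> a < n \<Longrightarrow> \<sigma> s a * \<sigma> s a = 1"
    and range: "\<And>h a. h \<in> set_pmf H \<Longrightarrow> a < n \<Longrightarrow> \<eta> h a < J"
    and S2: "\<And>a b. a < n \<Longrightarrow> b < n \<Longrightarrow> fexp S (\<lambda>s. \<sigma> s a * \<sigma> s b) = of_bool (a = b)"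
    and S4: "\<And>a b c d. a < n \<Longrightarrow> b < n \<Longrightarrow> c < n \<Longrightarrow> d < n \<Longrightarrow>
       fexp S (\<lambda>s. \<sigma> s a * \<sigma> s b * (\<sigma> s c * \<sigma> s d)) \<ge> 0"
    and M4: "\<And>y. fexp S (\<lambda>s. (\<Sum>a<n. \<sigma> s a * y a) ^ 4) \<le> G * (ip n y y)\<^sup>2"
    and col: "\<And>a b. a < n \<Longrightarrow> b < n \<Longrightarrow> a \<noteq> b \<Longrightarrow> fexp H (\<lambda>h. of_bool (\<eta> h a = \<eta> h b)) \<le> 1 / real J"
    and T: "\<And>h s. h \<in> set_pmf H \<Longrightarrow> s \<in> set_pmf S \<Longrightarrow> T h s = mat J n (\<lambda>(j, a). \<sigma> s a * (if \<eta> h a = j then 1 else 0))"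
  shows "moment_sketch (1 + G / real J) J n (map_pmf (\<lambda>(h, s). T h s) (pair_pmf H S))"
proof -
  let ?P = "map_pmf (\<lambda>(h, s). T h s) (pair_pmf H S)"
  have finP: "finite (set_pmf (pair_pmf H S))" using fin by simp
  have norm: "sq_app (T h s) x = (\<Sum>a<n. \<Sum>b<n. (x a * x b) * (of_bool (\<eta> h a = \<eta> h b) * (\<sigma> s a * \<sigma> s b)))"
    if h: "h \<in> set_pmf H" and s: "s \<in> set_pmf S" for h s x
  proof -
    have app: "app (T h s) x j = (\<Sum>a<n. of_bool (\<eta> h a = j) * (\<sigma> s a * x a))" if "j < J" for j
    proof -
      have "app (T h s) x j = (\<Sum>a<n. (\<sigma> s a * (if \<eta> h a = j then 1 else 0)) * x a)"
        using that by (simp add: app_def T[OF h s])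
      also have "\<dots> = (\<Sum>a<n. of_bool (\<eta> h a = j) * (\<sigma> s a * x a))"
        by (rule sum.cong[OF refl]) (simp add: of_bool_def)
      finally show ?thesis .
    qed
    have "sq_app (T h s) x = (\<Sum>j<J. app (T h s) x j * app (T h s) x j)"
      by (simp add: sq_app_def ip_def T[OF h s])
    also have "\<dots> = (\<Sum>j<J. \<Sum>a<n. \<Sum>b<n. of_bool (\<eta> h a = j) * (\<sigma> s a * x a) * (of_bool (\<eta> h b = j) * (\<sigma> s b * x b)))"
      by (rule sum.cong[OF refl]) (simp only: app lessThan_iff sum_product)
    also have "\<dots> = (\<Sum>j<J. \<Sum>a<n. \<Sum>b<n. of_bool (\<eta> h a = j) * of_bool (\<eta> h b = j) * (\<sigma> s a * x a * (\<sigma> s b * x b)))"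
      by (simp only: mult_ac)
    also have "\<dots> = (\<Sum>a<n. \<Sum>b<n. \<Sum>j<J. of_bool (\<eta> h a = j) * of_bool (\<eta> h b = j) * (\<sigma> s a * x a * (\<sigma> s b * x b)))"
      by (rule trans[OF sum.swap], rule sum.cong[OF refl], rule sum.swap)
    also have "\<dots> = (\<Sum>a<n. \<Sum>b<n. (x a * x b) * (of_bool (\<eta> h a = \<eta> h b) * (\<sigma> s a * \<sigma> s b)))"
    proof (intro sum.cong refl)
      fix a b assume ab: "a \<in> {..<n}" "b \<in> {..<n}"
      have "(\<Sum>j<J. of_bool (\<eta> h a = j) * of_bool (\<eta> h b = j) * (\<sigma> s a * x a * (\<sigma> s b * x b))) =
        (\<Sum>j<J. if \<eta> h a = j then of_bool (\<eta> h b = j) * (\<sigma> s a * x a * (\<sigma> s b * x b)) else 0)"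
        by (intro sum.cong) auto
      also have "\<dots> = of_bool (\<eta> h b = \<eta> h a) * (\<sigma> s a * x a * (\<sigma> s b * x b))"
        using range[OF h, of a] ab by simp
      finally show "(\<Sum>j<J. of_bool (\<eta> h a = j) * of_bool (\<eta> h b = j) * (\<sigma> s a * x a * (\<sigma> s b * x b))) =
        (x a * x b) * (of_bool (\<eta> h a = \<eta> h b) * (\<sigma> s a * \<sigma> s b))" by (auto simp: mult_ac)
    qed
    finally show ?thesis .
  qed
  have expect: "fexp ?P (\<lambda>M. f (sq_app M x)) = fexp H (\<lambda>h. fexp S (\<lambda>s.
      f (\<Sum>a<n. \<Sum>b<n. (x a * x b) * (of_bool (\<eta> h a = \<eta> h b) * (\<sigma> s a * \<sigma> s b)))))" for f x
    by (simp add: fexp_map[OF finP] fexp_pair norm cong: fexp_cong)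
  have mean: "fexp ?P (\<lambda>M. sq_app M x) = ip n x x" for x
  proof -
    have "fexp ?P (\<lambda>M. sq_app M x) = (\<Sum>a<n. \<Sum>b<n. (x a * x b) *
        (fexp H (\<lambda>h. of_bool (\<eta> h a = \<eta> h b)) * fexp S (\<lambda>s. \<sigma> s a * \<sigma> s b)))"
      unfolding expect[of "\<lambda>t. t"] by (simp only: fexp_sum fexp_cmult fexp_mult_const)
    also have "\<dots> = (\<Sum>a<n. \<Sum>b<n. if a = b then x a * x a else 0)"
      using fin by (intro sum.cong refl) (auto simp: S2)
    finally show ?thesis by (simp add: ip_def)
  qed
  have fourth: "fexp ?P (\<lambda>M. (sq_app M x)\<^sup>2) \<le> (1 + G / real J) * (ip n x x)\<^sup>2" for x
  proof -
    let ?E = "\<lambda>a b c d. fexp S (\<lambda>s. \<sigma> s a * \<sigma> s b * (\<sigma> s c * \<sigma> s d))"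
    let ?C = "\<lambda>a b c d. fexp H (\<lambda>h. of_bool (\<eta> h a = \<eta> h b) * of_bool (\<eta> h c = \<eta> h d))"
    have "fexp ?P (\<lambda>M. (sq_app M x)\<^sup>2) = (\<Sum>a<n. \<Sum>b<n. \<Sum>c<n. \<Sum>d<n.
       fexp H (\<lambda>h. fexp S (\<lambda>s. (x a * x b) * (of_bool (\<eta> h a = \<eta> h b) * (\<sigma> s a * \<sigma> s b)) *
         ((x c * x d) * (of_bool (\<eta> h c = \<eta> h d) * (\<sigma> s c * \<sigma> s d))))))"
      unfolding expect[of "\<lambda>t. t\<^sup>2"] by (simp only: pow4_sum_expand(2) fexp_sum)
    also have "\<dots> = (\<Sum>a<n. \<Sum>b<n. \<Sum>c<n. \<Sum>d<n. (x a * x b * (x c * x d)) * (?C a b c d * ?E a b c d))"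
    proof (intro sum.cong refl)
      fix a b c d
      let ?lhs = "fexp H (\<lambda>h. fexp S (\<lambda>s. (x a * x b) * (of_bool (\<eta> h a = \<eta> h b) * (\<sigma> s a * \<sigma> s b)) *
         ((x c * x d) * (of_bool (\<eta> h c = \<eta> h d) * (\<sigma> s c * \<sigma> s d)))))"
      have "?lhs =
        fexp H (\<lambda>h. fexp S (\<lambda>s. (x a * x b * (x c * x d)) * ((of_bool (\<eta> h a = \<eta> h b) * of_bool (\<eta> h c = \<eta> h d)) *
         (\<sigma> s a * \<sigma> s b * (\<sigma> s c * \<sigma> s d)))))"
        by (intro fexp_cong) (simp add: mult_ac)
      then show "?lhs =
         (x a * x b * (x c * x d)) * (?C a b c d * ?E a b c d)"
        by (simp only: fexp_cmult fexp_mult_const)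
    qed
    \<comment> \<open>Terms with a = b and c = d sum to |x|^4. Terms with a = b and c \<noteq> d
      vanish. The remaining ones need a collision of a and b, hence the factor 1/J.\<close>
    also have "\<dots> \<le> (\<Sum>a<n. \<Sum>b<n. \<Sum>c<n. \<Sum>d<n. of_bool (a = b) * of_bool (c = d) * ((x a)\<^sup>2 * (x c)\<^sup>2) +
        1 / real J * (\<bar>x a\<bar> * \<bar>x b\<bar> * (\<bar>x c\<bar> * \<bar>x d\<bar>) * ?E a b c d))"
    proof (intro sum_mono)
      fix a b c d assume "a \<in> {..<n}" "b \<in> {..<n}" "c \<in> {..<n}" "d \<in> {..<n}"
      then have I: "a < n" "b < n" "c < n" "d < n" by auto
      have E0: "?E a b c d \<ge> 0" using I by (rule S4)
      have C0: "?C a b c d \<ge> 0" by (intro fexp_nonneg) auto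
      have rest: "1 / real J * (\<bar>x a\<bar> * \<bar>x b\<bar> * (\<bar>x c\<bar> * \<bar>x d\<bar>) * ?E a b c d) \<ge> 0" using E0 by simp
      have Eab: "?E a b c d = of_bool (c = d)" if "a = b"
      proof -
        have "?E a b c d = fexp S (\<lambda>s. \<sigma> s c * \<sigma> s d)" using that sq I by (intro fexp_cong) auto
        then show ?thesis using S2 I by simp
      qed
      have Ecd: "?E a b c d = of_bool (a = b)" if "c = d"
      proof -
        have "?E a b c d = fexp S (\<lambda>s. \<sigma> s a * \<sigma> s b)" using that sq I by (intro fexp_cong) auto
        then show ?thesis using S2 I by simp
      qed
      show "(x a * x b * (x c * x d)) * (?C a b c d * ?E a b c d) \<le>
        of_bool (a = b) * of_bool (c = d) * ((x a)\<^sup>2 * (x c)\<^sup>2) +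
        1 / real J * (\<bar>x a\<bar> * \<bar>x b\<bar> * (\<bar>x c\<bar> * \<bar>x d\<bar>) * ?E a b c d)"
      proof (cases "a = b")
        case True
        show ?thesis
        proof (cases "c = d")
          case cd: True
          have "?C a b c d = 1" using True cd fin by simp
          then show ?thesis using rest Eab[OF True] True cd by (simp add: power2_eq_square)
        next
          case False
          then show ?thesis using rest Eab[OF True] by simp
        qed
      next
        case False
        have "?C a b c d \<le> fexp H (\<lambda>h. of_bool (\<eta> h a = \<eta> h b))" by (intro fexp_mono) auto
        also have "\<dots> \<le> 1 / real J" using I False by (intro col)
        finally have C: "?C a b c d \<le> 1 / real J" .
        have "(x a * x b * (x c * x d)) * (?C a b c d * ?E a b c d) \<le>
            \<bar>x a * x b * (x c * x d)\<bar> * (?C a b c d * ?E a b c d)"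
          using E0 C0 by (intro mult_right_mono) auto
        also have "\<dots> \<le> \<bar>x a * x b * (x c * x d)\<bar> * (1 / real J * ?E a b c d)"
          using C E0 by (intro mult_left_mono mult_right_mono) auto
        also have "\<dots> = 1 / real J * (\<bar>x a\<bar> * \<bar>x b\<bar> * (\<bar>x c\<bar> * \<bar>x d\<bar>) * ?E a b c d)"
          by (simp add: abs_mult)
        finally show ?thesis using False by simp
      qed
    qed
    also have "\<dots> = (ip n x x)\<^sup>2 + 1 / real J * fexp S (\<lambda>s. (\<Sum>a<n. \<sigma> s a * \<bar>x a\<bar>) ^ 4)"
    proof -
      note 1 = sum_pair_diagonal[of x n]
      have "fexp S (\<lambda>s. (\<Sum>a<n. \<sigma> s a * \<bar>x a\<bar>) ^ 4) =
         (\<Sum>a<n. \<Sum>b<n. \<Sum>c<n. \<Sum>d<n. fexp S (\<lambda>s. \<sigma> s a * \<bar>x a\<bar> * (\<sigma> s b * \<bar>x b\<bar>) * (\<sigma> s c * \<bar>x c\<bar> * (\<sigma> s d * \<bar>x d\<bar>))))"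
        by (simp only: pow4_sum_expand(1) fexp_sum)
      also have "\<dots> = (\<Sum>a<n. \<Sum>b<n. \<Sum>c<n. \<Sum>d<n. \<bar>x a\<bar> * \<bar>x b\<bar> * (\<bar>x c\<bar> * \<bar>x d\<bar>) * ?E a b c d)"
        unfolding fexp_cmult[symmetric] by (intro sum.cong refl fexp_cong) (simp add: mult_ac)
      finally have 2: "fexp S (\<lambda>s. (\<Sum>a<n. \<sigma> s a * \<bar>x a\<bar>) ^ 4) =
        (\<Sum>a<n. \<Sum>b<n. \<Sum>c<n. \<Sum>d<n. \<bar>x a\<bar> * \<bar>x b\<bar> * (\<bar>x c\<bar> * \<bar>x d\<bar>) * ?E a b c d)" .
      show ?thesis unfolding 2 by (simp only: sum.distrib 1 sum_distrib_left)
    qed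
    also have "\<dots> \<le> (ip n x x)\<^sup>2 + 1 / real J * (G * (ip n (\<lambda>a. \<bar>x a\<bar>) (\<lambda>a. \<bar>x a\<bar>))\<^sup>2)"
      by (intro add_left_mono mult_left_mono M4) auto
    also have "ip n (\<lambda>a. \<bar>x a\<bar>) (\<lambda>a. \<bar>x a\<bar>) = ip n x x" by (simp add: ip_def)
    finally show ?thesis by (simp add: algebra_simps)
  qed
  have "set_pmf ?P \<subseteq> carrier_mat J n" using T by auto
  then show ?thesis using finP mean fourth unfolding moment_sketch_def by simp
qed

text \<open>For each value of \<open>h a\<close> at most one value of \<open>h b\<close> collides.
  The shifts stand for the other hash of a TensorSketch once it is fixed.\<close>

lemma shifted_hash_collision:
  fixes c d :: nat
  assumes H: "k_wise_independent 3 I {..<J} H" and J: "J > 0" and ab: "a < I" "b < I" "a \<noteq> b"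
  shows "fexp H (\<lambda>h. of_bool ((h a + c) mod J = (h b + d) mod J)) \<le> 1 / real J"
proof -
  have inner: "(\<Sum>t<J. of_bool ((u + c) mod J = (t + d) mod J)) \<le> (1::real)" for u
  proof -
    have "card {t. t < J \<and> (u + c) mod J = (t + d) mod J} \<le> 1"
    proof (rule card_le_Suc0_iff_eq[THEN iffD2, folded One_nat_def])
      show "\<forall>x\<in>{t. t < J \<and> (u + c) mod J = (t + d) mod J}. \<forall>y\<in>{t. t < J \<and> (u + c) mod J = (t + d) mod J}. x = y"
      proof (intro ballI)
        have eq: "x = y" if "x \<le> y" "y < J" "(x + d) mod J = (y + d) mod J" for x y
        proof -
          have "J dvd (y + d) - (x + d)" using that by (subst mod_eq_dvd_iff_nat[symmetric]) auto
          then have "J dvd y - x" by simp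
          then show ?thesis using that by (auto dest: dvd_imp_le)
        qed
        fix x y assume "x \<in> {t. t < J \<and> (u + c) mod J = (t + d) mod J}"
          and "y \<in> {t. t < J \<and> (u + c) mod J = (t + d) mod J}"
        then show "x = y" using eq[of x y] eq[of y x] by (cases "x \<le> y") auto
      qed
    qed simp
    then have "real (card {t. t < J \<and> (u + c) mod J = (t + d) mod J}) \<le> 1" by linarith
    moreover have "(\<Sum>t<J. of_bool ((u + c) mod J = (t + d) mod J)) = real (card {t. t < J \<and> (u + c) mod J = (t + d) mod J})"
      by (simp add: Int_def)
    ultimately show ?thesis by simp
  qed
  have "fexp H (\<lambda>h. of_bool ((h a + c) mod J = (h b + d) mod J)) =
    (\<Sum>u<J. \<Sum>t<J. of_bool ((u + c) mod J = (t + d) mod J)) / (real J)\<^sup>2"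
    using pairwise_independent_fexp[OF H _ J ab, of "\<lambda>u t. of_bool ((u + c) mod J = (t + d) mod J)"] by simp
  also have "\<dots> \<le> (\<Sum>u<J. 1) / (real J)\<^sup>2" by (intro divide_right_mono sum_mono inner) auto
  also have "\<dots> = 1 / real J" using J by (simp add: power2_eq_square)
  finally show ?thesis .
qed

lemma sign_fexp_4_nonneg:
  assumes "k_wise_independent 4 I {-1, 1} S" "a < I" "b < I" "c < I" "d < I"
  shows "fexp S (\<lambda>s. s a * s b * (s c * s d)) \<ge> 0"
proof -
  have "of_bool Q \<ge> (0::real)" for Q by (cases Q) auto
  then show ?thesis unfolding sign_fexp_4[OF assms] .
qed

text \<open>A single sign sequence gives 3; this is weakened to 9 so that both kinds of sketch share
  one constant.\<close>

lemma count_sketch_fourth_moment: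
  assumes P: "is_count_sketch J I P" and J: "J > 0"
  shows "moment_sketch (1 + 9 / real J) J I P"
proof -
  obtain H S where H: "k_wise_independent 3 I {..<J} H" and S: "k_wise_independent 4 I {-1, 1} S"
    and P: "P = map_pmf (\<lambda>(h, s). count_sketch_mat J I h s) (pair_pmf H S)"
    using P by (auto simp: is_count_sketch_def)
  show ?thesis unfolding P
  proof (rule moment_sketch_of_hash_sign[where \<sigma> = "\<lambda>s. s" and \<eta> = "\<lambda>h. h"])
    show "finite (set_pmf S)" by (rule k_wise_independent_finite[OF S]) simp
    show "finite (set_pmf H)" by (rule k_wise_independent_finite[OF H]) simp
  next
    fix a b assume "a < I" "b < I"
    then show "fexp S (\<lambda>s. s a * s b) = of_bool (a = b)" by (rule sign_fexp_2[OF S])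
  next
    fix a b c d assume "a < I" "b < I" "c < I" "d < I"
    then show "fexp S (\<lambda>s. s a * s b * (s c * s d)) \<ge> 0" by (rule sign_fexp_4_nonneg[OF S])
  next
    fix s a assume "s \<in> set_pmf S" "a < I"
    from k_wise_independent_range[OF S this] show "s a * s a = 1" by auto
  next
    fix h a assume "h \<in> set_pmf H" "a < I"
    from k_wise_independent_range[OF H this] show "h a < J" by simp
  next
    fix y
    have "fexp S (\<lambda>s. (\<Sum>a<I. s a * y a) ^ 4) \<le> 3 * (ip I y y)\<^sup>2" by (rule sign_fourth_moment[OF S])
    also have "\<dots> \<le> 9 * (ip I y y)\<^sup>2" by simp
    finally show "fexp S (\<lambda>s. (\<Sum>a<I. s a * y a) ^ 4) \<le> 9 * (ip I y y)\<^sup>2" .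
  next
    fix a b assume "a < I" "b < I" "a \<noteq> b"
    from shifted_hash_collision[OF H J this, of 0 0]
    have "fexp H (\<lambda>h. of_bool (h a mod J = h b mod J)) \<le> 1 / real J" by simp
    moreover have "fexp H (\<lambda>h. of_bool (h a mod J = h b mod J)) = fexp H (\<lambda>h. of_bool (h a = h b))"
    proof (rule fexp_cong)
      fix h assume h: "h \<in> set_pmf H"
      have "h a < J" "h b < J"
        using k_wise_independent_range[OF H h \<open>a < I\<close>] k_wise_independent_range[OF H h \<open>b < I\<close>] by auto
      then show "of_bool (h a mod J = h b mod J) = (of_bool (h a = h b) :: real)" by simp
    qed
    ultimately show "fexp H (\<lambda>h. of_bool (h a = h b)) \<le> 1 / real J" by simp
  qed (rule count_sketch_mat_def)
qed

lemma tensor_sketch_fourth_moment: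
  assumes P: "is_tensor_sketch J I P" and J: "J > 0"
  shows "moment_sketch (1 + 9 / real J) J (I\<^sup>2) P"
proof -
  obtain H1 H2 S1 S2 where H1: "k_wise_independent 3 I {..<J} H1" and H2: "k_wise_independent 3 I {..<J} H2"
    and S1: "k_wise_independent 4 I {-1, 1} S1" and S2: "k_wise_independent 4 I {-1, 1} S2"
    and P: "P = map_pmf (\<lambda>(h1, h2, s1, s2). tensor_sketch_mat J I h1 h2 s1 s2)
              (pair_pmf H1 (pair_pmf H2 (pair_pmf S1 S2)))"
    using P by (auto simp: is_tensor_sketch_def)
  define \<sigma> where "\<sigma> = (\<lambda>(s1 :: nat \<Rightarrow> real, s2 :: nat \<Rightarrow> real) p. s1 (p mod I) * s2 (p div I))"
  define \<eta> where "\<eta> = (\<lambda>(h1 :: nat \<Rightarrow> nat, h2 :: nat \<Rightarrow> nat) p. (Suc (h1 (p mod I)) + Suc (h2 (p div I))) mod J)"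
  have fin: "finite (set_pmf S1)" "finite (set_pmf S2)" "finite (set_pmf H1)" "finite (set_pmf H2)"
    by (rule k_wise_independent_finite[OF S1] k_wise_independent_finite[OF S2]
      k_wise_independent_finite[OF H1] k_wise_independent_finite[OF H2], simp)+
  have idx: "p mod I < I" "p div I < I" if "p < I\<^sup>2" for p
  proof -
    have "I > 0" using that by (cases I) auto
    then show "p mod I < I" "p div I < I" using that by (auto simp: div_less_iff_less_mult power2_eq_square)
  qed
  have eqI: "p = p'" if "p mod I = p' mod I" "p div I = p' div I" for p p'
    using that by (metis div_mult_mod_eq)
  \<comment> \<open>Groups the two hashes and the two sign sequences, to match the one-hash,
    one-sign form.\<close>
  have P': "P = map_pmf (\<lambda>((h1, h2), (s1, s2)). tensor_sketch_mat J I h1 h2 s1 s2)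
      (pair_pmf (pair_pmf H1 H2) (pair_pmf S1 S2))"
    unfolding P pair_pair_pmf by (simp add: map_pmf_comp case_prod_unfold)
  have "moment_sketch (1 + 9 / real J) J (I\<^sup>2)
     (map_pmf (\<lambda>(h, s). case h of (h1, h2) \<Rightarrow> case s of (s1, s2) \<Rightarrow> tensor_sketch_mat J I h1 h2 s1 s2)
      (pair_pmf (pair_pmf H1 H2) (pair_pmf S1 S2)))"
  proof (rule moment_sketch_of_hash_sign[where \<sigma> = \<sigma> and \<eta> = \<eta>])
    show "finite (set_pmf (pair_pmf S1 S2))" "finite (set_pmf (pair_pmf H1 H2))" using fin by auto
  next
    fix s p assume s: "s \<in> set_pmf (pair_pmf S1 S2)" and p: "p < I\<^sup>2"
    then obtain s1 s2 where s: "s = (s1, s2)" "s1 \<in> set_pmf S1" "s2 \<in> set_pmf S2" by auto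
    have "s1 (p mod I) \<in> {-1, 1}" "s2 (p div I) \<in> {-1, 1}"
      using k_wise_independent_range[OF S1 s(2) idx(1)[OF p]] k_wise_independent_range[OF S2 s(3) idx(2)[OF p]] by auto
    then show "\<sigma> s p * \<sigma> s p = 1" by (auto simp: \<sigma>_def s)
  next
    fix h p assume "h \<in> set_pmf (pair_pmf H1 H2)" and "p < I\<^sup>2"
    then show "\<eta> h p < J" using J by (auto simp: \<eta>_def)
  next
    fix a b assume ab: "a < I\<^sup>2" "b < I\<^sup>2"
    have "fexp (pair_pmf S1 S2) (\<lambda>s. \<sigma> s a * \<sigma> s b) =
       fexp (pair_pmf S1 S2) (\<lambda>(s1, s2). (s1 (a mod I) * s1 (b mod I)) * (s2 (a div I) * s2 (b div I)))"
      by (intro fexp_cong) (auto simp: \<sigma>_def)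
    also have "\<dots> = of_bool (a mod I = b mod I) * of_bool (a div I = b div I)"
      using idx ab by (simp only: fexp_pair_mult sign_fexp_2[OF S1] sign_fexp_2[OF S2])
    also have "\<dots> = of_bool (a = b)"
      using eqI[of a b] by (cases "a mod I = b mod I"; cases "a div I = b div I") auto
    finally show "fexp (pair_pmf S1 S2) (\<lambda>s. \<sigma> s a * \<sigma> s b) = of_bool (a = b)" .
  next
    fix a b c d assume abcd: "a < I\<^sup>2" "b < I\<^sup>2" "c < I\<^sup>2" "d < I\<^sup>2"
    have "fexp (pair_pmf S1 S2) (\<lambda>s. \<sigma> s a * \<sigma> s b * (\<sigma> s c * \<sigma> s d)) =
       fexp (pair_pmf S1 S2) (\<lambda>(s1, s2). (s1 (a mod I) * s1 (b mod I) * (s1 (c mod I) * s1 (d mod I))) *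
         (s2 (a div I) * s2 (b div I) * (s2 (c div I) * s2 (d div I))))"
      by (intro fexp_cong) (auto simp: \<sigma>_def)
    also have "\<dots> \<ge> 0"
      unfolding fexp_pair_mult
      by (intro mult_nonneg_nonneg sign_fexp_4_nonneg[OF S1] sign_fexp_4_nonneg[OF S2] idx abcd)
    finally show "fexp (pair_pmf S1 S2) (\<lambda>s. \<sigma> s a * \<sigma> s b * (\<sigma> s c * \<sigma> s d)) \<ge> 0" .
  next
    fix y :: "nat \<Rightarrow> real"
    let ?z = "\<lambda>(s1 :: nat \<Rightarrow> real) i. \<Sum>j<I. s1 j * y (i * I + j)"
    have split: "(\<Sum>a<I\<^sup>2. \<sigma> (s1, s2) a * y a) = (\<Sum>i<I. s2 i * ?z s1 i)" for s1 s2
      unfolding power2_eq_square sum_lessThan_mult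
      by (auto simp: \<sigma>_def sum_distrib_left intro!: sum.cong)
    have "fexp (pair_pmf S1 S2) (\<lambda>s. (\<Sum>a<I\<^sup>2. \<sigma> s a * y a) ^ 4) =
      fexp S1 (\<lambda>s1. fexp S2 (\<lambda>s2. (\<Sum>i<I. s2 i * ?z s1 i) ^ 4))"
      by (simp add: fexp_pair split)
    \<comment> \<open>For fixed s1 the sum is a signed sum in s2, costing a factor 3. The squared
      coefficients are then summed over i, and s1 costs the second 3.\<close>
    also have "\<dots> \<le> fexp S1 (\<lambda>s1. 3 * (\<Sum>i<I. (?z s1 i)\<^sup>2)\<^sup>2)"
      using sign_fourth_moment[OF S2] by (intro fexp_mono) (simp add: ip_def power2_eq_square)
    also have "\<dots> \<le> 3 * (3 * (\<Sum>i<I. ip I (\<lambda>j. y (i * I + j)) (\<lambda>j. y (i * I + j)))\<^sup>2)"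
      unfolding fexp_cmult
    proof (intro mult_left_mono fexp_sum_squared_le fin)
      fix i
      show "fexp S1 (\<lambda>s1. ((?z s1 i)\<^sup>2)\<^sup>2) \<le> 3 * (ip I (\<lambda>j. y (i * I + j)) (\<lambda>j. y (i * I + j)))\<^sup>2"
        using sign_fourth_moment[OF S1, of "\<lambda>j. y (i * I + j)"] by simp
    qed auto
    also have "(\<Sum>i<I. ip I (\<lambda>j. y (i * I + j)) (\<lambda>j. y (i * I + j))) = ip (I\<^sup>2) y y"
      by (simp add: ip_def power2_eq_square sum_lessThan_mult)
    finally show "fexp (pair_pmf S1 S2) (\<lambda>s. (\<Sum>a<I\<^sup>2. \<sigma> s a * y a) ^ 4) \<le> 9 * (ip (I\<^sup>2) y y)\<^sup>2" by simp
  next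
    fix a b assume ab: "a < I\<^sup>2" "b < I\<^sup>2" "a \<noteq> b"
    show "fexp (pair_pmf H1 H2) (\<lambda>h. of_bool (\<eta> h a = \<eta> h b)) \<le> 1 / real J"
    \<comment> \<open>Distinct columns differ in at least one coordinate. The hash of that
      coordinate is averaged with the other one fixed; the two \<open>Suc\<close> account for the 2
      in the shift.\<close>
    proof (cases "a mod I = b mod I")
      case False
      have "fexp (pair_pmf H1 H2) (\<lambda>h. of_bool (\<eta> h a = \<eta> h b)) =
         fexp H2 (\<lambda>h2. fexp H1 (\<lambda>h1. of_bool ((h1 (a mod I) + (2 + h2 (a div I))) mod J = (h1 (b mod I) + (2 + h2 (b div I))) mod J)))"
        by (subst fexp_pair, subst fexp_swap) (simp add: \<eta>_def add_ac)
      also have "\<dots> \<le> fexp H2 (\<lambda>_. 1 / real J)"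
        using False idx ab by (intro fexp_mono shifted_hash_collision[OF H1 J]) auto
      finally show ?thesis using fin by simp
    next
      case True
      then have "a div I \<noteq> b div I" using eqI[of a b] ab(3) by blast
      have "fexp (pair_pmf H1 H2) (\<lambda>h. of_bool (\<eta> h a = \<eta> h b)) =
         fexp H1 (\<lambda>h1. fexp H2 (\<lambda>h2. of_bool ((h2 (a div I) + (2 + h1 (a mod I))) mod J = (h2 (b div I) + (2 + h1 (b mod I))) mod J)))"
        by (subst fexp_pair) (simp add: \<eta>_def add_ac)
      also have "\<dots> \<le> fexp H1 (\<lambda>_. 1 / real J)"
        using \<open>a div I \<noteq> b div I\<close> idx ab by (intro fexp_mono shifted_hash_collision[OF H2 J]) auto
      finally show ?thesis using fin by simp
    qed
  next
    fix h s
    show "(case h of (h1, h2) \<Rightarrow> case s of (s1, s2) \<Rightarrow> tensor_sketch_mat J I h1 h2 s1 s2) =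
        mat J (I\<^sup>2) (\<lambda>(j, a). \<sigma> s a * (if \<eta> h a = j then 1 else 0))"
      by (cases h; cases s) (simp only: tensor_sketch_mat_def \<sigma>_def \<eta>_def Let_def prod.case)
  qed
  then show ?thesis unfolding P' by (simp add: case_prod_unfold)
qed

section \<open>The recursive sketch\<close>

text \<open>The index type is left open: CountSketches are indexed by numbers, TensorSketches by
  pairs. Distinctness lets \<open>Pi_pmf\<close> split off the head.\<close>

lemma moment_sketch_kron_list:
  assumes "distinct xs" and P: "\<And>k. k \<in> set xs \<Longrightarrow> moment_sketch g (m k) (n k) (P k)" and g: "g \<ge> 0"
  shows "moment_sketch (g ^ length xs) (\<Prod>k\<leftarrow>xs. m k) (\<Prod>k\<leftarrow>xs. n k)
     (map_pmf (\<lambda>C. kron_list (map C xs)) (Pi_pmf (set xs) d P))"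
  using assms(1) P
proof (induction xs)
  case Nil
  have "sq_app (1\<^sub>m 1) x = ip 1 x x" for x by (simp add: sq_app_def ip_def app_def)
  then show ?case by (auto simp: moment_sketch_def fexp_def)
next
  case (Cons k xs)
  let ?K = "map_pmf (\<lambda>C. kron_list (map C xs)) (Pi_pmf (set xs) d P)"
  have upd: "map (C(k := M)) xs = map C xs" for C M using Cons.prems by auto
  have "map_pmf (\<lambda>C. kron_list (map C (k # xs))) (Pi_pmf (set (k # xs)) d P) =
      map_pmf (\<lambda>(A, B). kron A B) (pair_pmf (P k) ?K)"
    using Cons.prems by (simp add: Pi_pmf_insert pair_map_pmf2 map_pmf_comp case_prod_unfold upd fun_upd_def[symmetric] del: fun_upd_apply)
      (simp add: upd)
  moreover have "moment_sketch (g * g ^ length xs) (m k * (\<Prod>k\<leftarrow>xs. m k)) (n k * (\<Prod>k\<leftarrow>xs. n k))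
      (map_pmf (\<lambda>(A, B). kron A B) (pair_pmf (P k) ?K))"
    using Cons g by (intro moment_sketch_kron) auto
  ultimately show ?case by simp
qed

lemma sketch_product_cong:
  assumes "\<And>k. k < 2 ^ q \<Longrightarrow> C k = C' k"
    and "\<And>j k. j \<in> {1..m} \<Longrightarrow> k < 2 ^ (q - j) \<Longrightarrow> T (j, k) = T' (j, k)"
  shows "sketch_product q C T m = sketch_product q C' T' m"
  using assms
proof (induction m)
  case 0
  then have "map C [0..<2 ^ q] = map C' [0..<2 ^ q]" by (intro map_cong) auto
  then show ?case by (simp only: sketch_product.simps)
next
  case (Suc m)
  then have "map (\<lambda>k. T (Suc m, k)) [0..<2 ^ (q - Suc m)] = map (\<lambda>k. T' (Suc m, k)) [0..<2 ^ (q - Suc m)]"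
    by (intro map_cong) auto
  moreover have "sketch_product q C T m = sketch_product q C' T' m" using Suc by auto
  ultimately show ?case by (simp only: sketch_product.simps)
qed

text \<open>The exponent counts the matrices up to level m: 2^q leaves, and 2^(q-j) TensorSketches
  at each level j from 1 to m.\<close>

lemma sketch_product_fourth_moment:
  fixes q :: nat
  assumes C: "\<And>k. k < 2 ^ q \<Longrightarrow> moment_sketch g J (Is ! k) (PC k)"
    and T: "\<And>j k. j \<in> {1..q} \<Longrightarrow> k < 2 ^ (q - j) \<Longrightarrow> moment_sketch g J (J\<^sup>2) (PT (j, k))"
    and g: "g \<ge> 0" and len: "length Is = 2 ^ q" and "m \<le> q"
  shows "moment_sketch (g ^ (2 * 2 ^ q - 2 ^ (q - m))) (J ^ 2 ^ (q - m)) (prod_list Is)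
     (map_pmf (\<lambda>(C, T). sketch_product q C T m)
        (pair_pmf (Pi_pmf {..<2 ^ q} d PC) (Pi_pmf (SIGMA j:{1..m}. {..<2 ^ (q - j)}) d PT)))"
  using \<open>m \<le> q\<close>
proof (induction m)
  case 0
  have "moment_sketch (g ^ length [0..<2 ^ q]) (\<Prod>k\<leftarrow>[0..<2 ^ q]. J) (\<Prod>k\<leftarrow>[0..<2 ^ q]. Is ! k)
     (map_pmf (\<lambda>C. kron_list (map C [0..<2 ^ q])) (Pi_pmf (set [0..<2 ^ q]) d PC))"
    using C g by (intro moment_sketch_kron_list) auto
  moreover have "map ((!) Is) [0..<2 ^ q] = Is" using len by (metis map_nth)
  ultimately show ?case
    by (simp add: pair_return_pmf2 map_pmf_comp prod_list_replicate map_replicate_const lessThan_atLeast0 case_prod_unfold)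
next
  case (Suc m)
  let ?S = "\<lambda>m. SIGMA j:{1..m}. {..<2 ^ (q - j) :: nat}"
  let ?N = "2 ^ (q - Suc m) :: nat"
  let ?B = "Pair (Suc m) ` {..<?N}"
  let ?ks = "map (Pair (Suc m)) [0..<?N]"
  let ?L = "map_pmf (\<lambda>(C, T). sketch_product q C T m) (pair_pmf (Pi_pmf {..<2 ^ q} d PC) (Pi_pmf (?S m) d PT))"
  let ?K = "map_pmf (\<lambda>T. kron_list (map T ?ks)) (Pi_pmf ?B d PT)"
  have two: "(2::nat) ^ (q - m) = 2 * ?N"
  proof -
    have "q - m = Suc (q - Suc m)" using Suc.prems by simp
    then show ?thesis by (simp only: power_Suc)
  qed
  have K: "moment_sketch (g ^ length ?ks) (\<Prod>k\<leftarrow>?ks. J) (\<Prod>k\<leftarrow>?ks. J\<^sup>2)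
     (map_pmf (\<lambda>T. kron_list (map T ?ks)) (Pi_pmf (set ?ks) d PT))"
    using T g Suc.prems by (intro moment_sketch_kron_list) (auto simp: distinct_map inj_on_def)
  have K: "moment_sketch (g ^ ?N) (J ^ ?N) (J ^ 2 ^ (q - m)) ?K"
    using K by (simp add: two power_mult map_replicate_const prod_list_replicate comp_def lessThan_atLeast0)
  have L: "moment_sketch (g ^ (2 * 2 ^ q - 2 ^ (q - m))) (J ^ 2 ^ (q - m)) (prod_list Is) ?L"
    using Suc by simp
  have "moment_sketch (g ^ ?N * g ^ (2 * 2 ^ q - 2 ^ (q - m))) (J ^ ?N) (prod_list Is)
      (map_pmf (\<lambda>(A, B). A * B) (pair_pmf ?K ?L))"
    using g by (intro moment_sketch_mult[OF K L]) simp
  moreover have "g ^ ?N * g ^ (2 * 2 ^ q - 2 ^ (q - m)) = g ^ (2 * 2 ^ q - ?N)"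
  proof -
    have "(2::nat) ^ (q - m) \<le> 2 ^ q" by (rule power_increasing) auto
    then have "?N + (2 * 2 ^ q - 2 ^ (q - m)) = 2 * 2 ^ q - ?N" using two by linarith
    then show ?thesis by (simp flip: power_add)
  qed
  moreover have "map_pmf (\<lambda>(A, B). A * B) (pair_pmf ?K ?L) =
     map_pmf (\<lambda>(C, T). sketch_product q C T (Suc m)) (pair_pmf (Pi_pmf {..<2 ^ q} d PC) (Pi_pmf (?S (Suc m)) d PT))"
  proof -
    \<comment> \<open>The new level is a disjoint block of indices, so its TensorSketches are
      independent of the lower product.\<close>
    have S: "?S (Suc m) = ?S m \<union> ?B" by (auto simp: le_Suc_eq)
    have fin: "finite (?S m)" "finite ?B" and disj: "?S m \<inter> ?B = {}" by auto
    let ?un = "\<lambda>T T' x. if x \<in> ?S m then T x else T' x"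
    have prod: "sketch_product q C (?un T T') (Suc m) =
        kron_list (map T' ?ks) * sketch_product q C T m" for C T T'
    proof -
      have "sketch_product q C (?un T T') m = sketch_product q C T m"
        by (intro sketch_product_cong) auto
      moreover have "map (\<lambda>k. ?un T T' (Suc m, k)) [0..<?N] = map T' ?ks" by simp
      ultimately show ?thesis by (simp only: sketch_product.simps)
    qed
    have "map_pmf (\<lambda>(C, T). sketch_product q C T (Suc m)) (pair_pmf (Pi_pmf {..<2 ^ q} d PC) (Pi_pmf (?S (Suc m)) d PT)) =
        map_pmf (\<lambda>(C, T, T'). sketch_product q C (?un T T') (Suc m))
          (pair_pmf (Pi_pmf {..<2 ^ q} d PC) (pair_pmf (Pi_pmf (?S m) d PT) (Pi_pmf ?B d PT)))"
      unfolding S Pi_pmf_union[OF fin disj] pair_map_pmf2 map_pmf_comp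
      by (rule arg_cong[where f = "\<lambda>f. map_pmf f _"]) (auto simp: fun_eq_iff apsnd_def map_prod_def split: prod.splits)
    also have "\<dots> = map_pmf (\<lambda>((C, T), T'). kron_list (map T' ?ks) * sketch_product q C T m)
          (pair_pmf (pair_pmf (Pi_pmf {..<2 ^ q} d PC) (Pi_pmf (?S m) d PT)) (Pi_pmf ?B d PT))"
      unfolding prod pair_pair_pmf map_pmf_comp
      by (rule arg_cong[where f = "\<lambda>f. map_pmf f _"]) (auto simp: fun_eq_iff)
    also have "\<dots> = map_pmf (\<lambda>(A, B). A * B) (pair_pmf ?K ?L)"
      unfolding pair_map_pmf1 pair_map_pmf2 map_pmf_comp
      by (subst pair_commute_pmf, unfold map_pmf_comp, rule arg_cong[where f = "\<lambda>f. map_pmf f _"])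
         (auto simp: fun_eq_iff apfst_def apsnd_def map_prod_def split: prod.splits)
    finally show ?thesis by simp
  qed
  ultimately show ?case by simp
qed

lemma recursive_sketch_pow2_fourth_moment:
  assumes P: "is_recursive_sketch_pow2 J Is P" and J: "J > 0"
  shows "moment_sketch ((1 + 9 / real J) ^ (2 * length Is)) J (prod_list Is) P"
proof -
  let ?g = "1 + 9 / real J"
  obtain q PC PT where len: "length Is = 2 ^ q"
    and C: "\<And>k. k < 2 ^ q \<Longrightarrow> is_count_sketch J (Is ! k) (PC k)"
    and T: "\<And>m k. m \<in> {1..q} \<Longrightarrow> k < 2 ^ (q - m) \<Longrightarrow> is_tensor_sketch J J (PT (m, k))"
    and P: "P = map_pmf (\<lambda>(C, T). sketch_product q C T q)
              (pair_pmf (Pi_pmf {..<2 ^ q} (0\<^sub>m 0 0) PC)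
                        (Pi_pmf (SIGMA m:{1..q}. {..<2 ^ (q - m)}) (0\<^sub>m 0 0) PT))"
    using P unfolding is_recursive_sketch_pow2_def by blast
  have "moment_sketch (?g ^ (2 * 2 ^ q - 2 ^ (q - q))) (J ^ 2 ^ (q - q)) (prod_list Is) P"
    unfolding P
    by (rule sketch_product_fourth_moment)
       (use C T len J in \<open>auto intro: count_sketch_fourth_moment tensor_sketch_fourth_moment\<close>)
  then have F: "moment_sketch (?g ^ (2 * 2 ^ q - 1)) J (prod_list Is) P" by simp
  have "?g ^ (2 * 2 ^ q - 1) \<le> ?g ^ (2 * length Is)"
    unfolding len by (intro power_increasing) auto
  then have "?g ^ (2 * 2 ^ q - 1) * t\<^sup>2 \<le> ?g ^ (2 * length Is) * t\<^sup>2" for t :: real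
    by (rule mult_right_mono) simp
  then show ?thesis using F unfolding moment_sketch_def by (meson order_trans)
qed

section \<open>Padding to a power of two\<close>

lemma kron_vec_unit:
  assumes "j < d" "e > 0"
  shows "kron_vec (unit_vec d j) (unit_vec e 0) = unit_vec (d * e) (j * e)"
proof (rule eq_vecI)
  fix i assume "i < dim_vec (unit_vec (d * e) (j * e) :: real Matrix.vec)"
  then have i: "i < d * e" by simp
  then have "i div e < d" by (simp add: less_mult_imp_div_less)
  moreover have "(i div e = j \<and> i mod e = 0) \<longleftrightarrow> i = j * e"
    using assms(2) by auto
  ultimately show "vec_index (kron_vec (unit_vec d j) (unit_vec e 0)) i = vec_index (unit_vec (d * e) (j * e)) i"
    using i assms by (auto simp: kron_vec_def)
qed (simp add: kron_vec_def)

lemma kron_vec_unit_pow: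
  assumes "j < d" "e > 0"
  shows "((\<lambda>y. kron_vec y (unit_vec e 0)) ^^ k) (unit_vec d j) = unit_vec (d * e ^ k) (j * e ^ k)"
proof (induction k)
  case (Suc k)
  have "j * e ^ k < d * e ^ k" using assms by simp
  then show ?case using Suc assms(2) by (simp add: kron_vec_unit mult_ac)
qed simp

text \<open>Padding is an isometric embedding of x, so both moments carry over with the same
  g.\<close>

lemma pad_sketch_fourth_moment:
  assumes P: "moment_sketch g J (d * e ^ k) P" and e: "e > 0"
  shows "moment_sketch g J d (map_pmf (pad_sketch d k e) P)"
proof -
  let ?E = "e ^ k"
  \<comment> \<open>The Kronecker product of x with k copies of e_1: its entries sit at the
    multiples of e^k.\<close>
  define up where "up = (\<lambda>(x :: nat \<Rightarrow> real) p. if p mod ?E = 0 then x (p div ?E) else 0)"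
  have E: "?E > 0" using e by simp
  have up_sum: "(\<Sum>p<d * ?E. f p * up x p) = (\<Sum>j<d. f (j * ?E) * x j)" for f :: "nat \<Rightarrow> real" and x
  proof -
    have "(\<Sum>i<?E. f (j * ?E + i) * up x (j * ?E + i)) = f (j * ?E) * x j" for j
    proof -
      have "(\<Sum>i<?E. f (j * ?E + i) * up x (j * ?E + i)) = (\<Sum>i<?E. if i = 0 then f (j * ?E) * x j else 0)"
        by (intro sum.cong) (auto simp: up_def)
      then show ?thesis using E by simp
    qed
    then show ?thesis by (simp add: sum_lessThan_mult)
  qed
  have ipup: "ip (d * ?E) (up x) (up x) = ip d x x" for x
    unfolding ip_def up_sum by (intro sum.cong refl) (use E in \<open>simp add: up_def\<close>)
  have sq: "sq_app (pad_sketch d k e M) x = sq_app M (up x)" if M: "M \<in> carrier_mat J (d * ?E)" for M x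
  proof -
    have entry: "pad_sketch d k e M $$ (i, j) = M $$ (i, j * ?E)" if "i < J" "j < d" for i j
    proof -
      have "j * ?E < d * ?E" using that E by simp
      then show ?thesis using that M e by (simp add: pad_sketch_def mat_of_cols_def kron_vec_unit_pow)
    qed
    have "app (pad_sketch d k e M) x i = app M (up x) i" if "i < J" for i
    proof -
      have "app (pad_sketch d k e M) x i = (\<Sum>j<d. pad_sketch d k e M $$ (i, j) * x j)"
        by (simp add: app_def pad_sketch_def)
      also have "\<dots> = (\<Sum>j<d. M $$ (i, j * ?E) * x j)" using entry that by simp
      also have "\<dots> = app M (up x) i" using M by (simp add: app_def up_sum)
      finally show ?thesis .
    qed
    moreover have "dim_row (pad_sketch d k e M) = J" using M by (simp add: pad_sketch_def)
    ultimately show ?thesis using M by (simp add: sq_app_def ip_def)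
  qed
  have fin: "finite (set_pmf P)" by (rule moment_sketchD(1)[OF P])
  have "fexp (map_pmf (pad_sketch d k e) P) (\<lambda>M. f (sq_app M x)) = fexp P (\<lambda>M. f (sq_app M (up x)))" for f x
    unfolding fexp_map[OF fin] by (intro fexp_cong) (simp add: sq moment_sketchD(2)[OF P])
  note this[of "\<lambda>t. t"] this[of "\<lambda>t. t\<^sup>2"]
  moreover have "pad_sketch d k e M \<in> carrier_mat J d" if "M \<in> set_pmf P" for M
    using moment_sketchD(2)[OF P that] by (auto simp: pad_sketch_def)
  ultimately show ?thesis
    using fin moment_sketchD(3)[OF P] moment_sketchD(4)[OF P] ipup
    unfolding moment_sketch_def by (auto simp: image_subset_iff) (metis ipup)
qed

lemma pow2_padding_less:
  assumes "M > 0"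
  shows "2 ^ nat \<lceil>log 2 (real M)\<rceil> < 2 * M" and "M \<le> 2 ^ nat \<lceil>log 2 (real M)\<rceil>"
proof -
  define q where "q = nat \<lceil>log 2 (real M)\<rceil>"
  have pow: "2 powr real q = real (2 ^ q)" by (simp add: powr_realpow)
  have l0: "log 2 (real M) \<ge> 0" using assms by simp
  have "real q < log 2 (real M) + 1" unfolding q_def using l0 by linarith
  then have "2 powr real q < 2 powr (log 2 (real M) + 1)" by simp
  also have "\<dots> = real (2 * M)" using assms by (simp add: powr_add)
  finally have "2 ^ q < 2 * M" unfolding pow by (simp only: of_nat_less_iff)
  then show "2 ^ nat \<lceil>log 2 (real M)\<rceil> < 2 * M" by (simp only: q_def)
  have "log 2 (real M) \<le> real q" unfolding q_def by linarith
  then have "2 powr log 2 (real M) \<le> 2 powr real q" by simp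
  moreover have "2 powr log 2 (real M) = real M" using assms by simp
  ultimately have "M \<le> 2 ^ q" unfolding pow by (simp only: of_nat_le_iff)
  then show "M \<le> 2 ^ nat \<lceil>log 2 (real M)\<rceil>" by (simp only: q_def)
qed

text \<open>A tree with 2^q leaves has exponent at most 2 * 2^q, and 2^q < 2 *
  \<open>length Is\<close> after padding; hence the factor 4.\<close>

lemma recursive_sketch_fourth_moment:
  assumes P: "is_recursive_sketch J Is P" and J: "J > 0" and Is: "\<And>I. I \<in> set Is \<Longrightarrow> I \<ge> 1" "Is \<noteq> []"
  shows "moment_sketch ((1 + 9 / real J) ^ (4 * length Is)) J (prod_list Is) P"
proof -
  let ?g = "1 + 9 / real J"
  have weaken: "moment_sketch (?g ^ (4 * length Is)) J (prod_list Is) P"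
    if F: "moment_sketch (?g ^ l) J (prod_list Is) P" and l: "l \<le> 4 * length Is" for l
  proof -
    have "?g ^ l * t\<^sup>2 \<le> ?g ^ (4 * length Is) * t\<^sup>2" for t :: real
      using l by (intro mult_right_mono power_increasing) auto
    then show ?thesis using F unfolding moment_sketch_def by (meson order_trans)
  qed
  show ?thesis
  proof (cases "\<exists>q. length Is = 2 ^ q")
    case True
    then have "is_recursive_sketch_pow2 J Is P" using P by (simp add: is_recursive_sketch_def)
    from recursive_sketch_pow2_fourth_moment[OF this J] show ?thesis by (rule weaken) simp
  next
    case False
    define q where "q = nat \<lceil>log 2 (length Is)\<rceil>"
    define k where "k = 2 ^ q - length Is"
    define e where "e = Max (set Is)"
    obtain P' where P': "is_recursive_sketch_pow2 J (Is @ replicate k e) P'"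
      and P: "P = map_pmf (pad_sketch (prod_list Is) k e) P'"
      using P False by (auto simp: is_recursive_sketch_def Let_def q_def k_def e_def)
    have "e \<in> set Is" unfolding e_def using Is(2) by (intro Max_in) auto
    then have e: "e > 0" using Is(1)[of e] by simp
    have len: "length Is + k = 2 ^ q" "2 ^ q < 2 * length Is"
      using pow2_padding_less[of "length Is"] Is(2) by (auto simp: k_def q_def)
    have "moment_sketch (?g ^ (2 * 2 ^ q)) J (prod_list Is * e ^ k) P'"
      using recursive_sketch_pow2_fourth_moment[OF P' J] len(1) by (simp add: prod_list_replicate)
    from pad_sketch_fourth_moment[OF this e] have "moment_sketch (?g ^ (2 * 2 ^ q)) J (prod_list Is) P"
      by (simp add: P)
    then show ?thesis by (rule weaken) (use len in simp)
  qed
qed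

section \<open>Subspace embedding\<close>

lemma ip_sum_left: "ip D (\<lambda>i. \<Sum>k\<in>K. c k * u k i) x = (\<Sum>k\<in>K. c k * ip D (u k) x)"
proof -
  have "ip D (\<lambda>i. \<Sum>k\<in>K. c k * u k i) x = (\<Sum>i<D. \<Sum>k\<in>K. c k * (u k i * x i))"
    by (simp add: ip_def sum_distrib_right mult.assoc)
  also have "\<dots> = (\<Sum>k\<in>K. \<Sum>i<D. c k * (u k i * x i))" by (rule sum.swap)
  finally show ?thesis by (simp add: ip_def sum_distrib_left)
qed

lemma ip_sum_right: "ip D x (\<lambda>i. \<Sum>k\<in>K. c k * u k i) = (\<Sum>k\<in>K. c k * ip D x (u k))"
  unfolding ip_commute[of D x] by (rule ip_sum_left)

lemma ip_cong: "(\<And>i. i < D \<Longrightarrow> x i = x' i) \<Longrightarrow> (\<And>i. i < D \<Longrightarrow> y i = y' i) \<Longrightarrow> ip D x y = ip D x' y'"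
  by (simp add: ip_def)

lemma ip_self_eq_0: "ip D x x = 0 \<Longrightarrow> i < D \<Longrightarrow> x i = 0"
  by (simp add: ip_def sum_nonneg_eq_0_iff)

text \<open>Gram--Schmidt, in which dependent vectors produce zero vectors.\<close>
lemma orthogonal_family_exists:
  fixes a :: "nat \<Rightarrow> nat \<Rightarrow> real"
  shows "\<exists>u. (\<forall>k<R. ip D (u k) (u k) = 0 \<or> ip D (u k) (u k) = 1) \<and>
     (\<forall>k<R. \<forall>l<R. k \<noteq> l \<longrightarrow> ip D (u k) (u l) = 0) \<and>
     (\<forall>j<R. \<forall>i<D. a j i = (\<Sum>k<R. ip D (u k) (a j) * u k i))"
proof (induction R)
  case (Suc R)
  then obtain u where u: "(\<forall>k<R. ip D (u k) (u k) = 0 \<or> ip D (u k) (u k) = 1) \<and>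
     (\<forall>k<R. \<forall>l<R. k \<noteq> l \<longrightarrow> ip D (u k) (u l) = 0) \<and>
     (\<forall>j<R. \<forall>i<D. a j i = (\<Sum>k<R. ip D (u k) (a j) * u k i))" ..
  note n = u[THEN conjunct1] and o = u[THEN conjunct2, THEN conjunct1] and e = u[THEN conjunct2, THEN conjunct2]
  define p where "p = (\<lambda>i. \<Sum>k<R. ip D (u k) (a R) * u k i)"
  define z where "z = (\<lambda>i. a R i - 1 * p i)"
  have zo: "ip D (u l) z = 0" if l: "l < R" for l
  proof -
    have "ip D (u l) p = (\<Sum>k<R. ip D (u k) (a R) * ip D (u l) (u k))" by (simp add: p_def ip_sum_right)
    also have "\<dots> = (\<Sum>k<R. if k = l then ip D (u l) (a R) * ip D (u l) (u l) else 0)"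
      using o l by (intro sum.cong) auto
    also have "\<dots> = ip D (u l) (a R) * ip D (u l) (u l)" using l by simp
    also have "\<dots> = ip D (u l) (a R)"
    proof (cases "ip D (u l) (u l) = 0")
      case True
      then have "ip D (u l) (a R) = 0" using ip_self_eq_0[OF True] by (simp add: ip_def)
      then show ?thesis by simp
    next
      case False
      then have "ip D (u l) (u l) = 1" using n l by blast
      then show ?thesis by simp
    qed
    finally show ?thesis unfolding z_def ip_diff_scale_right by simp
  qed
  have za: "ip D z (a R) = ip D z z"
  proof -
    have "ip D p z = 0" by (simp add: p_def ip_sum_left zo)
    moreover have "ip D z z = ip D z (a R) - 1 * ip D z p"
      by (subst (2) z_def) (rule ip_diff_scale_right)
    ultimately show ?thesis by (simp add: ip_commute[of D z p])
  qed
  define w where "w = (\<lambda>i. 1 / sqrt (ip D z z) * z i)"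
  have ipw: "ip D w x = 1 / sqrt (ip D z z) * ip D z x" for x
    by (simp add: w_def ip_def sum_divide_distrib)
  have ww: "ip D w w = 0 \<or> ip D w w = 1"
  proof -
    have "ip D w w = 1 / sqrt (ip D z z) * (1 / sqrt (ip D z z) * ip D z z)"
      unfolding ipw[of w] by (simp add: ip_commute[of D z w] ipw)
    then show ?thesis by (cases "ip D z z = 0") auto
  qed
  have wu: "ip D w (u l) = 0" if "l < R" for l
    using zo[OF that] by (simp add: ipw ip_commute[of D z "u l"])
  then have uw: "ip D (u l) w = 0" if "l < R" for l
    using that by (simp add: ip_commute[of D "u l" w])
  let ?u = "u(R := w)"
  have 1: "ip D (?u k) (?u k) = 0 \<or> ip D (?u k) (?u k) = 1" if "k < Suc R" for k
    using that n ww by (auto simp: less_Suc_eq)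
  have 2: "ip D (?u k) (?u l) = 0" if "k < Suc R" "l < Suc R" "k \<noteq> l" for k l
    using that o wu uw by (auto simp: less_Suc_eq)
  have 3: "a j i = (\<Sum>k<Suc R. ip D (?u k) (a j) * ?u k i)" if "j < Suc R" "i < D" for j i
  proof (cases "j = R")
    case True
    have "ip D w (a R) * w i = z i"
    proof (cases "ip D z z = 0")
      case True
      then show ?thesis using ip_self_eq_0[OF True \<open>i < D\<close>] by (simp add: w_def)
    next
      case False
      then have "sqrt (ip D z z) * sqrt (ip D z z) = ip D z z" "sqrt (ip D z z) \<noteq> 0" by auto
      then have "1 / sqrt (ip D z z) * ip D z z * (1 / sqrt (ip D z z)) = 1" by (simp add: field_simps)
      moreover have "ip D w (a R) * w i = 1 / sqrt (ip D z z) * ip D z z * (1 / sqrt (ip D z z)) * z i"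
        unfolding ipw[of "a R"] za by (simp only: w_def mult.assoc)
      ultimately show ?thesis by simp
    qed
    then show ?thesis using True by (simp add: z_def p_def)
  next
    case False
    then have j: "j < R" using that by simp
    have "ip D w (a j) = ip D w (\<lambda>i. \<Sum>k<R. ip D (u k) (a j) * u k i)"
      using e j by (intro ip_cong refl) blast
    also have "\<dots> = 0" by (simp add: ip_sum_right wu)
    finally have "ip D w (a j) = 0" .
    moreover have "a j i = (\<Sum>k<R. ip D (u k) (a j) * u k i)" using e j \<open>i < D\<close> by blast
    ultimately show ?thesis by simp
  qed
  show ?case by (intro exI[of _ ?u] conjI allI impI 1 2 3)
qed simp

section \<open>Distortion of inner products and of subspaces\<close>

lemma sq_app_variance:
  assumes P: "moment_sketch g m n P"
  shows "fexp P (\<lambda>M. (sq_app M x - ip n x x)\<^sup>2) \<le> (g - 1) * (ip n x x)\<^sup>2"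
proof -
  have "fexp P (\<lambda>M. (sq_app M x - ip n x x)\<^sup>2) =
     fexp P (\<lambda>M. (sq_app M x)\<^sup>2 - (2 * ip n x x) * sq_app M x + (ip n x x)\<^sup>2)"
    by (intro fexp_cong) (simp add: power2_eq_square algebra_simps)
  also have "\<dots> = fexp P (\<lambda>M. (sq_app M x)\<^sup>2) - (2 * ip n x x) * ip n x x + (ip n x x)\<^sup>2"
    unfolding fexp_add fexp_diff fexp_cmult fexp_const[OF moment_sketchD(1)[OF P]] moment_sketchD(3)[OF P] ..
  also have "\<dots> \<le> (g - 1) * (ip n x x)\<^sup>2"
    using moment_sketchD(4)[OF P, of x] by (simp add: algebra_simps power2_eq_square)
  finally show ?thesis .
qed

lemma app_lincomb: "app M (\<lambda>i. a * x i + b * y i) j = a * app M x j + b * app M y j"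
  by (simp add: app_def algebra_simps sum.distrib sum_distrib_left)

lemma app_sum: "app M (\<lambda>i. \<Sum>k\<in>K. c k * u k i) j = (\<Sum>k\<in>K. c k * app M (u k) j)"
proof -
  have "app M (\<lambda>i. \<Sum>k\<in>K. c k * u k i) j = (\<Sum>i<dim_col M. \<Sum>k\<in>K. c k * (M $$ (j, i) * u k i))"
    by (simp add: app_def sum_distrib_left mult_ac)
  also have "\<dots> = (\<Sum>k\<in>K. \<Sum>i<dim_col M. c k * (M $$ (j, i) * u k i))" by (rule sum.swap)
  finally show ?thesis by (simp add: app_def sum_distrib_left)
qed

text \<open>By polarization, from the variances at \<open>u + w\<close> and \<open>u - w\<close>.\<close>
lemma fexp_inner_product_error:
  assumes P: "moment_sketch g m n P" and g: "g \<ge> 1"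
    and u: "ip n u u \<le> 1" and w: "ip n w w \<le> 1"
  shows "fexp P (\<lambda>M. (ip m (app M u) (app M w) - ip n u w)\<^sup>2) \<le> 2 * (g - 1)"
proof -
  let ?p = "\<lambda>i. 1 * u i + 1 * w i" and ?q = "\<lambda>i. 1 * u i + (-1) * w i"
  let ?V = "\<lambda>x M. (sq_app M x - ip n x x)\<^sup>2"
  have pq: "ip n ?p ?p + ip n ?q ?q = 2 * ip n u u + 2 * ip n w w"
    unfolding ip_lincomb_left ip_lincomb_right by simp
  have polar: "ip k (\<lambda>i. 1 * x i + 1 * y i) (\<lambda>i. 1 * x i + 1 * y i) -
      ip k (\<lambda>i. 1 * x i + (-1) * y i) (\<lambda>i. 1 * x i + (-1) * y i) = 4 * ip k x y" for k x y
    unfolding ip_lincomb_left ip_lincomb_right by (simp add: ip_commute[of k y x])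
  have "fexp P (\<lambda>M. (ip m (app M u) (app M w) - ip n u w)\<^sup>2) \<le> fexp P (\<lambda>M. 1 / 8 * (?V ?p M + ?V ?q M))"
  proof (rule fexp_mono)
    fix M assume "M \<in> set_pmf P"
    then have M: "M \<in> carrier_mat m n" by (rule moment_sketchD(2)[OF P])
    have "sq_app M ?p = ip m (\<lambda>i. 1 * app M u i + 1 * app M w i) (\<lambda>i. 1 * app M u i + 1 * app M w i)"
      "sq_app M ?q = ip m (\<lambda>i. 1 * app M u i + (-1) * app M w i) (\<lambda>i. 1 * app M u i + (-1) * app M w i)"
      using M unfolding sq_app_def by (auto intro!: ip_cong simp only: app_lincomb carrier_matD)
    then have 1: "sq_app M ?p - sq_app M ?q = 4 * ip m (app M u) (app M w)" by (simp only: polar)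
    have "c - d = 1 / 4 * ((s - p) - (t - q))" if "s - t = 4 * c" "p - q = 4 * d" for c d s t p q :: real
      using that by simp
    from this[OF 1 polar] have "ip m (app M u) (app M w) - ip n u w =
        1 / 4 * ((sq_app M ?p - ip n ?p ?p) - (sq_app M ?q - ip n ?q ?q))" .
    moreover have "(1 / 4 * (s - t))\<^sup>2 \<le> 1 / 8 * (s\<^sup>2 + t\<^sup>2)" for s t :: real
      using zero_le_power2[of "s + t"] by (simp add: power2_eq_square algebra_simps)
    ultimately show "(ip m (app M u) (app M w) - ip n u w)\<^sup>2 \<le> 1 / 8 * (?V ?p M + ?V ?q M)"
      by (simp only:)
  qed
  also have "\<dots> = 1 / 8 * (fexp P (?V ?p) + fexp P (?V ?q))" by (simp only: fexp_cmult fexp_add)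
  also have "\<dots> \<le> 1 / 8 * ((g - 1) * (ip n ?p ?p)\<^sup>2 + (g - 1) * (ip n ?q ?q)\<^sup>2)"
    by (intro mult_left_mono add_mono sq_app_variance[OF P]) auto
  also have "\<dots> = (g - 1) / 8 * ((ip n ?p ?p)\<^sup>2 + (ip n ?q ?q)\<^sup>2)"
    by (simp only: distrib_left[symmetric])
  \<comment> \<open>By the parallelogram law the two squared lengths add up to at most 4, so their
    squares add up to at most 16.\<close>
  also have "\<dots> \<le> (g - 1) / 8 * 4\<^sup>2"
  proof (intro mult_left_mono)
    have "s\<^sup>2 + t\<^sup>2 \<le> (s + t)\<^sup>2" if "s \<ge> 0" "t \<ge> 0" for s t :: real
      using mult_nonneg_nonneg[OF that] by (simp add: power2_eq_square algebra_simps)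
    then have "(ip n ?p ?p)\<^sup>2 + (ip n ?q ?q)\<^sup>2 \<le> (ip n ?p ?p + ip n ?q ?q)\<^sup>2" by (simp only: ip_self_nonneg)
    also have "\<dots> \<le> 4\<^sup>2" unfolding pq using u w by (intro power_mono) auto
    finally show "(ip n ?p ?p)\<^sup>2 + (ip n ?q ?q)\<^sup>2 \<le> 4\<^sup>2" .
  qed (use g in auto)
  finally show ?thesis by simp
qed

text \<open>Here \<open>a j\<close> is the \<open>j\<close>-th column of the matrix whose column space is embedded.\<close>
lemma subspace_embedding:
  fixes a :: "nat \<Rightarrow> nat \<Rightarrow> real" and R :: nat
  assumes P: "moment_sketch g m D P" and g: "g \<ge> 1"
  defines "v \<equiv> \<lambda>x i. \<Sum>j<R. x j * a j i"
  shows "measure_pmf.prob P {M. \<not> (\<forall>x. \<bar>sq_app M (v x) - ip D (v x) (v x)\<bar> \<le> 1 / 2 * ip D (v x) (v x))}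
     \<le> 8 * (real R)\<^sup>2 * (g - 1)"
    (is "?p \<le> _")
proof -
  obtain u where n: "\<And>k. k < R \<Longrightarrow> ip D (u k) (u k) = 0 \<or> ip D (u k) (u k) = 1"
    and e: "\<And>j i. j < R \<Longrightarrow> i < D \<Longrightarrow> a j i = (\<Sum>k<R. ip D (u k) (a j) * u k i)"
    using orthogonal_family_exists[of R D a] by metis
  define E where "E = (\<lambda>M k l. ip m (app M (u k)) (app M (u l)) - ip D (u k) (u l))"
  \<comment> \<open>The squared Frobenius norm of the error of the sketched Gram matrix. Its mean is
    at most 2 R^2 (g - 1), and Markov's inequality at 1/4 = (1/2)^2 gives the factor 8.\<close>
  define F where "F = (\<lambda>M. \<Sum>k<R. \<Sum>l<R. (E M k l)\<^sup>2)"
  have fin: "finite (set_pmf P)" by (rule moment_sketchD(1)[OF P])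
  have good: "\<bar>sq_app M (v x) - ip D (v x) (v x)\<bar> \<le> 1 / 2 * ip D (v x) (v x)"
    if M: "M \<in> carrier_mat m D" and F: "F M \<le> 1 / 4" for M x
  proof -
    \<comment> \<open>The coordinates of \<open>v x\<close> in the orthogonal family; their squares
      sum to |v x|^2 even if some members of the family are zero.\<close>
    define y where "y = (\<lambda>k. \<Sum>j<R. x j * ip D (u k) (a j))"
    let ?s = "\<lambda>i. \<Sum>k<R. y k * u k i"
    have vs: "v x i = ?s i" if "i < D" for i
    proof -
      have "v x i = (\<Sum>j<R. \<Sum>k<R. x j * ip D (u k) (a j) * u k i)"
        unfolding v_def using e that by (intro sum.cong refl) (simp add: sum_distrib_left mult.assoc)
      also have "\<dots> = ?s i" unfolding y_def by (subst sum.swap) (simp add: sum_distrib_right)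
      finally show ?thesis .
    qed
    have uv: "ip D (u k) (v x) = y k" for k by (simp add: v_def ip_sum_right y_def)
    have norm: "ip D (v x) (v x) = (\<Sum>k<R. (y k)\<^sup>2)"
    proof -
      have "ip D (v x) (v x) = ip D ?s (v x)" using vs by (intro ip_cong) auto
      then show ?thesis by (simp add: ip_sum_left uv power2_eq_square)
    qed
    have 1: "ip D (v x) (v x) = (\<Sum>k<R. \<Sum>l<R. (y k * y l) * ip D (u k) (u l))"
    proof -
      have "ip D (v x) (v x) = ip D ?s ?s" using vs by (intro ip_cong) auto
      then show ?thesis by (simp add: ip_sum_left ip_sum_right sum_distrib_left mult.assoc)
    qed
    have 2: "sq_app M (v x) = (\<Sum>k<R. \<Sum>l<R. (y k * y l) * ip m (app M (u k)) (app M (u l)))"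
    proof -
      have "app M (v x) j = (\<Sum>k<R. y k * app M (u k) j)" for j
      proof -
        have "app M (v x) j = app M ?s j" using M vs by (simp add: app_def)
        then show ?thesis by (simp only: app_sum)
      qed
      then have "app M (v x) = (\<lambda>j. \<Sum>k<R. y k * app M (u k) j)" by auto
      then show ?thesis using M by (simp add: sq_app_def ip_sum_left ip_sum_right sum_distrib_left mult.assoc)
    qed
    have "(sq_app M (v x) - ip D (v x) (v x))\<^sup>2 = (\<Sum>k<R. \<Sum>l<R. (y k * y l) * E M k l)\<^sup>2"
      unfolding 1 2 E_def by (simp add: sum_subtractf right_diff_distrib)
    also have "\<dots> = (\<Sum>p\<in>{..<R} \<times> {..<R}. (y (fst p) * y (snd p)) * E M (fst p) (snd p))\<^sup>2"
      by (simp add: sum.cartesian_product')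
    also have "\<dots> \<le> (\<Sum>p\<in>{..<R} \<times> {..<R}. (y (fst p) * y (snd p))\<^sup>2) * (\<Sum>p\<in>{..<R} \<times> {..<R}. (E M (fst p) (snd p))\<^sup>2)"
      by (rule Cauchy_Schwarz_ineq_sum)
    also have "(\<Sum>p\<in>{..<R} \<times> {..<R}. (E M (fst p) (snd p))\<^sup>2) = F M"
      by (simp add: sum.cartesian_product' F_def)
    also have "(\<Sum>p\<in>{..<R} \<times> {..<R}. (y (fst p) * y (snd p))\<^sup>2) = (ip D (v x) (v x))\<^sup>2"
      unfolding norm power2_eq_square[of "sum _ _"] sum_product
      by (simp add: sum.cartesian_product' power_mult_distrib)
    also have "(ip D (v x) (v x))\<^sup>2 * F M \<le> (ip D (v x) (v x))\<^sup>2 * (1 / 4)"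
      using F by (intro mult_left_mono) auto
    also have "\<dots> = (1 / 2 * ip D (v x) (v x))\<^sup>2" by (simp add: power2_eq_square)
    finally show ?thesis using abs_le_square_iff by (metis abs_of_nonneg ip_self_nonneg mult_nonneg_nonneg
        zero_le_divide_1_iff zero_le_numeral)
  qed
  have "?p \<le> measure_pmf.prob P {M. F M > 1 / 4}"
    using good moment_sketchD(2)[OF P]
    by (intro measure_pmf.finite_measure_mono_AE) (auto simp: AE_measure_pmf_iff not_less, force)
  also have "\<dots> \<le> 8 * (real R)\<^sup>2 * (g - 1)"
  proof (rule fexp_Markov[OF fin])
    have "fexp P F = (\<Sum>k<R. \<Sum>l<R. fexp P (\<lambda>M. (E M k l)\<^sup>2))"
      unfolding F_def by (simp only: fexp_sum)
    also have "\<dots> \<le> (\<Sum>k<R. \<Sum>l<R. 2 * (g - 1))"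
      unfolding E_def using n by (intro sum_mono fexp_inner_product_error[OF P g]) (auto, (metis less_eq_real_def zero_le_one)+)
    also have "\<dots> = 8 * (real R)\<^sup>2 * (g - 1) * (1 / 4)" by (simp add: power2_eq_square)
    finally show "fexp P F \<le> 8 * (real R)\<^sup>2 * (g - 1) * (1 / 4)" .
  qed (use g in \<open>auto simp: F_def intro!: sum_nonneg\<close>)
  finally show ?thesis .
qed

lemma pow_one_plus_le:
  assumes "x \<ge> 0" "real n * x \<le> 1"
  shows "(1 + x) ^ n - 1 \<le> 2 * (real n * x)"
proof -
  let ?y = "real n * x"
  have "(1 + x) ^ n \<le> exp x ^ n" using assms by (intro power_mono) auto
  also have "\<dots> = exp ?y" by (simp add: exp_of_nat_mult)
  also have "\<dots> \<le> 1 + ?y + ?y\<^sup>2" using assms by (intro exp_bound) auto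
  also have "?y\<^sup>2 \<le> ?y" using assms by (simp add: power2_eq_square mult_left_le)
  finally show ?thesis by linarith
qed

text \<open>Here g - 1 \<le> 2 * 4 * 9 * \<open>length Is\<close> / J, and 8 * 72 = 576.\<close>

lemma recursive_sketch_subspace_embedding:
  fixes a :: "nat \<Rightarrow> nat \<Rightarrow> real" and R :: nat
  assumes P: "is_recursive_sketch J Is P" and Is: "\<And>I. I \<in> set Is \<Longrightarrow> I \<ge> 1" "Is \<noteq> []"
    and t: "0 < t" "t \<le> 1" and R: "R \<ge> 1"
    and J: "real J \<ge> 576 * real (length Is) * (real R)\<^sup>2 / t"
  defines "v \<equiv> \<lambda>x i. \<Sum>j<R. x j * a j i" and "D \<equiv> prod_list Is"
  shows "measure_pmf.prob P {M. \<not> (\<forall>x. \<bar>sq_app M (v x) - ip D (v x) (v x)\<bar> \<le> 1 / 2 * ip D (v x) (v x))} \<le> t"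
    (is "?p \<le> t")
proof -
  let ?L = "real (length Is)"
  let ?g = "(1 + 9 / real J) ^ (4 * length Is)"
  have L: "?L \<ge> 1" using Is(2) by (cases Is) auto
  have "(real R)\<^sup>2 \<ge> 1" using R by simp
  then have "t \<le> (real R)\<^sup>2" using t by linarith
  then have Rt: "(real R)\<^sup>2 / t \<ge> 1" using t by (simp add: le_divide_eq)
  have tJ: "576 * ?L * (real R)\<^sup>2 \<le> t * real J" using J t by (simp add: field_simps)
  have "576 * ?L * 1 \<le> 576 * ?L * ((real R)\<^sup>2 / t)" using Rt L by (intro mult_left_mono) auto
  then have JL: "real J \<ge> 576 * ?L" using J by simp
  then have J0: "real J > 0" using L by linarith
  have "real (4 * length Is) * (9 / real J) \<le> 1" using JL J0 by (simp add: field_simps)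
  then have "?g - 1 \<le> 2 * (real (4 * length Is) * (9 / real J))" by (intro pow_one_plus_le) auto
  also have "\<dots> = 72 * ?L / real J" by simp
  finally have "8 * (real R)\<^sup>2 * (?g - 1) \<le> 8 * (real R)\<^sup>2 * (72 * ?L / real J)" by (intro mult_left_mono) auto
  also have "\<dots> \<le> t" using tJ J0 by (simp add: field_simps)
  finally have le: "8 * (real R)\<^sup>2 * (?g - 1) \<le> t" .
  have "moment_sketch ?g J D P"
    unfolding D_def using P Is J0 by (intro recursive_sketch_fourth_moment) auto
  moreover have "?g \<ge> 1" by simp
  ultimately have "?p \<le> 8 * (real R)\<^sup>2 * (?g - 1)"
    unfolding v_def by (rule subspace_embedding)
  then show ?thesis using le by (rule order_trans)
qed

section \<open>Sampled least squares\<close>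

text \<open>Given the earlier samples, the cross term with the new one has mean zero.\<close>

lemma fexp_iid_sum_squared:
  assumes fin: "finite (set_pmf q)" and mean: "fexp q z = 0"
  shows "fexp (Pi_pmf {..<J} 0 (\<lambda>_. q)) (\<lambda>f. (\<Sum>j<J. z (f j))\<^sup>2) = real J * fexp q (\<lambda>i. (z i)\<^sup>2)"
proof (induction J)
  case 0
  then show ?case by (simp add: fexp_def)
next
  case (Suc J)
  let ?Q = "Pi_pmf {..<J} 0 (\<lambda>_. q)"
  have finQ: "finite (set_pmf ?Q)" using fin by (intro finite_set_Pi_pmf) auto
  have "fexp (Pi_pmf {..<Suc J} 0 (\<lambda>_. q)) (\<lambda>f. (\<Sum>j<Suc J. z (f j))\<^sup>2) =
      fexp ?Q (\<lambda>f. fexp q (\<lambda>y. (\<Sum>j<J. z (f j))\<^sup>2 + 2 * (\<Sum>j<J. z (f j)) * z y + (z y)\<^sup>2))"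
    using fin by (subst fexp_Pi_pmf_lessThan_Suc) (simp_all add: power2_sum add_ac mult_ac)
  also have "\<dots> = fexp ?Q (\<lambda>f. (\<Sum>j<J. z (f j))\<^sup>2 + fexp q (\<lambda>y. (z y)\<^sup>2))"
    by (simp only: fexp_add fexp_cmult fexp_const[OF fin] mean mult_zero_right add_0_right)
  also have "\<dots> = fexp ?Q (\<lambda>f. (\<Sum>j<J. z (f j))\<^sup>2) + fexp q (\<lambda>y. (z y)\<^sup>2)"
    by (simp only: fexp_add fexp_const[OF finQ])
  finally show ?case unfolding Suc.IH by (simp add: algebra_simps)
qed

text \<open>Provides a least squares optimum even for dependent columns. The residual is corrected
  along the part s of the new column orthogonal to the earlier ones; if s has length 0, the new
  equation already holds.\<close>

lemma normal_equations_solvable: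
  fixes a :: "nat \<Rightarrow> nat \<Rightarrow> real"
  shows "\<exists>y. \<forall>j<R. ip D (a j) (\<lambda>i. x i - (\<Sum>k<R. y k * a k i)) = 0"
proof (induction R arbitrary: x)
  case (Suc R)
  obtain y where y: "\<forall>j<R. ip D (a j) (\<lambda>i. x i - (\<Sum>k<R. y k * a k i)) = 0" using Suc.IH[of x] ..
  obtain y' where y': "\<forall>j<R. ip D (a j) (\<lambda>i. a R i - (\<Sum>k<R. y' k * a k i)) = 0" using Suc.IH[of "a R"] ..
  define p where "p = (\<lambda>i. x i - (\<Sum>k<R. y k * a k i))"
  define s where "s = (\<lambda>i. a R i - (\<Sum>k<R. y' k * a k i))"
  define t where "t = ip D s p / ip D s s"
  let ?y = "\<lambda>k. if k = R then t else y k - t * y' k"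
  have res: "(\<lambda>i. x i - (\<Sum>k<Suc R. ?y k * a k i)) = (\<lambda>i. p i - t * s i)"
    by (simp add: p_def s_def left_diff_distrib sum_subtractf sum_distrib_left algebra_simps)
  have lower: "ip D (a j) (\<lambda>i. p i - t * s i) = 0" if "j < R" for j
    unfolding ip_diff_scale_right using y y' that by (simp add: p_def s_def)
  have aR: "a R = (\<lambda>i. 1 * s i + 1 * (\<Sum>k<R. y' k * a k i))" by (simp add: s_def)
  have "ip D (a R) (\<lambda>i. p i - t * s i) = ip D s (\<lambda>i. p i - t * s i) +
      (\<Sum>k<R. y' k * ip D (a k) (\<lambda>i. p i - t * s i))"
    by (subst aR, unfold ip_lincomb_left ip_sum_left) simp
  also have "\<dots> = ip D s p - t * ip D s s" using lower by (simp add: ip_diff_scale_right)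
  also have "\<dots> = 0"
  proof (cases "ip D s s = 0")
    case True
    have "ip D s p = 0" using ip_self_eq_0[OF True] by (simp add: ip_def)
    then show ?thesis using True by simp
  next
    case False
    then show ?thesis by (simp add: t_def)
  qed
  finally have "ip D (a R) (\<lambda>i. p i - t * s i) = 0" .
  with lower have "\<forall>j<Suc R. ip D (a j) (\<lambda>i. p i - t * s i) = 0" by (auto simp: less_Suc_eq)
  then show ?case unfolding res[symmetric] by (rule exI[of _ ?y])
qed simp

text \<open>With weights 1/(J q(f j)) and the rows f j of a matrix, this is the squared Frobenius
  norm after sampling.\<close>

definition weighted_sq_norm :: "nat \<Rightarrow> nat \<Rightarrow> (nat \<Rightarrow> real) \<Rightarrow> (nat \<Rightarrow> nat \<Rightarrow> real) \<Rightarrow> real" where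
  "weighted_sq_norm m C \<omega> Z = (\<Sum>i<m. \<omega> i * (\<Sum>c<C. (Z i c)\<^sup>2))"

text \<open>Rows \<open>b j\<close> of a sketched matrix with weights \<open>\<omega> j\<close>; \<open>z\<close> is the error of the sketched solution
  and \<open>e\<close> the residual of the true one.\<close>
lemma sketched_error_bound:
  fixes b :: "nat \<Rightarrow> nat \<Rightarrow> real" and e z :: "nat \<Rightarrow> nat \<Rightarrow> real"
  assumes opt: "weighted_sq_norm J C \<omega> (\<lambda>j c. ip r (b j) (z c) + e j c) \<le> weighted_sq_norm J C \<omega> e"
    and low: "\<And>y. (\<Sum>j<J. \<omega> j * (ip r (b j) y)\<^sup>2) \<ge> \<gamma> * ip r y y" and \<gamma>: "\<gamma> > 0"
    and F: "(\<Sum>c<C. \<Sum>k<r. (\<Sum>j<J. \<omega> j * (b j k * e j c))\<^sup>2) \<le> F"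
  shows "(\<Sum>c<C. ip r (z c) (z c)) \<le> 4 * F / \<gamma>\<^sup>2"
proof -
  let ?Z = "\<Sum>c<C. ip r (z c) (z c)"
  let ?G = "\<lambda>c k. \<Sum>j<J. \<omega> j * (b j k * e j c)"
  have Z0: "?Z \<ge> 0" by (intro sum_nonneg) simp
  have cross: "(\<Sum>j<J. \<omega> j * (\<Sum>c<C. ip r (b j) (z c) * e j c)) = (\<Sum>c<C. \<Sum>k<r. z c k * ?G c k)"
  proof -
    have "(\<Sum>j<J. \<omega> j * (\<Sum>c<C. ip r (b j) (z c) * e j c)) =
        (\<Sum>j<J. \<Sum>c<C. \<Sum>k<r. z c k * (\<omega> j * (b j k * e j c)))"
      by (simp add: ip_def sum_distrib_left sum_distrib_right mult_ac)
    also have "\<dots> = (\<Sum>c<C. \<Sum>j<J. \<Sum>k<r. z c k * (\<omega> j * (b j k * e j c)))" by (rule sum.swap)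
    also have "\<dots> = (\<Sum>c<C. \<Sum>k<r. \<Sum>j<J. z c k * (\<omega> j * (b j k * e j c)))"
      by (rule sum.cong[OF refl], rule sum.swap)
    finally show ?thesis by (simp add: sum_distrib_left)
  qed
  have quad: "(\<Sum>j<J. \<omega> j * (\<Sum>c<C. (ip r (b j) (z c))\<^sup>2)) \<ge> \<gamma> * ?Z"
  proof -
    have "\<gamma> * ?Z \<le> (\<Sum>c<C. \<Sum>j<J. \<omega> j * (ip r (b j) (z c))\<^sup>2)"
      unfolding sum_distrib_left by (intro sum_mono low)
    also have "\<dots> = (\<Sum>j<J. \<omega> j * (\<Sum>c<C. (ip r (b j) (z c))\<^sup>2))"
      by (subst sum.swap) (simp add: sum_distrib_left)
    finally show ?thesis .
  qed
  have "weighted_sq_norm J C \<omega> (\<lambda>j c. ip r (b j) (z c) + e j c) =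
      (\<Sum>j<J. \<omega> j * (\<Sum>c<C. (ip r (b j) (z c))\<^sup>2)) + 2 * (\<Sum>j<J. \<omega> j * (\<Sum>c<C. ip r (b j) (z c) * e j c))
      + weighted_sq_norm J C \<omega> e"
    by (simp add: weighted_sq_norm_def power2_sum sum.distrib distrib_left sum_distrib_left mult_ac)
  \<comment> \<open>Optimality cancels the residual term of the expanded square; the quadratic part
    is paid for by the cross term alone, which Cauchy--Schwarz bounds.\<close>
  with opt quad cross have "\<gamma> * ?Z \<le> - (2 * (\<Sum>c<C. \<Sum>k<r. z c k * ?G c k))" by linarith
  then have "(\<gamma> * ?Z)\<^sup>2 \<le> (- (2 * (\<Sum>c<C. \<Sum>k<r. z c k * ?G c k)))\<^sup>2"
    using Z0 \<gamma> by (intro power_mono) auto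
  also have "\<dots> = 4 * (\<Sum>c<C. \<Sum>k<r. z c k * ?G c k)\<^sup>2" by (simp add: power_mult_distrib)
  also have "(\<Sum>c<C. \<Sum>k<r. z c k * ?G c k)\<^sup>2 \<le> ?Z * F"
  proof -
    have "(\<Sum>c<C. \<Sum>k<r. z c k * ?G c k)\<^sup>2 = (\<Sum>p\<in>{..<C} \<times> {..<r}. z (fst p) (snd p) * ?G (fst p) (snd p))\<^sup>2"
      by (simp add: sum.cartesian_product')
    also have "\<dots> \<le> (\<Sum>p\<in>{..<C} \<times> {..<r}. (z (fst p) (snd p))\<^sup>2) * (\<Sum>p\<in>{..<C} \<times> {..<r}. (?G (fst p) (snd p))\<^sup>2)"
      by (rule Cauchy_Schwarz_ineq_sum)
    also have "(\<Sum>p\<in>{..<C} \<times> {..<r}. (z (fst p) (snd p))\<^sup>2) = ?Z"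
      by (simp add: sum.cartesian_product' ip_def power2_eq_square)
    also have "(\<Sum>p\<in>{..<C} \<times> {..<r}. (?G (fst p) (snd p))\<^sup>2) = (\<Sum>c<C. \<Sum>k<r. (?G c k)\<^sup>2)"
      by (simp add: sum.cartesian_product')
    also have "?Z * (\<Sum>c<C. \<Sum>k<r. (?G c k)\<^sup>2) \<le> ?Z * F" using F Z0 by (intro mult_left_mono)
    finally show ?thesis .
  qed
  finally have "\<gamma>\<^sup>2 * ?Z * ?Z \<le> 4 * F * ?Z" by (simp add: power2_eq_square mult_ac)
  moreover have "F \<ge> 0" using F by (rule order_trans[rotated]) (intro sum_nonneg, simp)
  ultimately have "\<gamma>\<^sup>2 * ?Z \<le> 4 * F" using Z0 by (cases "?Z = 0") auto
  then show ?thesis using \<gamma> by (simp add: field_simps)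
qed

lemma residual_Pythagoras:
  fixes b e :: "nat \<Rightarrow> nat \<Rightarrow> real"
  assumes orth: "\<And>k c. k < r \<Longrightarrow> c < C \<Longrightarrow> (\<Sum>i<D. b i k * e i c) = 0"
  shows "(\<Sum>i<D. \<Sum>c<C. (ip r (b i) (z c) + e i c)\<^sup>2) =
    (\<Sum>i<D. \<Sum>c<C. (ip r (b i) (z c))\<^sup>2) + (\<Sum>i<D. \<Sum>c<C. (e i c)\<^sup>2)"
proof -
  have "(\<Sum>i<D. \<Sum>c<C. (ip r (b i) (z c) + e i c)\<^sup>2) =
     (\<Sum>i<D. \<Sum>c<C. (ip r (b i) (z c))\<^sup>2) + 2 * (\<Sum>i<D. \<Sum>c<C. ip r (b i) (z c) * e i c) + (\<Sum>i<D. \<Sum>c<C. (e i c)\<^sup>2)"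
    by (simp add: power2_sum sum.distrib sum_distrib_left mult.assoc)
  moreover have "(\<Sum>i<D. \<Sum>c<C. ip r (b i) (z c) * e i c) = 0"
  proof -
    have "(\<Sum>i<D. \<Sum>c<C. ip r (b i) (z c) * e i c) = (\<Sum>c<C. \<Sum>i<D. \<Sum>k<r. z c k * (b i k * e i c))"
      by (subst sum.swap) (simp add: ip_def sum_distrib_left sum_distrib_right mult_ac)
    also have "\<dots> = (\<Sum>c<C. \<Sum>k<r. z c k * (\<Sum>i<D. b i k * e i c))"
      unfolding sum_distrib_left by (rule sum.cong[OF refl], rule sum.swap)
    finally show ?thesis using orth by simp
  qed
  ultimately show ?thesis by simp
qed

text \<open>\<open>T\<close> bounds the failure probability of the spectral bound and that of the bound on
  \<open>b\<^sup>T S\<^sup>T S e\<close>.\<close>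
lemma sampled_least_squares:
  fixes b e :: "nat \<Rightarrow> nat \<Rightarrow> real"
  assumes q: "\<And>i. pmf q i = (if i < D then ip r (b i) (b i) / (\<Sum>l<D. ip r (b l) (b l)) else 0)"
    and nz: "(\<Sum>l<D. ip r (b l) (b l)) > 0"
    and lo: "\<And>y. 2 / 3 * ip r y y \<le> (\<Sum>i<D. (ip r (b i) y)\<^sup>2)"
    and hi: "\<And>y. (\<Sum>i<D. (ip r (b i) y)\<^sup>2) \<le> 2 * ip r y y"
    and orth: "\<And>k c. k < r \<Longrightarrow> c < C \<Longrightarrow> (\<Sum>i<D. b i k * e i c) = 0"
    and rR: "r \<le> R" and R: "R \<ge> 1" and T: "T > 0"
    and "odd p" and p: "2 * real R / 3 ^ p \<le> T" and J: "real J \<ge> 216 * real R * real p"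
  shows "measure_pmf.prob (Pi_pmf {..<J} 0 (\<lambda>_. q))
     {f. (\<forall>z. weighted_sq_norm J C (\<lambda>j. 1 / (real J * pmf q (f j))) (\<lambda>j c. ip r (b (f j)) (z c) + e (f j) c)
            \<le> weighted_sq_norm J C (\<lambda>j. 1 / (real J * pmf q (f j))) (\<lambda>j. e (f j)) \<longrightarrow>
         (\<Sum>i<D. \<Sum>c<C. (ip r (b i) (z c) + e i c)\<^sup>2) \<le>
           (1 + 46656 * real R / (real J * T)) * (\<Sum>i<D. \<Sum>c<C. (e i c)\<^sup>2))} \<ge> 1 - 2 * T"
proof -
  let ?Q = "Pi_pmf {..<J} 0 (\<lambda>_. q)"
  define S where "S = (\<Sum>l<D. ip r (b l) (b l))"
  define E2 where "E2 = (\<Sum>i<D. \<Sum>c<C. (e i c)\<^sup>2)"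
  \<comment> \<open>Rows rescaled by importance weights: a sampled w has second moment matrix b^T b
    and constant squared length S.\<close>
  define w where "w = (\<lambda>i k. 1 / sqrt (pmf q i) * b i k)"
  have S: "S > 0" using nz by (simp add: S_def)
  have E2: "E2 \<ge> 0" by (simp add: E2_def sum_nonneg)
  have qi: "pmf q i = (if i < D then ip r (b i) (b i) / S else 0)" for i using q by (simp add: S_def)
  have setq: "set_pmf q \<subseteq> {..<D}" by (auto simp: set_pmf_iff qi split: if_splits)
  have fin: "finite (set_pmf q)" using setq finite_subset by blast
  have finQ: "finite (set_pmf ?Q)" using fin by (intro finite_set_Pi_pmf) auto
  \<comment> \<open>Rows outside the support of q are zero, so sums over the support extend to all
    rows.\<close>
  have b0: "b i k = 0" if "i < D" "i \<notin> set_pmf q" "k < r" for i k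
  proof -
    have "ip r (b i) (b i) = 0" using that S by (simp add: set_pmf_iff qi)
    then show ?thesis using that ip_self_eq_0 by blast
  qed
  have supp: "(\<Sum>i\<in>set_pmf q. g i) = (\<Sum>i<D. g i)" if "\<And>i. i < D \<Longrightarrow> (\<And>k. k < r \<Longrightarrow> b i k = 0) \<Longrightarrow> g i = 0" for g :: "nat \<Rightarrow> real"
  proof (rule sum.mono_neutral_left)
    show "\<forall>i\<in>{..<D} - set_pmf q. g i = 0"
    proof
      fix i assume "i \<in> {..<D} - set_pmf q"
      then show "g i = 0" by (intro that b0) auto
    qed
  qed (use setq in auto)
  have SR: "S \<le> 2 * real R"
  proof -
    have bk: "ip r (b i) (bvec k) = b i k" if "k < r" for i k
      unfolding ip_commute[of r "b i" "bvec k"] by (rule ip_bvec_left[OF that])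
    have "S = (\<Sum>k<r. \<Sum>i<D. b i k * b i k)"
      unfolding S_def ip_def by (rule sum.swap)
    also have "\<dots> = (\<Sum>k<r. \<Sum>i<D. (ip r (b i) (bvec k))\<^sup>2)"
      by (intro sum.cong refl) (simp add: bk power2_eq_square)
    also have "\<dots> \<le> (\<Sum>k<r. 2 * ip r (bvec k) (bvec k))" by (intro sum_mono hi)
    also have "\<dots> = 2 * real r" by (simp add: ip_bvec_left) (simp add: bvec_def)
    finally show ?thesis using rR by simp
  qed
  have p0: "p > 0" using \<open>odd p\<close> by (cases p) auto
  have "216 * real R * 1 \<le> 216 * real R * real p" using p0 by (intro mult_left_mono) auto
  then have J0: "real J > 0" using J R by linarith
  have sw: "ip r (w i) y = 1 / sqrt (pmf q i) * ip r (b i) y" for i y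
    by (simp add: w_def ip_def sum_divide_distrib)
  have sw2: "(ip r (w i) y)\<^sup>2 = (ip r (b i) y)\<^sup>2 / pmf q i" for i y
    by (simp add: sw power_divide)
  let ?bad1 = "{f. \<not> (\<forall>x. (\<Sum>i<J. (ip r (w (f i)) x)\<^sup>2) \<ge> real J / 54 * ip r x x)}"
  have bad1: "measure_pmf.prob ?Q ?bad1 \<le> 2 * real r / 3 ^ p"
  \<comment> \<open>K bounds S, the squared Frobenius norm of b, which is at most 2r by
    \<open>hi\<close>.\<close>
  proof (rule sampled_gram_lower_tail[OF fin _ _ \<open>odd p\<close>, where K = "2 * real R"])
    fix i assume i: "i \<in> set_pmf q"
    then have "i < D" using setq by auto
    have "pmf q i > 0" using i by (simp add: pmf_positive)
    have "ip r (w i) (w i) = ip r (b i) (b i) / pmf q i"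
    proof -
      have "ip r (w i) (w i) = (1 / sqrt (pmf q i) * (1 / sqrt (pmf q i))) * ip r (b i) (b i)"
        unfolding sw[of i "w i"] ip_commute[of r "b i" "w i"] sw[of i "b i"] by simp
      then show ?thesis using \<open>pmf q i > 0\<close> by simp
    qed
    also have "\<dots> = S" using \<open>pmf q i > 0\<close> \<open>i < D\<close> S by (auto simp: qi)
    finally show "ip r (w i) (w i) \<le> 2 * real R" using SR by simp
  next
    fix y
    have "fexp q (\<lambda>i. (ip r (w i) y)\<^sup>2) = (\<Sum>i\<in>set_pmf q. (ip r (b i) y)\<^sup>2)"
      unfolding fexp_def sw2 by (intro sum.cong refl) (simp add: set_pmf_iff)
    also have "\<dots> = (\<Sum>i<D. (ip r (b i) y)\<^sup>2)" by (rule supp) (simp add: ip_def)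
    finally show "2 / 3 * ip r y y \<le> fexp q (\<lambda>i. (ip r (w i) y)\<^sup>2)" using lo by simp
  qed (use J R in auto)
  \<comment> \<open>J^2 times the squared Frobenius norm of b^T S^T S e, where S here is the
    sampling matrix.\<close>
  define G where "G = (\<lambda>f. \<Sum>c<C. \<Sum>k<r. (\<Sum>j<J. b (f j) k * e (f j) c / pmf q (f j))\<^sup>2)"
  have G: "fexp ?Q G \<le> real J * (2 * real R * E2)"
  proof -
    have "fexp ?Q G = (\<Sum>c<C. \<Sum>k<r. real J * fexp q (\<lambda>i. (b i k * e i c / pmf q i)\<^sup>2))"
      unfolding G_def fexp_sum
    proof (intro sum.cong refl fexp_iid_sum_squared[OF fin])
      fix c k assume ck: "c \<in> {..<C}" "k \<in> {..<r}"
      have "fexp q (\<lambda>i. b i k * e i c / pmf q i) = (\<Sum>i\<in>set_pmf q. b i k * e i c)"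
        unfolding fexp_def by (intro sum.cong refl) (simp add: set_pmf_iff)
      also have "\<dots> = (\<Sum>i<D. b i k * e i c)" using ck by (intro supp) simp
      finally show "fexp q (\<lambda>i. b i k * e i c / pmf q i) = 0" using orth ck by simp
    qed
    also have "\<dots> = real J * fexp q (\<lambda>i. \<Sum>c<C. \<Sum>k<r. (b i k * e i c / pmf q i)\<^sup>2)"
      by (simp only: fexp_sum sum_distrib_left)
    \<comment> \<open>Where row-norm sampling pays off: |b_i|^2 |e_i|^2 / q(i) equals S
      |e_i|^2.\<close>
    also have "fexp q (\<lambda>i. \<Sum>c<C. \<Sum>k<r. (b i k * e i c / pmf q i)\<^sup>2) \<le> (\<Sum>i\<in>set_pmf q. S * (\<Sum>c<C. (e i c)\<^sup>2))"
      unfolding fexp_def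
    proof (rule sum_mono)
      fix i assume i: "i \<in> set_pmf q"
      have qp: "pmf q i > 0" using i by (simp add: pmf_positive)
      have "i < D" using i setq by auto
      then have qS: "pmf q i * S = ip r (b i) (b i)" using S by (simp add: qi)
      have "(\<Sum>c<C. \<Sum>k<r. (b i k * e i c / pmf q i)\<^sup>2) = (\<Sum>c<C. (\<Sum>k<r. b i k * b i k) * ((e i c)\<^sup>2 / (pmf q i)\<^sup>2))"
        unfolding sum_distrib_right by (intro sum.cong refl) (simp add: power2_eq_square mult_ac)
      also have "\<dots> = (pmf q i * S) * ((\<Sum>c<C. (e i c)\<^sup>2) / (pmf q i)\<^sup>2)"
        unfolding qS by (simp add: ip_def sum_distrib_left sum_divide_distrib)
      finally have "pmf q i * (\<Sum>c<C. \<Sum>k<r. (b i k * e i c / pmf q i)\<^sup>2) = S * (\<Sum>c<C. (e i c)\<^sup>2)"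
        using qp by (simp add: power2_eq_square)
      then show "pmf q i * (\<Sum>c<C. \<Sum>k<r. (b i k * e i c / pmf q i)\<^sup>2) \<le> S * (\<Sum>c<C. (e i c)\<^sup>2)" by simp
    qed
    also have "\<dots> = S * (\<Sum>i\<in>set_pmf q. \<Sum>c<C. (e i c)\<^sup>2)" by (simp add: sum_distrib_left)
    also have "\<dots> \<le> 2 * real R * E2"
      unfolding E2_def using SR setq S by (intro mult_mono sum_mono2) (auto intro!: sum_nonneg)
    finally show ?thesis using J0 by simp
  qed
  define c0 where "c0 = real J * (2 * real R * E2) / T"
  have c0: "c0 \<ge> 0" using E2 T by (simp add: c0_def)
  have bad2: "measure_pmf.prob ?Q {f. G f > c0} \<le> T"
    using finQ T c0 G by (intro fexp_Markov) (auto simp: G_def c0_def intro!: sum_nonneg)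
  define optimal where "optimal = (\<lambda>f z.
      weighted_sq_norm J C (\<lambda>j. 1 / (real J * pmf q (f j))) (\<lambda>j c. ip r (b (f j)) (z c) + e (f j) c)
      \<le> weighted_sq_norm J C (\<lambda>j. 1 / (real J * pmf q (f j))) (\<lambda>j. e (f j)))"
  define accurate where "accurate = (\<lambda>z :: nat \<Rightarrow> nat \<Rightarrow> real.
      (\<Sum>i<D. \<Sum>c<C. (ip r (b i) (z c) + e i c)\<^sup>2) \<le> (1 + 46656 * real R / (real J * T)) * E2)"
  let ?good = "{f. (\<forall>z. optimal f z \<longrightarrow> accurate z)}"
  have incl: "- ?good \<subseteq> ?bad1 \<union> {f. G f > c0}"
  proof (rule ccontr)
    assume "\<not> ?thesis"
    then obtain f where nf: "f \<notin> ?good" and f1: "f \<notin> ?bad1" and f2: "\<not> G f > c0" by blast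
    let ?\<omega> = "\<lambda>j. 1 / (real J * pmf q (f j))"
    obtain z where opt: "optimal f z" and big: "\<not> accurate z" using nf by blast
    have "(\<Sum>c<C. ip r (z c) (z c)) \<le> 4 * (c0 / (real J)\<^sup>2) / (1 / 54)\<^sup>2"
    proof (rule sketched_error_bound[where b = "\<lambda>j. b (f j)" and e = "\<lambda>j. e (f j)"])
      fix y
      have eq: "(\<Sum>j<J. ?\<omega> j * (ip r (b (f j)) y)\<^sup>2) = 1 / real J * (\<Sum>j<J. (ip r (w (f j)) y)\<^sup>2)"
        unfolding sw2 sum_distrib_left by (intro sum.cong) auto
      have "1 / 54 * ip r y y = 1 / real J * (real J / 54 * ip r y y)" using J0 by simp
      also have "\<dots> \<le> 1 / real J * (\<Sum>j<J. (ip r (w (f j)) y)\<^sup>2)"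
        using f1 by (intro mult_left_mono) auto
      finally show "1 / 54 * ip r y y \<le> (\<Sum>j<J. ?\<omega> j * (ip r (b (f j)) y)\<^sup>2)"
        by (simp only: eq)
    next
      have eq: "(\<Sum>j<J. ?\<omega> j * (b (f j) k * e (f j) c)) = 1 / real J * (\<Sum>j<J. b (f j) k * e (f j) c / pmf q (f j))" for k c
        unfolding sum_distrib_left by (intro sum.cong) auto
      have "(\<Sum>c<C. \<Sum>k<r. (\<Sum>j<J. ?\<omega> j * (b (f j) k * e (f j) c))\<^sup>2) =
          (\<Sum>c<C. \<Sum>k<r. (1 / real J)\<^sup>2 * (\<Sum>j<J. b (f j) k * e (f j) c / pmf q (f j))\<^sup>2)"
        by (simp only: eq power_mult_distrib)
      also have "\<dots> = (1 / real J)\<^sup>2 * G f" by (simp only: G_def sum_distrib_left)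
      also have "\<dots> = G f / (real J)\<^sup>2" by (simp add: power_divide)
      finally show "(\<Sum>c<C. \<Sum>k<r. (\<Sum>j<J. ?\<omega> j * (b (f j) k * e (f j) c))\<^sup>2) \<le> c0 / (real J)\<^sup>2"
        using f2 by (simp add: divide_right_mono)
    qed (use opt in \<open>simp_all add: optimal_def\<close>)
    \<comment> \<open>4 * 54^2 * 2 = 23328; the bound \<open>hi\<close> on b^T b doubles it to
      46656.\<close>
    also have "\<dots> = 23328 * real R / (real J * T) * E2"
      using J0 T by (simp add: c0_def power2_eq_square field_simps)
    finally have Z: "(\<Sum>c<C. ip r (z c) (z c)) \<le> 23328 * real R / (real J * T) * E2" .
    have "(\<Sum>i<D. \<Sum>c<C. (ip r (b i) (z c) + e i c)\<^sup>2) = (\<Sum>i<D. \<Sum>c<C. (ip r (b i) (z c))\<^sup>2) + E2"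
      unfolding E2_def by (rule residual_Pythagoras[OF orth])
    also have "(\<Sum>i<D. \<Sum>c<C. (ip r (b i) (z c))\<^sup>2) \<le> (\<Sum>c<C. 2 * ip r (z c) (z c))"
      by (subst sum.swap) (intro sum_mono hi)
    also have "\<dots> \<le> 2 * (23328 * real R / (real J * T) * E2)"
      using Z by (simp flip: sum_distrib_left)
    finally have "(\<Sum>i<D. \<Sum>c<C. (ip r (b i) (z c) + e i c)\<^sup>2) \<le> (1 + 46656 * real R / (real J * T)) * E2"
      by (simp add: algebra_simps)
    with big show False by (simp add: accurate_def)
  qed
  have "measure_pmf.prob ?Q (- ?good) \<le> measure_pmf.prob ?Q (?bad1 \<union> {f. G f > c0})"
    by (rule measure_pmf.finite_measure_mono[OF incl]) simp
  also have "\<dots> \<le> measure_pmf.prob ?Q ?bad1 + measure_pmf.prob ?Q {f. G f > c0}"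
    by (rule measure_Un_le) simp_all
  also have "\<dots> \<le> T + T"
  proof (intro add_mono bad2)
    have "2 * real r / 3 ^ p \<le> 2 * real R / 3 ^ p" using rR by (intro divide_right_mono) auto
    then show "measure_pmf.prob ?Q ?bad1 \<le> T" using bad1 p by linarith
  qed
  finally have "measure_pmf.prob ?Q ?good \<ge> 1 - 2 * T"
    using measure_pmf.prob_compl[of ?good ?Q] by (simp add: Compl_eq_Diff_UNIV)
  then show ?thesis unfolding optimal_def accurate_def E2_def .
qed

text \<open>Bad outcomes of the first stage are charged in full, good ones with their conditional
  failure probability s.\<close>

lemma prob_bind_pmf_ge:
  assumes fin: "finite (set_pmf P)" and s: "s \<ge> 0"
    and K: "\<And>x. x \<in> set_pmf P \<Longrightarrow> x \<in> G \<Longrightarrow> measure_pmf.prob (K x) E \<ge> 1 - s"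
    and G: "measure_pmf.prob P (- G) \<le> t"
  shows "measure_pmf.prob (bind_pmf P K) E \<ge> 1 - t - s"
proof -
  have "ennreal (measure_pmf.prob (bind_pmf P K) E) = (\<integral>\<^sup>+x. ennreal (measure_pmf.prob (K x) E) \<partial>measure_pmf P)"
    by (simp flip: measure_pmf.emeasure_eq_measure)
  also have "\<dots> = ennreal (measure_pmf.expectation P (\<lambda>x. measure_pmf.prob (K x) E))"
    using fin by (intro nn_integral_eq_integral integrable_measure_pmf_finite) auto
  finally have "measure_pmf.prob (bind_pmf P K) E = fexp P (\<lambda>x. measure_pmf.prob (K x) E)"
    using fin by (simp add: fexp_eq_expectation)
  also have "\<dots> \<ge> fexp P (\<lambda>x. (1 - s) - indicator (- G) x)"
  proof (rule fexp_mono)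
    fix x assume x: "x \<in> set_pmf P"
    show "(1 - s) - indicator (- G) x \<le> measure_pmf.prob (K x) E"
    proof (cases "x \<in> G")
      case True
      then show ?thesis using K[OF x] by simp
    next
      case False
      then have "indicator (- G) x = (1 :: real)" by simp
      moreover have "0 \<le> measure_pmf.prob (K x) E" by simp
      ultimately show ?thesis using s by linarith
    qed
  qed
  also have "fexp P (\<lambda>x. (1 - s) - indicator (- G) x) = 1 - s - measure_pmf.prob P (- G)"
    unfolding fexp_diff fexp_const[OF fin] by (simp add: fexp_eq_expectation[OF fin])
  finally show ?thesis using G by linarith
qed

section \<open>Matrices as operators and the whitened factor\<close>

lemma app_eq_sum: "M \<in> carrier_mat m n \<Longrightarrow> app M x i = (\<Sum>j<n. M $$ (i, j) * x j)"
  by (simp add: app_def)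

lemma app_cong: "M \<in> carrier_mat m n \<Longrightarrow> (\<And>j. j < n \<Longrightarrow> x j = y j) \<Longrightarrow> app M x i = app M y i"
  by (simp add: app_def)

lemma index_mult_mat_sum:
  "A \<in> carrier_mat m k \<Longrightarrow> B \<in> carrier_mat k n \<Longrightarrow> i < m \<Longrightarrow> j < n \<Longrightarrow>
    (A * B) $$ (i, j) = (\<Sum>l<k. A $$ (i, l) * B $$ (l, j))"
  by (simp add: scalar_prod_def lessThan_atLeast0)

lemma sq_app_isometry:
  assumes U: "U \<in> carrier_mat m r" and UU: "transpose_mat U * U = 1\<^sub>m r"
  shows "sq_app U y = ip r y y"
proof -
  have col: "(\<Sum>i<m. U $$ (i, k) * U $$ (i, l)) = (if k = l then 1 else 0)" if "k < r" "l < r" for k l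
  proof -
    have "(transpose_mat U * U) $$ (k, l) = (\<Sum>i<m. U $$ (i, k) * U $$ (i, l))"
      using U that by (simp add: scalar_prod_def lessThan_atLeast0)
    then show ?thesis using UU that by simp
  qed
  have "sq_app U y = (\<Sum>i<m. \<Sum>k<r. \<Sum>l<r. (y k * y l) * (U $$ (i, k) * U $$ (i, l)))"
    using U by (simp add: sq_app_def ip_def app_def sum_product mult_ac)
  also have "\<dots> = (\<Sum>k<r. \<Sum>i<m. \<Sum>l<r. (y k * y l) * (U $$ (i, k) * U $$ (i, l)))" by (rule sum.swap)
  also have "\<dots> = (\<Sum>k<r. \<Sum>l<r. \<Sum>i<m. (y k * y l) * (U $$ (i, k) * U $$ (i, l)))"
    by (rule sum.cong[OF refl], rule sum.swap)
  also have "\<dots> = (\<Sum>k<r. \<Sum>l<r. if k = l then y k * y l else 0)"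
    by (intro sum.cong refl) (simp add: col flip: sum_distrib_left)
  finally show ?thesis by (simp add: ip_def)
qed

text \<open>The scores are defined through \<open>the (mat_inverse Sg)\<close>; an explicit inverse
  shows that the option is not \<open>None\<close>.\<close>

lemma mat_inverse_diagonal:
  fixes Sg :: "real mat"
  assumes Sg: "Sg \<in> carrier_mat r r" "diagonal_mat Sg" and pos: "\<And>i. i < r \<Longrightarrow> Sg $$ (i, i) > 0"
  shows "the (mat_inverse Sg) \<in> carrier_mat r r" "Sg * the (mat_inverse Sg) = 1\<^sub>m r"
proof -
  let ?D = "mat r r (\<lambda>(i, j). if i = j then 1 / Sg $$ (i, i) else 0)"
  have off: "Sg $$ (i, j) = 0" if "i < r" "j < r" "i \<noteq> j" for i j
    using Sg that by (auto simp: diagonal_mat_def)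
  have D: "?D \<in> carrier_mat r r" by simp
  have "Sg * ?D = 1\<^sub>m r"
  proof (rule eq_matI)
    fix i j assume ij: "i < dim_row (1\<^sub>m r :: real mat)" "j < dim_col (1\<^sub>m r :: real mat)"
    then have "(Sg * ?D) $$ (i, j) = (\<Sum>l<r. Sg $$ (i, l) * ?D $$ (l, j))"
      using Sg by (intro index_mult_mat_sum[OF _ D]) auto
    also have "\<dots> = (\<Sum>l<r. if l = j then Sg $$ (i, j) * (1 / Sg $$ (j, j)) else 0)"
      using ij by (intro sum.cong) auto
    also have "\<dots> = 1\<^sub>m r $$ (i, j)" using ij off[of i j] pos[of j] by simp
    finally show "(Sg * ?D) $$ (i, j) = 1\<^sub>m r $$ (i, j)" .
  qed (use Sg in auto)
  moreover from this have "?D * Sg = 1\<^sub>m r" using Sg D by (intro mat_mult_left_right_inverse[of Sg r]) auto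
  ultimately have "Sg \<in> Units (ring_mat TYPE(real) r ())"
    unfolding Units_def ring_mat_def using Sg D by auto
  then obtain B where "mat_inverse Sg = Some B" using mat_inverse(1)[OF Sg(1), where b = "()"] by (cases "mat_inverse Sg") auto
  with mat_inverse(2)[OF Sg(1) this] show "the (mat_inverse Sg) \<in> carrier_mat r r" "Sg * the (mat_inverse Sg) = 1\<^sub>m r"
    by auto
qed

text \<open>\<open>B = A V Sg\<^sup>-\<^sup>1\<close> has the same range as \<open>A\<close> because \<open>\<Psi> B = U\<close> and \<open>\<Psi>\<close> is injective on that range.\<close>
lemma compact_svd_whitening:
  assumes Psi: "\<Psi> \<in> carrier_mat m D" and A: "A \<in> carrier_mat D R"
    and svd: "is_compact_svd (\<Psi> * A) U Sg V"
    and emb: "\<And>x. \<bar>sq_app \<Psi> (app A x) - ip D (app A x) (app A x)\<bar> \<le> 1 / 2 * ip D (app A x) (app A x)"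
  obtains r X W where "r \<le> R" "X \<in> carrier_mat R r" "W \<in> carrier_mat r R"
    "A * V * the (mat_inverse Sg) = A * X" "A = A * X * W"
    "\<And>y. 2 / 3 * ip r y y \<le> sq_app (A * X) y" "\<And>y. sq_app (A * X) y \<le> 2 * ip r y y"
proof -
  let ?M = "\<Psi> * A"
  define r where "r = vec_space.rank (dim_row ?M) ?M"
  have M: "?M \<in> carrier_mat m R" using Psi A by simp
  have U: "U \<in> carrier_mat m r" and Sg: "Sg \<in> carrier_mat r r" and V: "V \<in> carrier_mat R r"
    and UU: "transpose_mat U * U = 1\<^sub>m r" and VV: "transpose_mat V * V = 1\<^sub>m r"
    and diag: "diagonal_mat Sg" "\<And>i. i < r \<Longrightarrow> Sg $$ (i, i) > 0" and MU: "?M = U * Sg * transpose_mat V"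
    using svd Psi A unfolding is_compact_svd_def Let_def r_def[symmetric] by auto
  have rR: "r \<le> R" unfolding r_def using vec_space.rank_le_nc[OF M] Psi by simp
  let ?I = "the (mat_inverse Sg)"
  note I = mat_inverse_diagonal[OF Sg diag]
  \<comment> \<open>X = V Sg^(-1) and W = Sg V^T satisfy W X = I, and \<Psi> A X = U.\<close>
  define X where "X = V * ?I"
  define W where "W = Sg * transpose_mat V"
  have VT: "transpose_mat V \<in> carrier_mat r R" using V by simp
  have X: "X \<in> carrier_mat R r" using V I by (simp add: X_def)
  have W: "W \<in> carrier_mat r R" using Sg VT by (simp add: W_def)
  have AX: "A * X \<in> carrier_mat D r" using A X by simp
  have WX: "W * X = 1\<^sub>m r"
  proof -
    have "W * X = Sg * (transpose_mat V * (V * ?I))"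
      unfolding W_def X_def using Sg VT V I by (intro assoc_mult_mat) auto
    also have "transpose_mat V * (V * ?I) = transpose_mat V * V * ?I"
      using VT V I by (intro assoc_mult_mat[symmetric]) auto
    finally show ?thesis using VV I by simp
  qed
  have MW: "?M = U * W" unfolding MU W_def using U Sg VT by (intro assoc_mult_mat) auto
  have MX: "?M * X = U"
  proof -
    have "?M * X = U * (W * X)" unfolding MW using U W X by (intro assoc_mult_mat) auto
    then show ?thesis using WX U by simp
  qed
  have PsiAX: "\<Psi> * (A * X) = U"
    using MX assoc_mult_mat[OF Psi A X] by simp
  have emb': "1 / 2 * ip D (app A x) (app A x) \<le> sq_app \<Psi> (app A x)"
    "sq_app \<Psi> (app A x) \<le> 3 / 2 * ip D (app A x) (app A x)" for x
    using emb[of x] by linarith+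
  have sqAX: "sq_app (A * X) y = ip D (app A (app X y)) (app A (app X y))" for y
    unfolding sq_app_def carrier_matD(1)[OF AX] by (intro ip_cong app_mult[OF A X])
  have sqU: "sq_app \<Psi> (app A (app X y)) = ip r y y" for y
  proof -
    have "app \<Psi> (app A (app X y)) l = app U y l" if "l < m" for l
    proof -
      have "app \<Psi> (app A (app X y)) l = app \<Psi> (app (A * X) y) l"
        using app_mult[OF A X] by (intro app_cong[OF Psi]) simp
      also have "\<dots> = app U y l" using app_mult[OF Psi AX that] PsiAX by simp
      finally show ?thesis .
    qed
    then have "sq_app \<Psi> (app A (app X y)) = sq_app U y"
      unfolding sq_app_def carrier_matD(1)[OF Psi] carrier_matD(1)[OF U] by (intro ip_cong)
    then show ?thesis by (simp only: sq_app_isometry[OF U UU])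
  qed
  \<comment> \<open>|\<Psi> B y|^2 = |U y|^2 = |y|^2 lies between 1/2 and 3/2 times |B y|^2, whence
    2/3 and 2.\<close>
  have lower: "2 / 3 * ip r y y \<le> sq_app (A * X) y" and upper: "sq_app (A * X) y \<le> 2 * ip r y y" for y
    using emb'[of "app X y"] sqAX[of y] sqU[of y] by linarith+
  have "A = A * X * W"
  proof -
    \<comment> \<open>\<Psi> A annihilates the columns of I - X W, and by the embedding so does
      A.\<close>
    let ?Y = "1\<^sub>m R - X * W"
    have XW: "X * W \<in> carrier_mat R R" using X W by simp
    have Y: "?Y \<in> carrier_mat R R" by (rule minus_carrier_mat[OF XW])
    have MY: "?M * ?Y = 0\<^sub>m m R"
    proof -
      have "?M * ?Y = ?M * 1\<^sub>m R - ?M * (X * W)" using M XW by (intro mult_minus_distrib_mat) auto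
      also have "?M * (X * W) = ?M * X * W" using M X W by (intro assoc_mult_mat[symmetric]) auto
      also have "\<dots> = ?M" unfolding MX by (rule MW[symmetric])
      finally show ?thesis unfolding right_mult_one_mat[OF M] minus_r_inv_mat[OF M] .
    qed
    have AY: "A * ?Y \<in> carrier_mat D R" using A Y by simp
    have "A * ?Y = 0\<^sub>m D R"
    proof (rule eq_matI)
      fix i j assume "i < dim_row (0\<^sub>m D R :: real mat)" "j < dim_col (0\<^sub>m D R :: real mat)"
      then have i: "i < D" and j: "j < R" by auto
      let ?y = "\<lambda>k. ?Y $$ (k, j)"
      have Ay: "app A ?y l = (A * ?Y) $$ (l, j)" if "l < D" for l
        unfolding index_mult_mat_sum[OF A Y that j] by (rule app_eq_sum[OF A])
      have "app \<Psi> (app A ?y) l = 0" if l: "l < m" for l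
      proof -
        have "app \<Psi> (app A ?y) l = app (\<Psi> * A) ?y l" by (rule app_mult[OF Psi A l, symmetric])
        also have "\<dots> = (?M * ?Y) $$ (l, j)"
          unfolding index_mult_mat_sum[OF M Y l j] by (rule app_eq_sum[OF M])
        finally show ?thesis using MY l j by simp
      qed
      then have "sq_app \<Psi> (app A ?y) = 0" using Psi by (simp add: sq_app_def ip_def)
      then have "ip D (app A ?y) (app A ?y) = 0"
        using emb'(1)[of ?y] ip_self_nonneg[of D "app A ?y"] by linarith
      from ip_self_eq_0[OF this i] show "(A * ?Y) $$ (i, j) = 0\<^sub>m D R $$ (i, j)"
        using Ay[OF i] i j by simp
    qed (use AY in auto)
    moreover have "A * ?Y = A - A * (X * W)"
      using mult_minus_distrib_mat[OF A one_carrier_mat XW] A by simp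
    moreover have "A * (X * W) = A * X * W" using A X W by (intro assoc_mult_mat[symmetric]) auto
    ultimately have Z: "A - A * X * W = 0\<^sub>m D R" by simp
    show ?thesis
    proof (rule eq_matI)
      fix i j assume "i < dim_row (A * X * W)" "j < dim_col (A * X * W)"
      then have ij: "i < D" "j < R" using A W by auto
      have "(A - A * X * W) $$ (i, j) = 0" using Z ij by simp
      then show "A $$ (i, j) = (A * X * W) $$ (i, j)" using A W ij by simp
    qed (use A W in auto)
  qed
  moreover have "A * V * ?I = A * X"
    unfolding X_def using A V I by (intro assoc_mult_mat) auto
  ultimately show thesis using that[OF rR X W] lower upper by blast
qed

section \<open>The sampled least squares problem for matrices\<close>

lemma frob_norm_nonneg [simp]: "frob_norm A \<ge> 0"
  by (simp add: frob_norm_def sum_nonneg)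

lemma frob_norm_squared: "A \<in> carrier_mat m n \<Longrightarrow> (frob_norm A)\<^sup>2 = (\<Sum>i<m. \<Sum>j<n. (A $$ (i, j))\<^sup>2)"
  by (simp add: frob_norm_def sum_nonneg)

lemma sampling_mat_mult_frob_norm:
  assumes M: "M \<in> carrier_mat D C" and f: "\<And>j. j < J \<Longrightarrow> f j < D"
  shows "(frob_norm (sampling_mat J D q f * M))\<^sup>2 =
    weighted_sq_norm J C (\<lambda>j. 1 / (real J * pmf q (f j))) (\<lambda>j c. M $$ (f j, c))"
proof -
  have S: "sampling_mat J D q f \<in> carrier_mat J D" by (simp add: sampling_mat_def)
  have entry: "(sampling_mat J D q f * M) $$ (j, c) = 1 / sqrt (real J * pmf q (f j)) * M $$ (f j, c)"
    if "j < J" "c < C" for j c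
  proof -
    have "(sampling_mat J D q f * M) $$ (j, c) = (\<Sum>i<D. sampling_mat J D q f $$ (j, i) * M $$ (i, c))"
      using that by (intro index_mult_mat_sum[OF S M])
    also have "\<dots> = (\<Sum>i<D. if f j = i then 1 / sqrt (real J * pmf q (f j)) * M $$ (f j, c) else 0)"
      using that by (intro sum.cong) (auto simp: sampling_mat_def)
    finally show ?thesis using f[OF that(1)] by simp
  qed
  have "(frob_norm (sampling_mat J D q f * M))\<^sup>2 = (\<Sum>j<J. \<Sum>c<C. ((sampling_mat J D q f * M) $$ (j, c))\<^sup>2)"
    using S M by (intro frob_norm_squared) simp
  also have "\<dots> = (\<Sum>j<J. \<Sum>c<C. 1 / (real J * pmf q (f j)) * (M $$ (f j, c))\<^sup>2)"
    by (intro sum.cong refl) (simp add: entry power_mult_distrib power_divide)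
  finally show ?thesis by (simp only: weighted_sq_norm_def sum_distrib_left)
qed

text \<open>Quantifies over all minimizers, since the sketched problem may have several.\<close>

definition sketch_succeeds ::
  "real \<Rightarrow> nat \<Rightarrow> nat \<Rightarrow> real mat \<Rightarrow> real mat \<Rightarrow> real mat \<Rightarrow> bool" where
  "sketch_succeeds \<epsilon> C R A Xn S \<longleftrightarrow>
     (\<forall>At. is_arg_min (\<lambda>B. frob_norm (S * A * transpose_mat B - S * transpose_mat Xn))
               (\<lambda>B. B \<in> carrier_mat C R) At \<longrightarrow>
             frob_norm (A * transpose_mat At - transpose_mat Xn) \<le>
               (1 + \<epsilon>) * (INF B\<in>carrier_mat C R. frob_norm (A * transpose_mat B - transpose_mat Xn)))"

text \<open>For a fixed \<Psi> that embeds the column space, the problem is rewritten in the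
  coordinates of the whitened factor A Y, whose row norms are the sampling scores.\<close>

lemma leverage_sampling_least_squares:
  assumes Psi: "\<Psi> \<in> carrier_mat m D" and A: "A \<in> carrier_mat D R" and X: "Xn \<in> carrier_mat C D"
    and svd: "is_compact_svd (\<Psi> * A) U Sg V" and A0: "A \<noteq> 0\<^sub>m D R"
    and emb: "\<And>x. \<bar>sq_app \<Psi> (app A x) - ip D (app A x) (app A x)\<bar> \<le> 1 / 2 * ip D (app A x) (app A x)"
    and R: "R \<ge> 1" and T: "T > 0" and "odd p" and p: "2 * real R / 3 ^ p \<le> T"
    and J1: "real J \<ge> 216 * real R * real p" and \<epsilon>: "\<epsilon> > 0" and J2: "46656 * real R / (real J * T) \<le> \<epsilon>"
  shows "measure_pmf.prob (sampling_pmf J D (proportional_pmf D (approx_lev_score A Sg V) q0))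
     {S. sketch_succeeds \<epsilon> C R A Xn S} \<ge> 1 - 2 * T"
proof -
  let ?success = "{S. sketch_succeeds \<epsilon> C R A Xn S}"
  obtain r Y W where rR: "r \<le> R" and Y: "Y \<in> carrier_mat R r" and W: "W \<in> carrier_mat r R"
    and AV: "A * V * the (mat_inverse Sg) = A * Y" and AYW: "A = A * Y * W"
    and lo: "\<And>y. 2 / 3 * ip r y y \<le> sq_app (A * Y) y" and hi: "\<And>y. sq_app (A * Y) y \<le> 2 * ip r y y"
    by (rule compact_svd_whitening[OF Psi A svd emb], rule that)
  have AY: "A * Y \<in> carrier_mat D r" using A Y by simp
  define b where "b = (\<lambda>i k. (A * Y) $$ (i, k))"
  have sqb: "sq_app (A * Y) y = (\<Sum>i<D. (ip r (b i) y)\<^sup>2)" for y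
  proof -
    have "dim_row (A * Y) = D" "dim_col (A * Y) = r" using A Y by auto
    then show ?thesis by (simp only: sq_app_def app_def ip_def b_def power2_eq_square)
  qed
  let ?l = "approx_lev_score A Sg V"
  have l: "?l i = ip r (b i) (b i)" if "i < D" for i
  proof -
    have "dim_row (A * Y) = D" "dim_col (A * Y) = r" using A Y by auto
    then show ?thesis
      unfolding approx_lev_score_def AV using that by (simp add: scalar_prod_def ip_def b_def lessThan_atLeast0)
  qed
  \<comment> \<open>If all scores vanished, A Y and hence A = A Y W would be zero; so the fallback
    \<open>q0\<close> is never chosen.\<close>
  have nz: "\<not> (\<forall>i<D. ?l i = 0)"
  proof
    assume z: "\<forall>i<D. ?l i = 0"
    have "b i k = 0" if "i < D" "k < r" for i k
      using z l that ip_self_eq_0[of r "b i" k] by simp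
    then have "(A * Y * W) $$ (i, j) = 0" if "i < D" "j < R" for i j
      using that by (simp only: index_mult_mat_sum[OF AY W]) (simp add: b_def)
    then have "A $$ (i, j) = 0" if "i < D" "j < R" for i j
      using that unfolding AYW[symmetric] by blast
    then have "A = 0\<^sub>m D R" using A by (intro eq_matI) auto
    then show False using A0 by simp
  qed
  define q where "q = proportional_pmf D ?l q0"
  have q: "pmf q i = (if i < D then ip r (b i) (b i) / (\<Sum>l<D. ip r (b l) (b l)) else 0)" for i
  proof -
    have "pmf q i = (if i < D then ?l i / (\<Sum>k<D. ?l k) else 0)"
      unfolding q_def by (rule pmf_proportional_pmf[OF _ nz]) (simp add: l)
    then show ?thesis by (simp add: l)
  qed
  have pos: "(\<Sum>l<D. ip r (b l) (b l)) > 0"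
  proof -
    obtain i where i: "i < D" "ip r (b i) (b i) \<noteq> 0" using nz l by auto
    have "(\<Sum>l<D. ip r (b l) (b l)) \<noteq> 0" using i by (subst sum_nonneg_eq_0_iff) auto
    moreover have "(\<Sum>l<D. ip r (b l) (b l)) \<ge> 0" by (intro sum_nonneg) simp
    ultimately show ?thesis by linarith
  qed
  \<comment> \<open>One least squares problem for each row c of Xn.\<close>
  have "\<forall>c. \<exists>y. \<forall>j<R. ip D (\<lambda>i. A $$ (i, j)) (\<lambda>i. Xn $$ (c, i) - (\<Sum>k<R. y k * A $$ (i, k))) = 0"
    by (rule allI, rule normal_equations_solvable)
  from choice[OF this] obtain y where
    y: "\<forall>c. \<forall>j<R. ip D (\<lambda>i. A $$ (i, j)) (\<lambda>i. Xn $$ (c, i) - (\<Sum>k<R. y c k * A $$ (i, k))) = 0" ..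
  define e where "e = (\<lambda>i c. (\<Sum>k<R. A $$ (i, k) * y c k) - Xn $$ (c, i))"
  have Ae: "(\<Sum>i<D. A $$ (i, j) * e i c) = 0" if "j < R" for j c
  proof -
    have "(\<Sum>i<D. A $$ (i, j) * e i c) = - ip D (\<lambda>i. A $$ (i, j)) (\<lambda>i. Xn $$ (c, i) - (\<Sum>k<R. y c k * A $$ (i, k)))"
      unfolding ip_def e_def sum_negf[symmetric] by (intro sum.cong refl) (simp add: algebra_simps)
    then show ?thesis using y that by simp
  qed
  have orth: "(\<Sum>i<D. b i k * e i c) = 0" if "k < r" for k c
  proof -
    have "(\<Sum>i<D. b i k * e i c) = (\<Sum>i<D. \<Sum>j<R. Y $$ (j, k) * (A $$ (i, j) * e i c))"
    proof (intro sum.cong refl)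
      fix i assume "i \<in> {..<D}"
      then have "b i k = (\<Sum>j<R. A $$ (i, j) * Y $$ (j, k))"
        using that unfolding b_def by (intro index_mult_mat_sum[OF A Y]) auto
      then show "b i k * e i c = (\<Sum>j<R. Y $$ (j, k) * (A $$ (i, j) * e i c))"
        by (simp only: sum_distrib_right) (simp only: mult_ac)
    qed
    also have "\<dots> = (\<Sum>j<R. \<Sum>i<D. Y $$ (j, k) * (A $$ (i, j) * e i c))" by (rule sum.swap)
    also have "\<dots> = (\<Sum>j<R. Y $$ (j, k) * (\<Sum>i<D. A $$ (i, j) * e i c))" by (simp only: sum_distrib_left)
    finally show ?thesis using Ae by simp
  qed
  \<comment> \<open>W times the deviation of B from the optimum. As A = (A Y) W, applying A to the
    deviation is applying A Y to z.\<close>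
  define z where "z = (\<lambda>(B :: real mat) c k. \<Sum>j<R. W $$ (k, j) * (B $$ (c, j) - y c j))"
  have resid: "(A * transpose_mat B - transpose_mat Xn) $$ (i, c) = ip r (b i) (z B c) + e i c"
    if B: "B \<in> carrier_mat C R" and ic: "i < D" "c < C" for B i c
  proof -
    have "ip r (b i) (z B c) = (\<Sum>k<r. \<Sum>j<R. ((A * Y) $$ (i, k) * W $$ (k, j)) * (B $$ (c, j) - y c j))"
      by (simp add: ip_def z_def b_def sum_distrib_left mult.assoc)
    also have "\<dots> = (\<Sum>j<R. \<Sum>k<r. ((A * Y) $$ (i, k) * W $$ (k, j)) * (B $$ (c, j) - y c j))" by (rule sum.swap)
    also have "\<dots> = (\<Sum>j<R. A $$ (i, j) * (B $$ (c, j) - y c j))"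
    proof (intro sum.cong refl)
      fix j assume "j \<in> {..<R}"
      then have "(A * Y * W) $$ (i, j) = (\<Sum>k<r. (A * Y) $$ (i, k) * W $$ (k, j))"
        by (intro index_mult_mat_sum[OF AY W ic(1)]) simp
      then have "A $$ (i, j) = (\<Sum>k<r. (A * Y) $$ (i, k) * W $$ (k, j))" unfolding AYW[symmetric] .
      then show "(\<Sum>k<r. ((A * Y) $$ (i, k) * W $$ (k, j)) * (B $$ (c, j) - y c j)) = A $$ (i, j) * (B $$ (c, j) - y c j)"
        by (simp only: sum_distrib_right)
    qed
    finally have "ip r (b i) (z B c) + e i c = (\<Sum>j<R. A $$ (i, j) * B $$ (c, j)) - Xn $$ (c, i)"
      by (simp add: e_def right_diff_distrib sum_subtractf)
    moreover have "(A * transpose_mat B) $$ (i, c) = (\<Sum>j<R. A $$ (i, j) * B $$ (c, j))"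
      using B A ic by (simp add: scalar_prod_def lessThan_atLeast0)
    ultimately show ?thesis using A B X ic by (simp del: index_mult_mat)
  qed
  have carrier: "A * transpose_mat B - transpose_mat Xn \<in> carrier_mat D C" if "B \<in> carrier_mat C R" for B
    using that A X by auto
  define E2 where "E2 = (\<Sum>i<D. \<Sum>c<C. (e i c)\<^sup>2)"
  have E2: "E2 \<ge> 0" by (simp add: E2_def sum_nonneg)
  have Pythagoras: "(\<Sum>i<D. \<Sum>c<C. (ip r (b i) (z c) + e i c)\<^sup>2) = (\<Sum>i<D. \<Sum>c<C. (ip r (b i) (z c))\<^sup>2) + E2" for z
    unfolding E2_def by (rule residual_Pythagoras) (rule orth)
  have sqnorm: "(frob_norm (A * transpose_mat B - transpose_mat Xn))\<^sup>2 =
      (\<Sum>i<D. \<Sum>c<C. (ip r (b i) (z B c) + e i c)\<^sup>2)" if B: "B \<in> carrier_mat C R" for B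
    unfolding frob_norm_squared[OF carrier[OF B]] by (intro sum.cong refl) (simp only: resid[OF B] lessThan_iff)
  have inf: "sqrt E2 \<le> (INF B\<in>carrier_mat C R. frob_norm (A * transpose_mat B - transpose_mat Xn))"
  proof (rule cINF_greatest)
    show "carrier_mat C R \<noteq> ({} :: real mat set)" using zero_carrier_mat by blast
    fix B :: "real mat" assume B: "B \<in> carrier_mat C R"
    have "E2 \<le> (frob_norm (A * transpose_mat B - transpose_mat Xn))\<^sup>2"
      unfolding sqnorm[OF B] Pythagoras by (simp add: sum_nonneg)
    then show "sqrt E2 \<le> frob_norm (A * transpose_mat B - transpose_mat Xn)" by (intro real_le_lsqrt) auto
  qed
  \<comment> \<open>The true optimum, with z = 0, is the competitor against which a sketched
    minimizer is compared.\<close>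
  define Bs where "Bs = mat C R (\<lambda>(c, j). y c j)"
  have Bs: "Bs \<in> carrier_mat C R" by (simp add: Bs_def)
  have zBs: "ip r (b i) (z Bs c) = 0" if "c < C" for i c
    using that by (simp add: z_def Bs_def ip_def)
  let ?good = "{f. \<forall>z. weighted_sq_norm J C (\<lambda>j. 1 / (real J * pmf q (f j))) (\<lambda>j c. ip r (b (f j)) (z c) + e (f j) c)
            \<le> weighted_sq_norm J C (\<lambda>j. 1 / (real J * pmf q (f j))) (\<lambda>j. e (f j)) \<longrightarrow>
         (\<Sum>i<D. \<Sum>c<C. (ip r (b i) (z c) + e i c)\<^sup>2) \<le> (1 + 46656 * real R / (real J * T)) * E2}"
  let ?Q = "Pi_pmf {..<J} 0 (\<lambda>_. q)"
  have good: "measure_pmf.prob ?Q ?good \<ge> 1 - 2 * T"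
    unfolding E2_def
    by (rule sampled_least_squares[OF q pos lo[unfolded sqb] hi[unfolded sqb] orth rR R T \<open>odd p\<close> p J1])
  have succ: "sampling_mat J D q f \<in> ?success" if f: "f \<in> ?good" and supp: "f \<in> set_pmf ?Q" for f
    unfolding sketch_succeeds_def
  proof (intro CollectI allI impI)
    let ?S = "sampling_mat J D q f"
    let ?w = "\<lambda>j. 1 / (real J * pmf q (f j))"
    fix At assume min: "is_arg_min (\<lambda>B. frob_norm (?S * A * transpose_mat B - ?S * transpose_mat Xn)) (\<lambda>B. B \<in> carrier_mat C R) At"
    then have At: "At \<in> carrier_mat C R" by (simp add: is_arg_min_def)
    have fD: "f j < D" if "j < J" for j
    proof -
      have "f j \<in> set_pmf q" using supp that by (simp add: set_Pi_pmf PiE_dflt_def)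
      then have "pmf q (f j) \<noteq> 0" by (simp add: set_pmf_iff)
      then show ?thesis using q[of "f j"] by (simp split: if_splits)
    qed
    have S: "?S \<in> carrier_mat J D" by (simp add: sampling_mat_def)
    have sk: "(frob_norm (?S * A * transpose_mat B - ?S * transpose_mat Xn))\<^sup>2 =
        weighted_sq_norm J C ?w (\<lambda>j c. ip r (b (f j)) (z B c) + e (f j) c)" if B: "B \<in> carrier_mat C R" for B
    proof -
      have BT: "transpose_mat B \<in> carrier_mat R C" and XT: "transpose_mat Xn \<in> carrier_mat D C" using B X by auto
      have ABT: "A * transpose_mat B \<in> carrier_mat D C" by (rule mult_carrier_mat[OF A BT])
      have "?S * A * transpose_mat B - ?S * transpose_mat Xn = ?S * (A * transpose_mat B - transpose_mat Xn)"
        unfolding assoc_mult_mat[OF S A BT] by (rule mult_minus_distrib_mat[OF S ABT XT, symmetric])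
      then have "(frob_norm (?S * A * transpose_mat B - ?S * transpose_mat Xn))\<^sup>2 =
          weighted_sq_norm J C ?w (\<lambda>j c. (A * transpose_mat B - transpose_mat Xn) $$ (f j, c))"
        by (simp only: sampling_mat_mult_frob_norm[where J = J and f = f, OF carrier[OF B] fD])
      also have "\<dots> = weighted_sq_norm J C ?w (\<lambda>j c. ip r (b (f j)) (z B c) + e (f j) c)"
        unfolding weighted_sq_norm_def sum_distrib_left
        by (intro sum.cong refl) (simp only: resid[OF B] fD lessThan_iff)
      finally show ?thesis .
    qed
    have "\<not> frob_norm (?S * A * transpose_mat Bs - ?S * transpose_mat Xn) <
        frob_norm (?S * A * transpose_mat At - ?S * transpose_mat Xn)"
      using min Bs unfolding is_arg_min_def by blast
    then have "frob_norm (?S * A * transpose_mat At - ?S * transpose_mat Xn) \<le>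
        frob_norm (?S * A * transpose_mat Bs - ?S * transpose_mat Xn)" by (rule leI)
    then have "(frob_norm (?S * A * transpose_mat At - ?S * transpose_mat Xn))\<^sup>2 \<le>
        (frob_norm (?S * A * transpose_mat Bs - ?S * transpose_mat Xn))\<^sup>2"
      by (intro power_mono) auto
    moreover have "weighted_sq_norm J C ?w (\<lambda>j c. ip r (b (f j)) (z Bs c) + e (f j) c) = weighted_sq_norm J C ?w (\<lambda>j. e (f j))"
      unfolding weighted_sq_norm_def by (simp add: zBs)
    ultimately have "weighted_sq_norm J C ?w (\<lambda>j c. ip r (b (f j)) (z At c) + e (f j) c) \<le> weighted_sq_norm J C ?w (\<lambda>j. e (f j))"
      by (simp only: sk[OF At] sk[OF Bs])
    then have "(\<Sum>i<D. \<Sum>c<C. (ip r (b i) (z At c) + e i c)\<^sup>2) \<le> (1 + 46656 * real R / (real J * T)) * E2"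
      by (rule f[unfolded mem_Collect_eq, THEN spec, THEN mp])
    also have "\<dots> \<le> (1 + \<epsilon>)\<^sup>2 * E2"
    proof (intro mult_right_mono E2)
      \<comment> \<open>The sampling bound gives a factor 1 + \<epsilon> between squared norms,
        while the claim allows its square.\<close>
      have "1 + \<epsilon> \<le> (1 + \<epsilon>)\<^sup>2" using \<epsilon> by (simp add: power2_eq_square)
      then show "1 + 46656 * real R / (real J * T) \<le> (1 + \<epsilon>)\<^sup>2" using J2 by linarith
    qed
    finally have le: "(\<Sum>i<D. \<Sum>c<C. (ip r (b i) (z At c) + e i c)\<^sup>2) \<le> (1 + \<epsilon>)\<^sup>2 * E2" .
    have "((1 + \<epsilon>) * sqrt E2)\<^sup>2 = (1 + \<epsilon>)\<^sup>2 * E2" using E2 by (simp add: power_mult_distrib)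
    then have "(frob_norm (A * transpose_mat At - transpose_mat Xn))\<^sup>2 \<le> ((1 + \<epsilon>) * sqrt E2)\<^sup>2"
      using le by (simp only: sqnorm[OF At])
    then have "frob_norm (A * transpose_mat At - transpose_mat Xn) \<le> (1 + \<epsilon>) * sqrt E2"
      by (rule power2_le_imp_le) (use \<epsilon> E2 in simp)
    also have "\<dots> \<le> (1 + \<epsilon>) * (INF B\<in>carrier_mat C R. frob_norm (A * transpose_mat B - transpose_mat Xn))"
      by (rule mult_left_mono[OF inf]) (use \<epsilon> in simp)
    finally show "frob_norm (A * transpose_mat At - transpose_mat Xn) \<le>
        (1 + \<epsilon>) * (INF B\<in>carrier_mat C R. frob_norm (A * transpose_mat B - transpose_mat Xn))" .
  qed
  have "measure_pmf.prob ?Q ?good \<le> measure_pmf.prob ?Q (sampling_mat J D q -` ?success)"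
  proof (rule measure_pmf.finite_measure_mono_AE)
    show "AE f in measure_pmf ?Q. f \<in> ?good \<longrightarrow> f \<in> sampling_mat J D q -` ?success"
      unfolding AE_measure_pmf_iff using succ by (intro ballI impI) (rule vimageI2)
  qed simp
  also have "\<dots> = measure_pmf.prob (sampling_pmf J D q) ?success"
    by (simp only: sampling_pmf_def measure_map_pmf)
  finally show ?thesis using good unfolding q_def by linarith
qed

section \<open>Dimensions, the exponent and the choice of constants\<close>

lemma dim_row_khatri_rao_list: "dim_row (khatri_rao_list R Ms) = prod_list (map dim_row Ms)"
  by (induction Ms) (simp_all add: khatri_rao_def)

lemma dim_col_khatri_rao_list:
  assumes "\<forall>M\<in>set Ms. dim_col M = R"
  shows "dim_col (khatri_rao_list R Ms) = R"
  using assms by (cases Ms) (simp_all add: khatri_rao_def)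

lemma prod_list_rev: "prod_list (rev xs) = (prod_list xs :: nat)"
proof (induction xs)
  case (Cons x xs)
  then show ?case by (simp only: rev.simps prod_list.append prod_list.Cons prod_list.Nil mult_1_right mult_1_left mult.commute)
qed simp

lemma omit_map: "omit n (map f xs) = map f (omit n xs)"
  by (simp only: omit_def take_map drop_map map_append)

text \<open>Takes p = 2k + 1 with k the ceiling of ln t, and e \<le> 3.\<close>

lemma odd_exponent_exists:
  fixes t :: real
  assumes "t \<ge> 1"
  shows "\<exists>p. odd p \<and> t \<le> 3 ^ p \<and> real p \<le> 2 * ln t + 3"
proof -
  define k where "k = nat \<lceil>ln t\<rceil>"
  have "ln t \<ge> 0" using assms by simp
  then have k: "ln t \<le> real k" "real k \<le> ln t + 1" unfolding k_def by linarith+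
  have "t = exp (ln t)" using assms by simp
  also have "\<dots> \<le> exp (real (2 * k + 1))" using k by simp
  also have "\<dots> = exp 1 ^ (2 * k + 1)" using exp_of_nat_mult[of "2 * k + 1" "1 :: real"] by (simp only: mult_1_right)
  also have "\<dots> \<le> 3 ^ (2 * k + 1)" using exp_le by (intro power_mono) auto
  finally have "t \<le> 3 ^ (2 * k + 1)" .
  moreover have "real (2 * k + 1) \<le> 2 * ln t + 3" using k by simp
  ultimately show ?thesis by (intro exI[of _ "2 * k + 1"]) simp
qed

lemma sketched_leverage_score_least_squares:
  fixes N n R :: nat and Is :: "nat list" and X :: "nat list \<Rightarrow> real" and A :: "nat \<Rightarrow> real mat"
    and \<epsilon> \<delta> :: real and J1 J2 :: nat and P :: "real mat pmf"
    and U1 \<Sigma>1 V1 :: "real mat \<Rightarrow> real mat" and q0 :: "nat pmf"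
  assumes v_def: "v = rev (omit n [0..<N])" and D_def: "D = prod_list (omit n Is)"
    and Ane_def: "Ane = khatri_rao_list R (map A v)" and Xn_def: "Xn = mode_unfolding Is n X"
    and N: "N \<ge> 2" and n: "n < N" and R: "R \<ge> 1" and len: "length Is = N" and Is: "\<forall>I\<in>set Is. I \<ge> 1"
    and A: "\<forall>j<N. j \<noteq> n \<longrightarrow> A j \<in> carrier_mat (Is ! j) R" and nz: "Ane \<noteq> 0\<^sub>m D R"
    and \<epsilon>: "0 < \<epsilon>" "\<epsilon> < 1" and \<delta>: "0 < \<delta>" "\<delta> < 1"
    and P: "is_recursive_sketch J1 (map (\<lambda>j. Is ! j) v) P"
    and svd: "\<forall>\<Psi>\<in>set_pmf P. is_compact_svd (\<Psi> * Ane) (U1 \<Psi>) (\<Sigma>1 \<Psi>) (V1 \<Psi>)"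
    and J1: "real J1 \<ge> 1000000 * real N * (real R)\<^sup>2 / \<delta>"
    and J2: "real J2 \<ge> 1000000 * real R * max (ln (real R / \<delta>)) (1 / (\<epsilon> * \<delta>))"
  shows "measure_pmf.prob
          (bind_pmf P (\<lambda>\<Psi>. sampling_pmf J2 D (proportional_pmf D (approx_lev_score Ane (\<Sigma>1 \<Psi>) (V1 \<Psi>)) q0)))
          {S. sketch_succeeds \<epsilon> (Is ! n) R Ane Xn S}
        \<ge> 1 - \<delta>"
proof -
  \<comment> \<open>One third of the budget for the embedding, one for each of the two sampling
    events.\<close>
  define T where "T = \<delta> / 3"
  define L where "L = max (ln (real R / \<delta>)) (1 / (\<epsilon> * \<delta>))"
  let ?Is = "map (\<lambda>j. Is ! j) v"
  have T: "T > 0" "T \<le> 1" using \<delta> by (simp_all add: T_def)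
  have R1: "real R \<ge> 1" using R by simp
  have omit: "omit n [0..<N] = [0..<n] @ [Suc n..<N]" using n by (simp add: omit_def)
  have set_v: "set v \<subseteq> {j. j < N \<and> j \<noteq> n}" unfolding v_def set_rev omit using n by auto
  have len_v: "length v = N - 1" unfolding v_def length_rev omit using n by simp
  have nth: "map (\<lambda>j. Is ! j) [0..<N] = Is" unfolding len[symmetric] by (rule map_nth)
  have "?Is = rev (omit n (map (\<lambda>j. Is ! j) [0..<N]))" by (simp only: v_def rev_map omit_map)
  then have D: "prod_list ?Is = D" unfolding nth by (simp only: prod_list_rev D_def)
  have Av: "A j \<in> carrier_mat (Is ! j) R" if "j \<in> set v" for j
  proof -
    have "j < N" "j \<noteq> n" using that set_v by auto
    then show ?thesis using A by simp
  qed
  have Ane: "Ane \<in> carrier_mat D R"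
  proof -
    have rows: "map dim_row (map A v) = ?Is"
      unfolding map_map by (rule map_cong[OF refl]) (simp only: comp_def carrier_matD(1)[OF Av])
    have "dim_col M = R" if M: "M \<in> set (map A v)" for M
    proof -
      obtain j where "M = A j" "j \<in> set v" using M unfolding set_map by (rule imageE)
      then show ?thesis using carrier_matD(2)[OF Av] by simp
    qed
    then have "dim_col Ane = R" unfolding Ane_def by (intro dim_col_khatri_rao_list ballI)
    moreover have "dim_row Ane = D" unfolding Ane_def dim_row_khatri_rao_list rows by (rule D)
    ultimately show ?thesis by (intro carrier_matI)
  qed
  have Xn: "Xn \<in> carrier_mat (Is ! n) D" unfolding Xn_def mode_unfolding_def D_def by (rule mat_carrier)
  have Is1: "I \<ge> 1" if I: "I \<in> set ?Is" for I
  proof -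
    obtain j where "j < N" "I = Is ! j" using I set_v by auto
    then show ?thesis using Is len by simp
  qed
  have Is0: "?Is \<noteq> []" using len_v N by auto
  have "(real R)\<^sup>2 \<ge> 1" using R1 by simp
  then have "1 * 1 \<le> real N * (real R)\<^sup>2" using N by (intro mult_mono) auto
  then have "1000000 * real N * (real R)\<^sup>2 / \<delta> > 0" using \<delta> by simp
  then have "real J1 > 0" using J1 by linarith
  then have J1pos: "J1 > 0" by simp
  note sketch = recursive_sketch_fourth_moment[OF P J1pos Is1 Is0]
  have fin: "finite (set_pmf P)" by (rule moment_sketchD(1)[OF sketch])
  have Psi: "\<Psi> \<in> carrier_mat J1 D" if "\<Psi> \<in> set_pmf P" for \<Psi>
    using moment_sketchD(2)[OF sketch that] by (simp only: D)
  let ?v = "\<lambda>x i. \<Sum>j<R. x j * Ane $$ (i, j)"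
  define G where "G = {M. \<forall>x. \<bar>sq_app M (?v x) - ip D (?v x) (?v x)\<bar> \<le> 1 / 2 * ip D (?v x) (?v x)}"
  have vapp: "?v x = app Ane x" for x using Ane by (simp add: app_def mult.commute)
  have "measure_pmf.prob P {M. \<not> (\<forall>x. \<bar>sq_app M (?v x) - ip (prod_list ?Is) (?v x) (?v x)\<bar> \<le>
      1 / 2 * ip (prod_list ?Is) (?v x) (?v x))} \<le> T"
  proof (rule recursive_sketch_subspace_embedding[OF P Is1 Is0 T R])
    have "576 * real (length ?Is) * (real R)\<^sup>2 / T = 1728 * real (length ?Is) * (real R)\<^sup>2 / \<delta>"
      by (simp add: T_def)
    also have "\<dots> \<le> 1000000 * real N * (real R)\<^sup>2 / \<delta>"
      using \<delta> len_v by (intro divide_right_mono mult_right_mono mult_mono) auto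
    finally show "576 * real (length ?Is) * (real R)\<^sup>2 / T \<le> real J1" using J1 by linarith
  qed
  then have G: "measure_pmf.prob P (- G) \<le> T" by (simp only: D G_def Collect_neg_eq[symmetric])
  have ed: "\<epsilon> * \<delta> > 0" "\<epsilon> * \<delta> \<le> 1" using \<epsilon> \<delta> by (simp_all add: mult_le_one)
  then have "1 / (\<epsilon> * \<delta>) \<ge> 1" by simp
  then have L1: "L \<ge> 1" unfolding L_def by linarith
  have J2L: "real J2 \<ge> 1000000 * real R * L" using J2 by (simp only: L_def)
  \<comment> \<open>3^p \<ge> 6R/\<delta> is the condition 2R/3^p \<le> \<delta>/3.\<close>
  have "6 * real R / \<delta> \<ge> 1" using R1 \<delta> by (simp add: field_simps)
  from odd_exponent_exists[OF this] obtain p where "odd p" and p: "6 * real R / \<delta> \<le> 3 ^ p"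
    and pl: "real p \<le> 2 * ln (6 * real R / \<delta>) + 3" by blast
  have "ln (6 * real R / \<delta>) = ln 6 + ln (real R / \<delta>)"
    using R1 \<delta> ln_mult[of 6 "real R / \<delta>"] by simp
  also have "\<dots> \<le> 5 + L" using ln_le_minus_one[of "6 :: real"] by (simp add: L_def)
  \<comment> \<open>2 (5 + L) + 3 \<le> 15 L because L \<ge> 1, which follows from
    \<epsilon>\<delta> \<le> 1. The requirements 1728 on J1, and 216 * 15 and 3 * 46656 on J2, all
    stay below 1000000.\<close>
  finally have pL: "real p \<le> 15 * L" using pl L1 by linarith
  have "216 * real R * real p \<le> 216 * real R * (15 * L)" using pL by (intro mult_left_mono) auto
  also have "\<dots> \<le> 1000000 * real R * L" using R1 L1 by simp
  finally have J2p: "216 * real R * real p \<le> real J2" using J2L by linarith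
  have p3: "2 * real R / 3 ^ p \<le> T"
    using p \<delta> by (simp add: T_def field_simps)
  have J2e: "46656 * real R / (real J2 * T) \<le> \<epsilon>"
  proof -
    have "1000000 * real R * (1 / (\<epsilon> * \<delta>)) \<le> 1000000 * real R * L"
      unfolding L_def by (intro mult_left_mono) auto
    then have J: "1000000 * real R * (1 / (\<epsilon> * \<delta>)) \<le> real J2" using J2L by linarith
    then have JJ: "1000000 * real R \<le> real J2 * (\<epsilon> * \<delta>)" using ed by (simp add: field_simps)
    have "1000000 * real R * (1 / (\<epsilon> * \<delta>)) > 0" using ed R1 by simp
    then have J20: "real J2 > 0" using J by linarith
    have "46656 * real R * 3 \<le> 1000000 * real R" using R1 by simp
    also note JJ
    finally have "46656 * real R \<le> \<epsilon> * (real J2 * T)" by (simp add: T_def field_simps)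
    moreover have "real J2 * T > 0" using J20 T by simp
    ultimately show ?thesis by (simp only: pos_divide_le_eq)
  qed
  have "1 - T - 2 * T \<le> measure_pmf.prob
          (bind_pmf P (\<lambda>\<Psi>. sampling_pmf J2 D (proportional_pmf D (approx_lev_score Ane (\<Sigma>1 \<Psi>) (V1 \<Psi>)) q0)))
          {S. sketch_succeeds \<epsilon> (Is ! n) R Ane Xn S}"
  proof (rule prob_bind_pmf_ge[OF fin _ _ G])
    fix \<Psi> assume \<Psi>: "\<Psi> \<in> set_pmf P" and good: "\<Psi> \<in> G"
    have "\<bar>sq_app \<Psi> (app Ane x) - ip D (app Ane x) (app Ane x)\<bar> \<le> 1 / 2 * ip D (app Ane x) (app Ane x)" for x
      using good[unfolded G_def mem_Collect_eq, THEN spec, of x] by (simp only: vapp)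
    then show "1 - 2 * T \<le> measure_pmf.prob
          (sampling_pmf J2 D (proportional_pmf D (approx_lev_score Ane (\<Sigma>1 \<Psi>) (V1 \<Psi>)) q0))
          {S. sketch_succeeds \<epsilon> (Is ! n) R Ane Xn S}"
      by (rule leverage_sampling_least_squares[OF Psi[OF \<Psi>] Ane Xn bspec[OF svd \<Psi>] nz _ R T(1) \<open>odd p\<close> p3 J2p \<epsilon>(1) J2e])
  qed (use T in simp)
  moreover have "1 - T - 2 * T = 1 - \<delta>" by (simp add: T_def)
  ultimately show ?thesis by (simp only:)
qed

theorem theorem9:
  shows "\<exists>c::real. c > 0 \<and>
    (\<forall>(N::nat) (n::nat) (R::nat) (Is::nat list) (X :: nat list \<Rightarrow> real) (A :: nat \<Rightarrow> real mat)
      (\<epsilon>::real) (\<delta>::real) (J1::nat) (J2::nat) (P :: real mat pmf)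
      (U1 :: real mat \<Rightarrow> real mat) (\<Sigma>1 :: real mat \<Rightarrow> real mat) (V1 :: real mat \<Rightarrow> real mat)
      (q0 :: nat pmf).
      let v = rev (omit n [0..<N]);
          D = prod_list (omit n Is);
          Ane = khatri_rao_list R (map A v);
          Xn = mode_unfolding Is n X;
          q = (\<lambda>\<Psi>. proportional_pmf D (approx_lev_score Ane (\<Sigma>1 \<Psi>) (V1 \<Psi>)) q0)
      in
        N \<ge> 2 \<longrightarrow> n < N \<longrightarrow> R \<ge> 1 \<longrightarrow> length Is = N \<longrightarrow> (\<forall>I\<in>set Is. I \<ge> 1) \<longrightarrow>
        (\<forall>j<N. j \<noteq> n \<longrightarrow> A j \<in> carrier_mat (Is ! j) R) \<longrightarrow>
        Ane \<noteq> 0\<^sub>m D R \<longrightarrow>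
        0 < \<epsilon> \<longrightarrow> \<epsilon> < 1 \<longrightarrow> 0 < \<delta> \<longrightarrow> \<delta> < 1 \<longrightarrow>
        is_recursive_sketch J1 (map (\<lambda>j. Is ! j) v) P \<longrightarrow>
        (\<forall>\<Psi>\<in>set_pmf P. is_compact_svd (\<Psi> * Ane) (U1 \<Psi>) (\<Sigma>1 \<Psi>) (V1 \<Psi>)) \<longrightarrow>
        set_pmf q0 \<subseteq> {..<D} \<longrightarrow>
        real J1 \<ge> c * real N * (real R)\<^sup>2 / \<delta> \<longrightarrow>
        real J2 \<ge> c * real R * max (ln (real R / \<delta>)) (1 / (\<epsilon> * \<delta>)) \<longrightarrow>
        measure_pmf.prob
          (bind_pmf P (\<lambda>\<Psi>. sampling_pmf J2 D (q \<Psi>)))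
          {S. \<forall>At.
             is_arg_min (\<lambda>B. frob_norm (S * Ane * transpose_mat B - S * transpose_mat Xn))
               (\<lambda>B. B \<in> carrier_mat (Is ! n) R) At \<longrightarrow>
             frob_norm (Ane * transpose_mat At - transpose_mat Xn) \<le>
               (1 + \<epsilon>) * (INF B\<in>carrier_mat (Is ! n) R.
                             frob_norm (Ane * transpose_mat B - transpose_mat Xn))}
        \<ge> 1 - \<delta>)"
  unfolding Let_def
  by (rule exI[of _ 1000000], rule conjI, simp, intro allI impI)
     (rule sketched_leverage_score_least_squares[OF refl refl refl refl, unfolded sketch_succeeds_def]; assumption)

end
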